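(* Fix $\alpha>0$. Let $\mathbf{u}_h=\tfrac12\nabla^\perp h\in W^{3,2}_{\mathrm{div}}(\mathbb{T}^2;\mathbb{R}^2)$, $f\in W^{2,2}(\mathbb{T}^2)$ and $(b_0,\omega_0)\in\mathcal{M}=W^{3,2}(\mathbb{T}^2)\times W^{2,2}(\mathbb{T}^2)$, and let $(b^\alpha,\omega^\alpha,T^\alpha_{\max})$ be a maximal solution of the $\alpha$-TQG system with data $\mathbf{u}_h,f$ and initial condition $(b_0,\omega_0)$. If $T^\alpha_{\max}<\infty$, then $$\int_0^{T^\alpha_{\max}}\|\nabla b^\alpha(t)\|_{1,2}\,dt=\infty.$$
   Context: $\mathbb{T}^2$ is the two-dimensional flat torus, $\nabla^\perp=(-\partial_y,\partial_x)$, $W^{k,2}(\mathbb{T}^2)$ are the usual $L^2$-based Sobolev spaces with norm $\|\cdot\|_{k,2}$, and $W^{k,2}_{\mathrm{div}}(\mathbb{T}^2;\mathbb{R}^2)$ is the space of weakly divergence-free vector fields in $W^{k,2}$. $\mathcal{M}=W^{3,2}(\mathbb{T}^2)\times W^{2,2}(\mathbb{T}^2)$ has norm $\|(b,\omega)\|_{\mathcal{M}}=\|b\|_{3,2}+\|\omega\|_{2,2}$. Standing assumption: all functions under consideration have zero average over $\mathbb{T}^2$. The $\alpha$-TQG system ($\alpha>0$) for $(b^\alpha,\omega^\alpha)$ is $$\partial_t b^\alpha+\mathbf{u}^\alpha\cdot\nabla b^\alpha=0,\qquad \partial_t\omega^\alpha+\mathbf{u}^\alpha\cdot\nabla(\omega^\alpha-b^\alpha)=-\mathbf{u}_h\cdot\nabla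 b^\alpha,$$ $$\mathbf{u}^\alpha=\nabla^\perp\psi^\alpha,\qquad \mathbf{u}_h=\tfrac12\nabla^\perp h,\qquad \omega^\alpha=(\Delta-1)(1-\alpha\Delta)\psi^\alpha+f,$$ where $h$ and $f$ are given time-independent functions. Local strong solution: given $T>0$, $(b^\alpha,\omega^\alpha,T)$ is a local strong solution with initial condition $(b_0,\omega_0)$ if $b^\alpha\in C([0,T];W^{3,2}(\mathbb{T}^2))$, $\omega^\alpha\in C([0,T];W^{2,2}(\mathbb{T}^2))$, and for all $t\in[0,T]$ $$b^\alpha(t)=b_0-\int_0^t\mathrm{div}(b^\alpha\mathbf{u}^\alpha)\,d\tau,\qquad \omega^\alpha(t)=\omega_0-\int_0^t\big[\mathrm{div}((\omega^\alpha-b^\alpha)\mathbf{u}^\alpha)+\mathrm{div}(b^\alpha\mathbf{u}_h)\big]\,d\tau,$$ with $\mathbf{u}^\alpha=\nabla^\perp(1-\alpha\Delta)^{-1}(\Delta-1)^{-1}(\omega^\alpha-f)$. Maximal solution: $(b^\alpha,\omega^\alpha,T^\alpha_{\max})$ is a maximal solution with initial condition $(b_0,\omega_0)$ if (i) there is an increasing sequence of times $(T_n)_{n\in\mathbb{N}}$ with limit $T^\alpha_{\max}\in(0,\infty]$; (ii) for each $n$, $(b^\alpha,\omega^\alpha,T_n)$ is a local strong solution with initial condition $(b_0,\omega_0)$; (iii) if $T^\alpha_{\max}<\infty$, then $\limsup_{T_n\to T^\alpha_{\max}}\|(b^\alpha,\omega^\alpha)(T_n)\|_{\mathcal{M}}^2=\infty$.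 *)

theory Defs
  imports "HOL-Analysis.Analysis"
begin

section \<open>The Hilbert space of square integrable functions on the flat torus\<close>

text \<open>
  The flat torus is the quotient of the plane by the integer lattice. As a measure space it is the
  half-open unit cell with Lebesgue measure; periodicity only enters through the test functions.
\<close>

definition T2 :: "(real \<times> real) measure" where
  "T2 = restrict_space lborel ({0..<1} \<times> {0..<1})"

definition sq_integrable :: "(real \<times> real \<Rightarrow> real) \<Rightarrow> bool" where
  "sq_integrable f \<longleftrightarrow> f \<in> borel_measurable T2 \<and> integrable T2 (\<lambda>p. (f p)\<^sup>2)"

definition L2_rel :: "(real \<times> real \<Rightarrow> real) \<Rightarrow> (real \<times> real \<Rightarrow> real) \<Rightarrow> bool" where
  "L2_rel f g \<longleftrightarrow> sq_integrable f \<and> sq_integrable g \<and> (AE p in T2. f p = g p)"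

lemma cell_borel: "{0..<1} \<times> {0..<1} \<in> sets (lborel :: (real \<times> real) measure)"
  unfolding lborel_prod[symmetric] by (intro pair_measureI) auto

lemma emeasure_T2_space: "emeasure T2 (space T2) = 1"
proof -
  have "emeasure T2 (space T2) = emeasure lborel ({0..<1} \<times> {0..<1} :: (real \<times> real) set)"
    unfolding T2_def using cell_borel
    by (subst emeasure_restrict_space) (auto simp: space_restrict_space)
  also have "\<dots> = emeasure lborel {0..<1::real} * emeasure lborel {0..<1::real}"
    unfolding lborel_prod[symmetric] by (rule lborel.emeasure_pair_measure_Times) auto
  finally show ?thesis by simp
qed

lemma finite_measure_T2: "finite_measure T2"
  by (rule finite_measureI) (simp add: emeasure_T2_space)

lemma measure_T2_space: "measure T2 (space T2) = 1"
  by (simp add: measure_def emeasure_T2_space)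

lemma sq_integrable_mult:
  assumes "sq_integrable f" "sq_integrable g"
  shows "integrable T2 (\<lambda>p. f p * g p)"
proof (rule Bochner_Integration.integrable_bound)
  show "integrable T2 (\<lambda>p. (f p)\<^sup>2 + (g p)\<^sup>2)"
    using assms by (auto simp: sq_integrable_def)
  show "(\<lambda>p. f p * g p) \<in> borel_measurable T2"
    using assms by (auto simp: sq_integrable_def)
  have "\<bar>x * y\<bar> \<le> \<bar>x\<^sup>2 + y\<^sup>2\<bar>" for x y :: real
  proof -
    have "2 * (\<bar>x\<bar> * \<bar>y\<bar>) \<le> x\<^sup>2 + y\<^sup>2"
      using sum_squares_bound[of "\<bar>x\<bar>" "\<bar>y\<bar>"] by simp
    moreover have "0 \<le> \<bar>x\<bar> * \<bar>y\<bar>" by simp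
    ultimately have "\<bar>x\<bar> * \<bar>y\<bar> \<le> x\<^sup>2 + y\<^sup>2" by linarith
    then show ?thesis by (simp add: abs_mult)
  qed
  then show "AE p in T2. norm (f p * g p) \<le> norm ((f p)\<^sup>2 + (g p)\<^sup>2)"
    by simp
qed

lemma sq_integrable_const: "sq_integrable (\<lambda>_. c)"
  using finite_measure.integrable_const[OF finite_measure_T2] by (auto simp: sq_integrable_def)

lemma sq_integrable_add:
  assumes "sq_integrable f" "sq_integrable g"
  shows "sq_integrable (\<lambda>p. f p + g p)"
  unfolding sq_integrable_def
proof
  have "integrable T2 (\<lambda>p. (f p)\<^sup>2 + (g p)\<^sup>2 + 2 * (f p * g p))"
    using assms sq_integrable_mult[OF assms]
    by (intro Bochner_Integration.integrable_add integrable_mult_right)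
      (auto simp: sq_integrable_def)
  then show "integrable T2 (\<lambda>p. (f p + g p)\<^sup>2)"
    by (simp add: power2_sum mult.assoc)
qed (use assms in \<open>auto simp: sq_integrable_def\<close>)

lemma sq_integrable_scale:
  assumes "sq_integrable f"
  shows "sq_integrable (\<lambda>p. c * f p)"
  using assms by (auto simp: sq_integrable_def power_mult_distrib)

lemma sq_integrable_diff:
  assumes "sq_integrable f" "sq_integrable g"
  shows "sq_integrable (\<lambda>p. f p - g p)"
  using sq_integrable_add[OF assms(1) sq_integrable_scale[OF assms(2), of "-1"]] by simp

lemma sq_integrable_integrable:
  assumes "sq_integrable f"
  shows "integrable T2 f"
  using sq_integrable_mult[OF assms sq_integrable_const[of 1]] by simp

quotient_type L2T = "real \<times> real \<Rightarrow> real" / partial: L2_rel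
proof (rule part_equivpI)
  show "\<exists>f. L2_rel f f"
    using sq_integrable_const[of 0] by (auto simp: L2_rel_def)
  show "symp L2_rel"
    by (auto simp: symp_def L2_rel_def)
  show "transp L2_rel"
    by (auto simp: transp_def L2_rel_def elim: AE_mp)
qed

text \<open>An arbitrary representative of a class; it is only ever used under the integral sign.\<close>

definition fun_of :: "L2T \<Rightarrow> real \<times> real \<Rightarrow> real" where
  "fun_of = rep_L2T"

definition class_of :: "(real \<times> real \<Rightarrow> real) \<Rightarrow> L2T" where
  "class_of = abs_L2T"

lemma sq_integrable_fun_of: "sq_integrable (fun_of v)"
  using Quotient_rep_reflp[OF Quotient_L2T, of v] by (simp add: fun_of_def L2_rel_def)

lemma class_of_fun_of [simp]: "class_of (fun_of v) = v"
  using Quotient_abs_rep[OF Quotient_L2T] by (simp add: fun_of_def class_of_def)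

lemma class_of_eq_iff:
  assumes "sq_integrable f" "sq_integrable g"
  shows "class_of f = class_of g \<longleftrightarrow> (AE p in T2. f p = g p)"
  using assms Quotient_rel[OF Quotient_L2T, of f g] by (auto simp: class_of_def L2_rel_def)

lemma fun_of_class_of:
  assumes "sq_integrable f"
  shows "AE p in T2. fun_of (class_of f) p = f p"
  using class_of_eq_iff[OF sq_integrable_fun_of assms, of "class_of f"] by simp

lemma L2T_eqI:
  assumes "AE p in T2. fun_of v p = fun_of w p"
  shows "v = w"
  using class_of_eq_iff[OF sq_integrable_fun_of sq_integrable_fun_of, of v w] assms by simp

instantiation L2T :: real_inner
begin

definition zero_L2T :: L2T where
  "0 = class_of (\<lambda>_. 0)"

definition plus_L2T :: "L2T \<Rightarrow> L2T \<Rightarrow> L2T" where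
  "v + w = class_of (\<lambda>p. fun_of v p + fun_of w p)"

definition minus_L2T :: "L2T \<Rightarrow> L2T \<Rightarrow> L2T" where
  "v - w = class_of (\<lambda>p. fun_of v p - fun_of w p)"

definition uminus_L2T :: "L2T \<Rightarrow> L2T" where
  "- v = class_of (\<lambda>p. - fun_of v p)"

definition scaleR_L2T :: "real \<Rightarrow> L2T \<Rightarrow> L2T" where
  "c *\<^sub>R v = class_of (\<lambda>p. c * fun_of v p)"

definition inner_L2T :: "L2T \<Rightarrow> L2T \<Rightarrow> real" where
  "inner v w = (LINT p|T2. fun_of v p * fun_of w p)"

definition norm_L2T :: "L2T \<Rightarrow> real" where
  "norm v = sqrt (inner v v)" for v :: L2T

definition sgn_L2T :: "L2T \<Rightarrow> L2T" where
  "sgn v = inverse (norm v) *\<^sub>R v" for v :: L2T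

definition dist_L2T :: "L2T \<Rightarrow> L2T \<Rightarrow> real" where
  "dist v w = norm (v - w)" for v w :: L2T

definition uniformity_L2T :: "(L2T \<times> L2T) filter" where
  "uniformity_L2T = (INF e\<in>{0<..}. principal {(v, w). dist v w < e})"

definition open_L2T :: "L2T set \<Rightarrow> bool" where
  "open_L2T U = (\<forall>v\<in>U. eventually (\<lambda>(v', w). v' = v \<longrightarrow> w \<in> U) uniformity)"

lemma fun_of_zero: "AE p in T2. fun_of 0 p = 0"
  unfolding zero_L2T_def by (rule fun_of_class_of[OF sq_integrable_const])

lemma fun_of_add: "AE p in T2. fun_of (v + w) p = fun_of v p + fun_of w p"
  unfolding plus_L2T_def
  by (rule fun_of_class_of[OF sq_integrable_add[OF sq_integrable_fun_of sq_integrable_fun_of]])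

lemma fun_of_diff: "AE p in T2. fun_of (v - w) p = fun_of v p - fun_of w p"
  unfolding minus_L2T_def
  by (rule fun_of_class_of[OF sq_integrable_diff[OF sq_integrable_fun_of sq_integrable_fun_of]])

lemma fun_of_scaleR: "AE p in T2. fun_of (c *\<^sub>R v) p = c * fun_of v p"
  unfolding scaleR_L2T_def
  by (rule fun_of_class_of[OF sq_integrable_scale[OF sq_integrable_fun_of]])

lemma fun_of_uminus: "AE p in T2. fun_of (- v) p = - fun_of v p"
  unfolding uminus_L2T_def
  using fun_of_class_of[OF sq_integrable_scale[OF sq_integrable_fun_of, of "-1" v]] by simp

lemma fun_of_measurable [measurable]: "fun_of v \<in> borel_measurable T2"
  using sq_integrable_fun_of by (simp add: sq_integrable_def)

lemma integrable_fun_of_mult: "integrable T2 (\<lambda>p. fun_of v p * fun_of w p)"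
  by (rule sq_integrable_mult[OF sq_integrable_fun_of sq_integrable_fun_of])

instance
proof
  fix u v w :: L2T and c d :: real
  show "u + v + w = u + (v + w)"
  proof (rule L2T_eqI)
    show "AE p in T2. fun_of (u + v + w) p = fun_of (u + (v + w)) p"
      using fun_of_add[of "u + v" w] fun_of_add[of u v] fun_of_add[of v w] fun_of_add[of u "v + w"]
      by eventually_elim simp
  qed
  show "v + w = w + v"
    by (simp add: plus_L2T_def add.commute)
  show "0 + v = v"
  proof (rule L2T_eqI)
    show "AE p in T2. fun_of (0 + v) p = fun_of v p"
      using fun_of_add[of 0 v] fun_of_zero by eventually_elim simp
  qed
  show "- v + v = 0"
  proof (rule L2T_eqI)
    show "AE p in T2. fun_of (- v + v) p = fun_of 0 p"
      using fun_of_add[of "- v" v] fun_of_uminus[of v] fun_of_zero by eventually_elim simp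
  qed
  show "v - w = v + - w"
  proof (rule L2T_eqI)
    show "AE p in T2. fun_of (v - w) p = fun_of (v + - w) p"
      using fun_of_add[of v "- w"] fun_of_uminus[of w] fun_of_diff[of v w] by eventually_elim simp
  qed
  show "c *\<^sub>R (v + w) = c *\<^sub>R v + c *\<^sub>R w"
  proof (rule L2T_eqI)
    show "AE p in T2. fun_of (c *\<^sub>R (v + w)) p = fun_of (c *\<^sub>R v + c *\<^sub>R w) p"
      using fun_of_add[of v w] fun_of_add[of "c *\<^sub>R v" "c *\<^sub>R w"]
        fun_of_scaleR[of c v] fun_of_scaleR[of c w] fun_of_scaleR[of c "v + w"]
      by eventually_elim (simp add: distrib_left)
  qed
  show "(c + d) *\<^sub>R v = c *\<^sub>R v + d *\<^sub>R v"
  proof (rule L2T_eqI)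
    show "AE p in T2. fun_of ((c + d) *\<^sub>R v) p = fun_of (c *\<^sub>R v + d *\<^sub>R v) p"
      using fun_of_add[of "c *\<^sub>R v" "d *\<^sub>R v"]
        fun_of_scaleR[of c v] fun_of_scaleR[of d v] fun_of_scaleR[of "c + d" v]
      by eventually_elim (simp add: distrib_right)
  qed
  show "c *\<^sub>R d *\<^sub>R v = (c * d) *\<^sub>R v"
  proof (rule L2T_eqI)
    show "AE p in T2. fun_of (c *\<^sub>R d *\<^sub>R v) p = fun_of ((c * d) *\<^sub>R v) p"
      using fun_of_scaleR[of c "d *\<^sub>R v"] fun_of_scaleR[of d v] fun_of_scaleR[of "c * d" v]
      by eventually_elim simp
  qed
  show "1 *\<^sub>R v = v"
  proof (rule L2T_eqI)
    show "AE p in T2. fun_of (1 *\<^sub>R v) p = fun_of v p"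
      using fun_of_scaleR[of 1 v] by eventually_elim simp
  qed
  show "inner v w = inner w v"
    by (simp add: inner_L2T_def mult.commute)
  show "inner (u + v) w = inner u w + inner v w"
  proof -
    have "inner (u + v) w = (LINT p|T2. fun_of u p * fun_of w p + fun_of v p * fun_of w p)"
      unfolding inner_L2T_def
    proof (rule integral_cong_AE)
      show "AE p in T2. fun_of (u + v) p * fun_of w p
          = fun_of u p * fun_of w p + fun_of v p * fun_of w p"
        using fun_of_add[of u v] by eventually_elim (simp add: distrib_right)
    qed measurable
    then show ?thesis
      by (simp add: inner_L2T_def integrable_fun_of_mult)
  qed
  show "inner (c *\<^sub>R v) w = c * inner v w"
  proof -
    have "inner (c *\<^sub>R v) w = (LINT p|T2. c * (fun_of v p * fun_of w p))"
      unfolding inner_L2T_def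
    proof (rule integral_cong_AE)
      show "AE p in T2. fun_of (c *\<^sub>R v) p * fun_of w p = c * (fun_of v p * fun_of w p)"
        using fun_of_scaleR[of c v] by eventually_elim simp
    qed measurable
    then show ?thesis
      by (simp add: inner_L2T_def)
  qed
  show "0 \<le> inner v v"
    by (simp add: inner_L2T_def)
  show "inner v v = 0 \<longleftrightarrow> v = 0"
  proof
    assume "inner v v = 0"
    then have "AE p in T2. fun_of v p * fun_of v p = 0"
      using integral_nonneg_eq_0_iff_AE[OF integrable_fun_of_mult[of v v]]
      by (simp add: inner_L2T_def)
    then have "AE p in T2. fun_of v p = fun_of 0 p"
      using fun_of_zero by eventually_elim simp
    then show "v = 0" by (rule L2T_eqI)
  next
    assume "v = 0"
    have "(LINT p|T2. fun_of 0 p * fun_of 0 p) = (LINT p|T2. 0)"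
    proof (rule integral_cong_AE)
      show "AE p in T2. fun_of 0 p * fun_of 0 p = 0"
        using fun_of_zero by eventually_elim simp
    qed measurable
    then show "inner v v = 0"
      by (simp add: inner_L2T_def \<open>v = 0\<close>)
  qed
  show "norm v = sqrt (inner v v)" by (rule norm_L2T_def)
  show "sgn v = inverse (norm v) *\<^sub>R v" by (rule sgn_L2T_def)
  show "dist v w = norm (v - w)" by (rule dist_L2T_def)
  show "uniformity = (INF e\<in>{0<..}. principal {(v::L2T, w). dist v w < e})"
    by (rule uniformity_L2T_def)
  show "open U = (\<forall>v\<in>U. eventually (\<lambda>(v', w). v' = v \<longrightarrow> w \<in> U) uniformity)" for U :: "L2T set"
    by (rule open_L2T_def)
qed

end

lemma norm_class_of:
  assumes "sq_integrable f"
  shows "(norm (class_of f))\<^sup>2 = (LINT p|T2. (f p)\<^sup>2)"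
proof -
  have "(norm (class_of f))\<^sup>2 = (LINT p|T2. fun_of (class_of f) p * fun_of (class_of f) p)"
    by (simp add: dot_square_norm[symmetric] inner_L2T_def)
  also have "\<dots> = (LINT p|T2. (f p)\<^sup>2)"
  proof (rule integral_cong_AE)
    show "AE p in T2. fun_of (class_of f) p * fun_of (class_of f) p = (f p)\<^sup>2"
      using fun_of_class_of[OF assms] by eventually_elim (simp add: power2_eq_square)
    show "(\<lambda>p. (f p)\<^sup>2) \<in> borel_measurable T2"
      using assms by (auto simp: sq_integrable_def)
  qed measurable
  finally show ?thesis .
qed

lemma norm_diff_L2T: "(norm (v - w))\<^sup>2 = (LINT p|T2. (fun_of v p - fun_of w p)\<^sup>2)"
  unfolding minus_L2T_def
  by (rule norm_class_of[OF sq_integrable_diff[OF sq_integrable_fun_of sq_integrable_fun_of]])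

lemma L1_le_norm_diff: "(LINT p|T2. \<bar>fun_of v p - fun_of w p\<bar>) \<le> norm (v - w)"
proof -
  let ?f = "\<lambda>p. \<bar>fun_of v p - fun_of w p\<bar>"
  have f: "sq_integrable ?f"
    using sq_integrable_diff[OF sq_integrable_fun_of[of v] sq_integrable_fun_of[of w]]
    by (auto simp: sq_integrable_def)
  have "inner (class_of ?f) (class_of (\<lambda>_. 1)) \<le> norm (class_of ?f) * norm (class_of (\<lambda>_. 1))"
    by (rule norm_cauchy_schwarz)
  moreover have "inner (class_of ?f) (class_of (\<lambda>_. 1)) = (LINT p|T2. ?f p)"
    unfolding inner_L2T_def
  proof (rule integral_cong_AE)
    show "AE p in T2. fun_of (class_of ?f) p * fun_of (class_of (\<lambda>_. 1)) p = ?f p"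
      using fun_of_class_of[OF f] fun_of_class_of[OF sq_integrable_const[of 1]]
      by eventually_elim simp
  qed measurable
  moreover have "norm (class_of (\<lambda>_. 1)) = 1"
  proof -
    have "(norm (class_of (\<lambda>_. 1)))\<^sup>2 = 1"
      using norm_class_of[OF sq_integrable_const[of 1]] by (simp add: measure_T2_space)
    then show ?thesis by (simp add: power2_eq_1_iff) (metis norm_ge_zero neg_0_le_iff_le not_one_le_zero)
  qed
  moreover have "(norm (class_of ?f))\<^sup>2 = (norm (v - w))\<^sup>2"
    using norm_class_of[OF f] norm_diff_L2T[of v w] by simp
  then have "norm (class_of ?f) = norm (v - w)"
    by (simp add: power2_eq_iff_nonneg)
  ultimately show ?thesis by simp
qed

instance L2T :: complete_space
proof
  fix X :: "nat \<Rightarrow> L2T"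
  assume X: "Cauchy X"
  have "\<forall>n. \<exists>N. \<forall>k\<ge>N. \<forall>m\<ge>N. norm (X k - X m) < (1/2)^n"
    using X unfolding Cauchy_def dist_norm by simp
  then obtain N where N: "\<And>n k m. k \<ge> N n \<Longrightarrow> m \<ge> N n \<Longrightarrow> norm (X k - X m) < (1/2)^n"
    by metis
  define r where "r n = n + (\<Sum>i\<le>n. N i)" for n
  have r: "strict_mono r"
    by (rule strict_mono_Suc_iff[THEN iffD2]) (simp add: r_def)
  have rN: "r n \<ge> N k" if "k \<le> n" for n k
  proof -
    have "N k \<le> (\<Sum>i\<le>n. N i)" using that by (intro member_le_sum) auto
    then show ?thesis by (simp add: r_def)
  qed
  define F where "F n = fun_of (X (r n))" for n
  have F_meas [measurable]: "F n \<in> borel_measurable T2" for n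
    by (simp add: F_def)
  define d where "d n p = \<bar>F (Suc n) p - F n p\<bar>" for n p
  have d_meas [measurable]: "d n \<in> borel_measurable T2" for n
    unfolding d_def by measurable
  have d_int: "integrable T2 (d n)" for n
    unfolding d_def F_def
    by (intro integrable_abs Bochner_Integration.integrable_diff sq_integrable_integrable
        sq_integrable_fun_of)
  have d_le: "(\<integral>\<^sup>+p. ennreal (d n p) \<partial>T2) \<le> ennreal ((1/2)^n)" for n
  proof -
    have "(\<integral>\<^sup>+p. ennreal (d n p) \<partial>T2) = ennreal (LINT p|T2. d n p)"
      by (rule nn_integral_eq_integral[OF d_int]) (simp add: d_def)
    moreover have "(LINT p|T2. d n p) \<le> (1/2)^n"
      using L1_le_norm_diff[of "X (r (Suc n))" "X (r n)"] N[of n "r (Suc n)" "r n"]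
        rN[of n "Suc n"] rN[of n n] by (simp add: d_def F_def)
    ultimately show ?thesis by (simp add: ennreal_leI)
  qed
  have "(\<integral>\<^sup>+p. (\<Sum>n. ennreal (d n p)) \<partial>T2) = (\<Sum>n. \<integral>\<^sup>+p. ennreal (d n p) \<partial>T2)"
    by (rule nn_integral_suminf) measurable
  also have "\<dots> \<le> (\<Sum>n. ennreal ((1/2)^n))"
    by (intro suminf_le d_le) auto
  also have "\<dots> = ennreal (\<Sum>n. (1/2)^n)"
    by (rule suminf_ennreal2) (auto intro: summable_geometric)
  also have "\<dots> < \<infinity>" by simp
  finally have "(\<integral>\<^sup>+p. (\<Sum>n. ennreal (d n p)) \<partial>T2) \<noteq> \<infinity>" by simp
  then have "AE p in T2. (\<Sum>n. ennreal (d n p)) \<noteq> \<infinity>"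
    by (intro nn_integral_PInf_AE) auto
  then have conv: "AE p in T2. convergent (\<lambda>n. F n p)"
  proof eventually_elim
    case (elim p)
    then have "summable (\<lambda>n. d n p)"
      by (intro summable_suminf_not_top) (auto simp: d_def)
    then have "summable (\<lambda>n. F (Suc n) p - F n p)"
      unfolding d_def by (rule summable_rabs_cancel)
    then have "convergent (\<lambda>n. \<Sum>i<n. F (Suc i) p - F i p)"
      by (simp add: summable_iff_convergent)
    moreover have "(\<lambda>n. \<Sum>i<n. F (Suc i) p - F i p) = (\<lambda>n. F n p - F 0 p)"
      by (rule ext) (rule sum_lessThan_telescope)
    ultimately have "convergent (\<lambda>n. F n p - F 0 p)"
      by (rule back_subst)
    then have "convergent (\<lambda>n. F n p - F 0 p + F 0 p)"
      by (rule convergent_add[OF _ convergent_const])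
    then show ?case by simp
  qed
  define L where "L p = lim (\<lambda>n. F n p)" for p
  have L_meas [measurable]: "L \<in> borel_measurable T2"
    unfolding L_def by measurable
  have lim: "AE p in T2. (\<lambda>n. F n p) \<longlonglongrightarrow> L p"
    using conv by eventually_elim (simp add: L_def convergent_LIMSEQ_iff)
  have fatou: "(\<integral>\<^sup>+p. ennreal ((F m p - L p)\<^sup>2) \<partial>T2) \<le> ennreal (((1/2)^m)\<^sup>2)" for m
  proof -
    have "(\<integral>\<^sup>+p. ennreal ((F m p - L p)\<^sup>2) \<partial>T2)
        = (\<integral>\<^sup>+p. liminf (\<lambda>n. ennreal ((F m p - F n p)\<^sup>2)) \<partial>T2)"
    proof (rule nn_integral_cong_AE)
      show "AE p in T2. ennreal ((F m p - L p)\<^sup>2) = liminf (\<lambda>n. ennreal ((F m p - F n p)\<^sup>2))"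
        using lim
      proof eventually_elim
        case (elim p)
        have "(\<lambda>n. ennreal ((F m p - F n p)\<^sup>2)) \<longlonglongrightarrow> ennreal ((F m p - L p)\<^sup>2)"
          by (intro tendsto_intros elim)
        then show ?case by (rule lim_imp_Liminf[OF trivial_limit_sequentially, symmetric])
      qed
    qed
    also have "\<dots> \<le> liminf (\<lambda>n. \<integral>\<^sup>+p. ennreal ((F m p - F n p)\<^sup>2) \<partial>T2)"
      by (rule nn_integral_liminf) measurable
    also have "\<dots> \<le> liminf (\<lambda>n. ennreal (((1/2)^m)\<^sup>2))"
    proof (rule Liminf_mono)
      show "\<forall>\<^sub>F n in sequentially. (\<integral>\<^sup>+p. ennreal ((F m p - F n p)\<^sup>2) \<partial>T2) \<le> ennreal (((1/2)^m)\<^sup>2)"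
        using eventually_ge_at_top[of m]
      proof eventually_elim
        case (elim n)
        have "(\<integral>\<^sup>+p. ennreal ((F m p - F n p)\<^sup>2) \<partial>T2) = ennreal (LINT p|T2. (F m p - F n p)\<^sup>2)"
          using sq_integrable_diff[OF sq_integrable_fun_of sq_integrable_fun_of,
              of "X (r m)" "X (r n)"]
          by (intro nn_integral_eq_integral) (auto simp: F_def sq_integrable_def)
        also have "\<dots> = ennreal ((norm (X (r m) - X (r n)))\<^sup>2)"
          by (simp add: norm_diff_L2T F_def)
        also have "\<dots> \<le> ennreal (((1/2)^m)\<^sup>2)"
          using N[of m "r m" "r n"] rN[of m m] rN[of m n] elim
          by (intro ennreal_leI power_mono) auto
        finally show ?case .
      qed
    qed
    also have "\<dots> = ennreal (((1/2)^m)\<^sup>2)"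
      by (simp add: Liminf_const)
    finally show ?thesis .
  qed
  have sqFL: "sq_integrable (\<lambda>p. F m p - L p)" for m
    unfolding sq_integrable_def
  proof
    show "integrable T2 (\<lambda>p. (F m p - L p)\<^sup>2)"
    proof (rule integrableI_nonneg)
      show "(\<integral>\<^sup>+p. ennreal ((F m p - L p)\<^sup>2) \<partial>T2) < \<infinity>"
        using fatou[of m] by (rule le_less_trans) simp
    qed auto
  qed measurable
  have sqL: "sq_integrable L"
    using sq_integrable_diff[OF sq_integrable_fun_of sqFL, of "X (r 0)" 0] by (simp add: F_def)
  have bound: "norm (X (r m) - class_of L) \<le> (1/2)^m" for m
  proof -
    have "ennreal ((norm (X (r m) - class_of L))\<^sup>2)
        = ennreal (LINT p|T2. (F m p - fun_of (class_of L) p)\<^sup>2)"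
      by (simp add: norm_diff_L2T F_def)
    also have "(LINT p|T2. (F m p - fun_of (class_of L) p)\<^sup>2) = (LINT p|T2. (F m p - L p)\<^sup>2)"
    proof (rule integral_cong_AE)
      show "AE p in T2. (F m p - fun_of (class_of L) p)\<^sup>2 = (F m p - L p)\<^sup>2"
        using fun_of_class_of[OF sqL] by eventually_elim simp
    qed measurable
    also have "ennreal \<dots> = (\<integral>\<^sup>+p. ennreal ((F m p - L p)\<^sup>2) \<partial>T2)"
      using sqFL[of m] by (intro nn_integral_eq_integral[symmetric]) (auto simp: sq_integrable_def)
    also have "\<dots> \<le> ennreal (((1/2)^m)\<^sup>2)" by (rule fatou)
    finally have "(norm (X (r m) - class_of L))\<^sup>2 \<le> ((1/2)^m)\<^sup>2"
      by (simp add: ennreal_le_iff)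
    then show ?thesis by (rule power2_le_imp_le) simp
  qed
  have "(\<lambda>m. X (r m) - class_of L) \<longlonglongrightarrow> 0"
  proof (rule Lim_null_comparison)
    show "\<forall>\<^sub>F m in sequentially. norm (X (r m) - class_of L) \<le> (1/2)^m"
      using bound by simp
    show "(\<lambda>m. (1/2 :: real)^m) \<longlonglongrightarrow> 0"
      by (rule LIMSEQ_power_zero) simp
  qed
  then have "(X \<circ> r) \<longlonglongrightarrow> class_of L"
    by (simp add: LIM_zero_iff o_def)
  with X r show "convergent X"
    by (metis Cauchy_converges_subseq convergent_def)
qed

instance L2T :: banach ..


section \<open>Sobolev spaces on the torus\<close>

definition pd_x :: "(real \<times> real \<Rightarrow> real) \<Rightarrow> real \<times> real \<Rightarrow> real" where
  "pd_x \<phi> = (\<lambda>(x, y). deriv (\<lambda>s. \<phi> (s, y)) x)"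

definition pd_y :: "(real \<times> real \<Rightarrow> real) \<Rightarrow> real \<times> real \<Rightarrow> real" where
  "pd_y \<phi> = (\<lambda>(x, y). deriv (\<lambda>s. \<phi> (x, s)) y)"

text \<open>Infinite differentiability: partial derivatives of all orders are (Frechet) differentiable.\<close>

coinductive smooth :: "(real \<times> real \<Rightarrow> real) \<Rightarrow> bool" where
  "(\<forall>p. \<phi> differentiable (at p)) \<Longrightarrow> smooth (pd_x \<phi>) \<Longrightarrow> smooth (pd_y \<phi>) \<Longrightarrow> smooth \<phi>"

definition test_functions :: "(real \<times> real \<Rightarrow> real) set" where
  "test_functions = {\<phi>. smooth \<phi> \<and> (\<forall>x y. \<phi> (x + 1, y) = \<phi> (x, y) \<and> \<phi> (x, y + 1) = \<phi> (x, y))}"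

definition has_weak_deriv :: "L2T \<Rightarrow> nat \<Rightarrow> nat \<Rightarrow> L2T \<Rightarrow> bool" where
  "has_weak_deriv v i j g \<longleftrightarrow> (\<forall>\<phi>\<in>test_functions.
     (LINT p|T2. fun_of v p * (pd_x ^^ i) ((pd_y ^^ j) \<phi>) p)
       = (-1) ^ (i + j) * (LINT p|T2. fun_of g p * \<phi> p))"

definition wderiv :: "nat \<Rightarrow> nat \<Rightarrow> L2T \<Rightarrow> L2T" where
  "wderiv i j v = (THE g. has_weak_deriv v i j g)"

definition W :: "nat \<Rightarrow> L2T set" where
  "W k = {v. \<forall>i j. i + j \<le> k \<longrightarrow> (\<exists>g. has_weak_deriv v i j g)}"

definition sob_norm :: "nat \<Rightarrow> L2T \<Rightarrow> real" where
  "sob_norm k v = sqrt (\<Sum>(i, j)\<in>{(i, j). i + j \<le> k}. (norm (wderiv i j v))\<^sup>2)"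

definition sob_norm_vec :: "nat \<Rightarrow> L2T \<times> L2T \<Rightarrow> real" where
  "sob_norm_vec k u = sqrt ((sob_norm k (fst u))\<^sup>2 + (sob_norm k (snd u))\<^sup>2)"

definition norm_M :: "L2T \<times> L2T \<Rightarrow> real" where
  "norm_M z = sob_norm 3 (fst z) + sob_norm 2 (snd z)"

definition zero_avg :: "L2T \<Rightarrow> bool" where
  "zero_avg v \<longleftrightarrow> (LINT p|T2. fun_of v p) = 0"

definition grad :: "L2T \<Rightarrow> L2T \<times> L2T" where
  "grad v = (wderiv 1 0 v, wderiv 0 1 v)"

definition perp_grad :: "L2T \<Rightarrow> L2T \<times> L2T" where
  "perp_grad v = (- wderiv 0 1 v, wderiv 1 0 v)"

definition laplacian :: "L2T \<Rightarrow> L2T" where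
  "laplacian v = wderiv 2 0 v + wderiv 0 2 v"

definition div_free :: "L2T \<times> L2T \<Rightarrow> bool" where
  "div_free u \<longleftrightarrow> (\<forall>\<phi>\<in>test_functions.
     (LINT p|T2. fun_of (fst u) p * pd_x \<phi> p + fun_of (snd u) p * pd_y \<phi> p) = 0)"

definition W_div :: "nat \<Rightarrow> (L2T \<times> L2T) set" where
  "W_div k = {u. fst u \<in> W k \<and> snd u \<in> W k \<and> div_free u}"

text \<open>
  \<open>has_flux_div v u g\<close>: the weak divergence of the flux \<open>v u\<close> is \<open>g\<close>. The flux is a product of two
  square integrable functions, hence integrable, so that the left-hand integral is always defined.
\<close>

definition has_flux_div :: "L2T \<Rightarrow> L2T \<times> L2T \<Rightarrow> L2T \<Rightarrow> bool" where
  "has_flux_div v u g \<longleftrightarrow> (\<forall>\<phi>\<in>test_functions.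
     (LINT p|T2. fun_of v p * fun_of (fst u) p * pd_x \<phi> p + fun_of v p * fun_of (snd u) p * pd_y \<phi> p)
       = - (LINT p|T2. fun_of g p * \<phi> p))"

definition flux_div :: "L2T \<Rightarrow> L2T \<times> L2T \<Rightarrow> L2T" where
  "flux_div v u = (THE g. has_flux_div v u g)"


section \<open>The regularised thermal quasi-geostrophic system\<close>

text \<open>
  Both factors of the elliptic operator map the second-order Sobolev space bijectively onto the
  space of square integrable functions; these are their inverses.
\<close>

definition inv_laplacian_minus_1 :: "L2T \<Rightarrow> L2T" where
  "inv_laplacian_minus_1 = inv_into (W 2) (\<lambda>\<psi>. laplacian \<psi> - \<psi>)"

definition inv_1_minus_laplacian :: "real \<Rightarrow> L2T \<Rightarrow> L2T" where
  "inv_1_minus_laplacian \<alpha> = inv_into (W 2) (\<lambda>\<psi>. \<psi> - \<alpha> *\<^sub>R laplacian \<psi>)"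

definition velocity :: "real \<Rightarrow> L2T \<Rightarrow> L2T \<Rightarrow> L2T \<times> L2T" where
  "velocity \<alpha> f \<omega> = perp_grad (inv_1_minus_laplacian \<alpha> (inv_laplacian_minus_1 (\<omega> - f)))"

definition continuous_sob :: "nat \<Rightarrow> real \<Rightarrow> (real \<Rightarrow> L2T) \<Rightarrow> bool" where
  "continuous_sob k T v \<longleftrightarrow> (\<forall>t\<in>{0..T}. v t \<in> W k) \<and>
     (\<forall>t\<in>{0..T}. ((\<lambda>s. sob_norm k (v s - v t)) \<longlongrightarrow> 0) (at t within {0..T}))"

text \<open>
  The time integrals are integrals of functions with values in the Banach space \<open>L2T\<close>. The clause
  on \<open>zero_avg\<close> is the convention that all functions on the torus have zero average.
\<close>

definition local_strong_solution ::
  "real \<Rightarrow> L2T \<times> L2T \<Rightarrow> L2T \<Rightarrow> L2T \<times> L2T \<Rightarrow> (real \<Rightarrow> L2T) \<Rightarrow> (real \<Rightarrow> L2T) \<Rightarrow> real \<Rightarrow> bool" where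
  "local_strong_solution \<alpha> u\<^sub>h f z\<^sub>0 b \<omega> T \<longleftrightarrow>
     T > 0 \<and> continuous_sob 3 T b \<and> continuous_sob 2 T \<omega> \<and>
     (\<forall>t\<in>{0..T}. zero_avg (b t) \<and> zero_avg (\<omega> t)) \<and>
     (\<forall>t\<in>{0..T}.
        b t = fst z\<^sub>0 - integral {0..t} (\<lambda>\<tau>. flux_div (b \<tau>) (velocity \<alpha> f (\<omega> \<tau>))) \<and>
        \<omega> t = snd z\<^sub>0 - integral {0..t} (\<lambda>\<tau>. flux_div (\<omega> \<tau> - b \<tau>) (velocity \<alpha> f (\<omega> \<tau>))
                                          + flux_div (b \<tau>) u\<^sub>h))"

definition maximal_solution ::
  "real \<Rightarrow> L2T \<times> L2T \<Rightarrow> L2T \<Rightarrow> L2T \<times> L2T \<Rightarrow> (real \<Rightarrow> L2T) \<Rightarrow> (real \<Rightarrow> L2T) \<Rightarrow> ereal \<Rightarrow> bool" where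
  "maximal_solution \<alpha> u\<^sub>h f z\<^sub>0 b \<omega> Tmax \<longleftrightarrow> 0 < Tmax \<and>
     (\<exists>T :: nat \<Rightarrow> real. incseq T \<and> (\<lambda>n. ereal (T n)) \<longlonglongrightarrow> Tmax \<and>
        (\<forall>n. local_strong_solution \<alpha> u\<^sub>h f z\<^sub>0 b \<omega> (T n)) \<and>
        (Tmax < \<infinity> \<longrightarrow> limsup (\<lambda>n. ereal ((norm_M (b (T n), \<omega> (T n)))\<^sup>2)) = \<infinity>))"

end

theory Submission
  imports Defs
begin

text \<open>
  Everything is expressed in Fourier coefficients. A velocity is \<open>\<nabla>\<^sup>\<bottom>\<psi>\<close>, and advection by it becomes a
  convolution whose kernel is \<open>(k \<and> l) \<psi>(k - l)\<close>, up to a constant. Antisymmetry of \<open>k \<and> l\<close> turns a weight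
  \<open>w\<close> in an energy into the difference \<open>w k - w l\<close>, which gains the missing derivative, so that the
  products of Sobolev functions reduce to trilinear \<open>\<ell>\<^sup>1\<close>-\<open>\<ell>\<^sup>2\<close>-\<open>\<ell>\<^sup>2\<close> bounds. If the integral in question is
  finite, the \<open>L\<^sup>2\<close> estimate for \<open>\<omega>\<close> closes, since its transport term vanishes and its forcing is bounded by
  the gradient of \<open>b\<close>. A bound on \<open>\<omega>\<close> in \<open>L\<^sup>2\<close> bounds the velocity in \<open>W\<^sup>3\<^sup>,\<^sup>2\<close>, and this makes the top order energy
  inequality linear; Gronwall's inequality then keeps the norm in \<open>\<M>\<close> bounded up to \<open>T\<^sub>m\<^sub>a\<^sub>x\<close>.
\<close>

section \<open>Integration on the cell\<close>

text \<open>The equations hold in L2 only: \<open>b\<close> and \<open>\<omega>\<close> are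
  differentiable in time as L2-valued maps, while their top order norms are merely known to be
  continuous. Gronwall's inequality can therefore be applied neither to these norms nor to the
  truncated energies, whose growth is bounded by the full norms. It is applied to the time integral
  of the full norms, after the truncation has been removed. A sharp frequency cut-off would jump at
  its edge and spoil the difference of weights; hence the Lipschitz factor in \<open>wt\<close>. The
  only embedding is that |k|^-2 is square summable on the planar lattice, so that an l1 bound costs
  two derivatives. Since \<open>\<alpha>\<close> is positive, the elliptic operator has order four:
  \<open>\<omega>\<close> in L2 puts |k|^4 psi into l2 and |k|^2 psi into l1, which is a bounded
  velocity gradient. Zero average lets the top derivatives alone control the norm in M. The final
  constants involve the data, the assumed value of the time integral and an upper bound for the
  times, so that one bound serves the whole sequence of times approaching the maximal one.\<close>

type_synonym freq = "int \<times> int"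

definition phase :: "freq \<Rightarrow> real \<times> real \<Rightarrow> real" where
  "phase k p = 2 * pi * (of_int (fst k) * fst p + of_int (snd k) * snd p)"

text \<open>Real cosines with free amplitude and phase, because test functions are real:
  differentiation only rescales the amplitude and shifts the phase by pi/2, and varying the phase
  recovers real and imaginary parts of a coefficient.\<close>

definition trig :: "real \<Rightarrow> freq \<Rightarrow> real \<Rightarrow> real \<times> real \<Rightarrow> real" where
  "trig a k \<theta> p = a * cos (phase k p + \<theta>)"

definition fourier :: "(real \<times> real \<Rightarrow> complex) \<Rightarrow> freq \<Rightarrow> complex" where
  "fourier F k = (LINT p|T2. F p * cis (- phase k p))"

definition coef :: "L2T \<Rightarrow> freq \<Rightarrow> complex" where
  "coef v = fourier (\<lambda>p. complex_of_real (fun_of v p))"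

lemma continuous_measurable_T2:
  fixes f :: "real \<times> real \<Rightarrow> 'a::topological_space"
  assumes "continuous_on UNIV f"
  shows "f \<in> borel_measurable T2"
  unfolding T2_def
  by (rule measurable_restrict_space1) (use borel_measurable_continuous_onI[OF assms] in simp)

lemma cell_subset: "space T2 \<subseteq> cbox (0,0) (1,1)"
  by (auto simp: T2_def space_restrict_space cbox_Pair_eq)

lemma integrable_T2_bounded:
  fixes f :: "real \<times> real \<Rightarrow> 'a::{banach,second_countable_topology}"
  assumes "f \<in> borel_measurable T2" "\<And>p. p \<in> space T2 \<Longrightarrow> norm (f p) \<le> B"
  shows "integrable T2 f"
  by (rule finite_measure.integrable_const_bound[OF finite_measure_T2, of _ B]) (use assms in auto)

lemma continuous_bounded_T2:
  fixes f :: "real \<times> real \<Rightarrow> 'a::real_normed_vector"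
  assumes "continuous_on UNIV f"
  obtains B where "\<And>p. p \<in> space T2 \<Longrightarrow> norm (f p) \<le> B"
proof -
  have "compact (f ` cbox (0,0) (1,1))"
    by (rule compact_continuous_image[OF continuous_on_subset[OF assms]]) auto
  then have "bounded (f ` cbox (0,0) (1,1))" by (rule compact_imp_bounded)
  then obtain B where "\<And>x. x \<in> f ` cbox (0,0) (1,1) \<Longrightarrow> norm x \<le> B" unfolding bounded_iff by auto
  then show ?thesis using that cell_subset by blast
qed

lemma integrable_T2_continuous:
  fixes f :: "real \<times> real \<Rightarrow> 'a::{banach,second_countable_topology}"
  assumes "continuous_on UNIV f"
  shows "integrable T2 f"
  using continuous_bounded_T2[OF assms] integrable_T2_bounded[OF continuous_measurable_T2[OF assms]]
  by metis

lemma sq_integrable_continuous: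
  assumes "continuous_on UNIV f"
  shows "sq_integrable f"
  unfolding sq_integrable_def
  using continuous_measurable_T2[OF assms] integrable_T2_continuous[of "\<lambda>p. (f p)^2"] assms
  by (auto intro!: continuous_intros)

lemma sq_integrable_mult_continuous:
  assumes v: "sq_integrable v" and f: "continuous_on UNIV f"
  shows "sq_integrable (\<lambda>p. v p * f p)"
proof -
  obtain B where B: "\<And>p. p \<in> space T2 \<Longrightarrow> norm (f p) \<le> B"
    using continuous_bounded_T2[OF f] by blast
  have [measurable]: "v \<in> borel_measurable T2" "f \<in> borel_measurable T2"
    using v continuous_measurable_T2[OF f] by (auto simp: sq_integrable_def)
  have "integrable T2 (\<lambda>p. (v p * f p)^2)"
  proof (rule Bochner_Integration.integrable_bound)
    show "integrable T2 (\<lambda>p. B^2 * (v p)^2)"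
      using v by (auto simp: sq_integrable_def)
    show "AE p in T2. norm ((v p * f p)^2) \<le> norm (B^2 * (v p)^2)"
    proof (rule AE_I2)
      fix p assume "p \<in> space T2"
      then have "(f p)^2 \<le> B^2"
        using power_mono[OF B, of p 2] by simp
      then show "norm ((v p * f p)^2) \<le> norm (B^2 * (v p)^2)"
        by (simp add: power_mult_distrib mult.commute mult_right_mono)
    qed
  qed measurable
  then show ?thesis by (simp add: sq_integrable_def)
qed

lemma LINT_T2_cell:
  fixes f :: "real \<times> real \<Rightarrow> real"
  shows "(LINT p|T2. f p)
    = (LINT p|(lborel \<Otimes>\<^sub>M lborel). indicator {0..<1} (fst p) * (indicator {0..<1} (snd p) * f p))"
  unfolding T2_def using cell_borel
  by (subst integral_restrict_space) (auto simp: lborel_prod indicator_times case_prod_beta mult.assoc)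

lemma integrable_T2_cell:
  fixes f :: "real \<times> real \<Rightarrow> real"
  shows "integrable T2 f \<longleftrightarrow> integrable (lborel \<Otimes>\<^sub>M lborel)
    (\<lambda>p. indicator {0..<1} (fst p) * (indicator {0..<1} (snd p) * f p))"
  unfolding T2_def using cell_borel
  by (subst integrable_restrict_space) (auto simp: lborel_prod indicator_times case_prod_beta mult.assoc)

lemma LINT_unit_interval_deriv:
  fixes F f :: "real \<Rightarrow> real"
  assumes "continuous_on UNIV f" "\<And>x. (F has_real_derivative f x) (at x)" "F 1 = F 0"
  shows "(LINT x|lborel. indicator {0..<1} x * f x) = 0"
proof -
  have "(LINT x|lborel. indicator {0..<1} x * f x) = (LINT x|lborel. f x * indicator {0..1} x)"
  proof (rule integral_cong_AE)
    have f[measurable]: "f \<in> borel_measurable borel"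
      by (rule borel_measurable_continuous_onI[OF assms(1)])
    show "(\<lambda>x. indicator {0..<1} x * f x) \<in> borel_measurable lborel" by measurable
    show "(\<lambda>x. f x * indicator {0..1} x) \<in> borel_measurable lborel" by measurable
    show "AE x in lborel. indicator {0..<1} x * f x = f x * indicator {0..1} x"
      using AE_lborel_singleton[of 1] by eventually_elim (auto simp: indicator_def)
  qed
  also have "\<dots> = F 1 - F 0"
    using assms by (intro integral_FTC_Icc_real) (auto simp: continuous_on_eq_continuous_at)
  finally show ?thesis using assms by simp
qed

text \<open>The source of all integrations by parts: by Fubini, the inner integral is a total
  derivative over a period.\<close>

lemma LINT_T2_deriv_x:
  assumes "continuous_on UNIV f" "\<And>x y. ((\<lambda>s. F (s,y)) has_real_derivative f (x,y)) (at x)"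
    "\<And>y. F (1,y) = F (0,y)"
  shows "(LINT p|T2. f p) = 0"
proof -
  have "integrable (lborel \<Otimes>\<^sub>M lborel)
    (\<lambda>(x,y). indicator {0..<1} x * (indicator {0..<1} y * f (x,y)))"
    using integrable_T2_continuous[OF assms(1)] unfolding integrable_T2_cell case_prod_beta by simp
  from lborel_pair.integral_snd[OF this]
  have "(LINT p|T2. f p) = (LINT y|lborel. LINT x|lborel. indicator {0..<1} x * (indicator {0..<1} y * f (x,y)))"
    unfolding LINT_T2_cell case_prod_beta by simp
  also have "\<dots> = (LINT y|lborel. indicator {0..<1} y * (LINT x|lborel. indicator {0..<1} x * f (x,y)))"
    by (rule Bochner_Integration.integral_cong[OF refl], subst integral_mult_right_zero[symmetric]) (simp add: mult.left_commute)
  also have "\<dots> = 0"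
  proof -
    have "(LINT x|lborel. indicator {0..<1} x * f (x,y)) = 0" for y
      by (rule LINT_unit_interval_deriv[where F="\<lambda>x. F (x, y)"])
        (use assms in \<open>auto intro!: continuous_on_compose2[OF assms(1)] continuous_intros\<close>)
    then show ?thesis by simp
  qed
  finally show ?thesis .
qed

lemma LINT_T2_deriv_y:
  assumes "continuous_on UNIV f" "\<And>x y. ((\<lambda>s. F (x,s)) has_real_derivative f (x,y)) (at y)"
    "\<And>x. F (x,1) = F (x,0)"
  shows "(LINT p|T2. f p) = 0"
proof -
  have "integrable (lborel \<Otimes>\<^sub>M lborel)
    (\<lambda>(x,y). indicator {0..<1} x * (indicator {0..<1} y * f (x,y)))"
    using integrable_T2_continuous[OF assms(1)] unfolding integrable_T2_cell case_prod_beta by simp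
  from lborel_pair.integral_fst[OF this]
  have "(LINT p|T2. f p) = (LINT x|lborel. LINT y|lborel. indicator {0..<1} x * (indicator {0..<1} y * f (x,y)))"
    unfolding LINT_T2_cell case_prod_beta by simp
  also have "\<dots> = (LINT x|lborel. indicator {0..<1} x * (LINT y|lborel. indicator {0..<1} y * f (x,y)))"
    by simp
  also have "\<dots> = 0"
  proof -
    have "(LINT y|lborel. indicator {0..<1} y * f (x,y)) = 0" for x
      by (rule LINT_unit_interval_deriv[where F="\<lambda>y. F (x, y)"])
        (use assms in \<open>auto intro!: continuous_on_compose2[OF assms(1)] continuous_intros\<close>)
    then show ?thesis by simp
  qed
  finally show ?thesis .
qed

section \<open>Trigonometric functions as test functions\<close>

lemma phase_add: "phase (k + l) p = phase k p + phase l p"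
  by (simp add: phase_def algebra_simps)

lemma phase_minus [simp]: "phase (- k) p = - phase k p"
  by (simp add: phase_def algebra_simps)

lemma phase_diff: "phase (k - l) p = phase k p - phase l p"
  by (simp add: phase_def algebra_simps)

lemma phase_zero [simp]: "phase 0 p = 0" by (simp add: phase_def)

lemma continuous_on_phase [continuous_intros]: "continuous_on A (phase k)"
  unfolding phase_def[abs_def] by (intro continuous_intros)

lemma continuous_on_trig [continuous_intros]: "continuous_on A (trig a k \<theta>)"
  unfolding trig_def[abs_def] by (intro continuous_intros)

lemma phase_measurable [measurable]: "phase k \<in> borel_measurable T2"
  by (rule continuous_measurable_T2) (intro continuous_intros)

lemma trig_measurable [measurable]: "trig a k \<theta> \<in> borel_measurable T2"
  by (rule continuous_measurable_T2) (intro continuous_intros)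

lemma cos_phase_periodic:
  "cos (phase k (x + 1, y) + \<theta>) = cos (phase k (x, y) + \<theta>)"
  "cos (phase k (x, y + 1) + \<theta>) = cos (phase k (x, y) + \<theta>)"
proof -
  have 1: "phase k (x + 1, y) + \<theta> = (phase k (x, y) + \<theta>) + 2 * pi * of_int (fst k)"
    by (simp add: phase_def algebra_simps)
  show "cos (phase k (x + 1, y) + \<theta>) = cos (phase k (x, y) + \<theta>)"
    unfolding 1 by (simp add: cos_add)
  have 2: "phase k (x, y + 1) + \<theta> = (phase k (x, y) + \<theta>) + 2 * pi * of_int (snd k)"
    by (simp add: phase_def algebra_simps)
  show "cos (phase k (x, y + 1) + \<theta>) = cos (phase k (x, y) + \<theta>)"
    unfolding 2 by (simp add: cos_add)
qed

lemma trig_deriv_x: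
  "((\<lambda>s. trig a k \<theta> (s, y)) has_real_derivative trig (2 * pi * of_int (fst k) * a) k (\<theta> + pi/2) (x, y)) (at x)"
proof -
  have "cos (phase k (x, y) + (\<theta> + pi/2)) = - sin (phase k (x, y) + \<theta>)"
    using minus_sin_cos_eq[of "phase k (x, y) + \<theta>"] by (simp add: add.assoc)
  then show ?thesis unfolding trig_def phase_def
    by (auto intro!: derivative_eq_intros simp: algebra_simps)
qed

lemma trig_deriv_y:
  "((\<lambda>s. trig a k \<theta> (x, s)) has_real_derivative trig (2 * pi * of_int (snd k) * a) k (\<theta> + pi/2) (x, y)) (at y)"
proof -
  have "cos (phase k (x, y) + (\<theta> + pi/2)) = - sin (phase k (x, y) + \<theta>)"
    using minus_sin_cos_eq[of "phase k (x, y) + \<theta>"] by (simp add: add.assoc)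
  then show ?thesis unfolding trig_def phase_def
    by (auto intro!: derivative_eq_intros simp: algebra_simps)
qed

lemma pd_x_trig: "pd_x (trig a k \<theta>) = trig (2 * pi * of_int (fst k) * a) k (\<theta> + pi/2)"
  by (auto simp: pd_x_def fun_eq_iff intro!: DERIV_imp_deriv trig_deriv_x)

lemma pd_y_trig: "pd_y (trig a k \<theta>) = trig (2 * pi * of_int (snd k) * a) k (\<theta> + pi/2)"
  by (auto simp: pd_y_def fun_eq_iff intro!: DERIV_imp_deriv trig_deriv_y)

lemma pd_xy_trig: "(pd_x ^^ i) ((pd_y ^^ j) (trig a k \<theta>))
  = trig ((2 * pi * of_int (fst k)) ^ i * (2 * pi * of_int (snd k)) ^ j * a) k (\<theta> + of_nat (i + j) * (pi/2))"
proof -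
  have "(pd_y ^^ j) (trig a k \<theta>) = trig ((2 * pi * of_int (snd k)) ^ j * a) k (\<theta> + of_nat j * (pi/2))"
    by (induction j) (simp_all add: pd_y_trig algebra_simps del: times_divide_eq_right)
  moreover have "(pd_x ^^ i) (trig b k \<eta>) = trig ((2 * pi * of_int (fst k)) ^ i * b) k (\<eta> + of_nat i * (pi/2))" for b \<eta>
    by (induction i) (simp_all add: pd_x_trig algebra_simps del: times_divide_eq_right)
  ultimately show ?thesis by (simp add: algebra_simps del: times_divide_eq_right)
qed

text \<open>Coinduction with amplitude and phase generalised works because \<open>pd_x\<close> and
  \<open>pd_y\<close> map the family into itself.\<close>

lemma smooth_trig: "smooth (trig a k \<theta>)"
proof (coinduction arbitrary: a \<theta>)
  case smooth
  have "trig a k \<theta> differentiable (at p)" for p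
    unfolding trig_def phase_def differentiable_def
    by (rule exI) (auto intro!: derivative_eq_intros)
  then show ?case using pd_x_trig pd_y_trig by auto
qed

lemma trig_test: "trig a k \<theta> \<in> test_functions"
  by (auto simp: test_functions_def smooth_trig) (simp_all add: trig_def cos_phase_periodic)

text \<open>A primitive is the same cosine with phase moved back by pi/2 and amplitude divided by
  the frequency, taken in a coordinate in which \<open>k\<close> does not vanish.\<close>

lemma LINT_T2_trig:
  assumes "k \<noteq> 0"
  shows "(LINT p|T2. trig a k \<theta> p) = 0"
proof (cases "fst k = 0")
  case False
  let ?b = "a / (2 * pi * of_int (fst k))"
  have *: "((\<lambda>s. trig ?b k (\<theta> - pi/2) (s, y)) has_real_derivative trig a k \<theta> (x, y)) (at x)" for x y
    using trig_deriv_x[of ?b k "\<theta> - pi/2" y x] False by simp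
  show ?thesis
    by (rule LINT_T2_deriv_x[OF _ *])
      (use cos_phase_periodic(1)[of k 0] in \<open>auto intro!: continuous_intros simp: trig_def\<close>)
next
  case True
  then have k: "snd k \<noteq> 0" using assms by (auto simp: prod_eq_iff)
  let ?b = "a / (2 * pi * of_int (snd k))"
  have *: "((\<lambda>s. trig ?b k (\<theta> - pi/2) (x, s)) has_real_derivative trig a k \<theta> (x, y)) (at y)" for x y
    using trig_deriv_y[of ?b k "\<theta> - pi/2" x y] k by simp
  show ?thesis
    by (rule LINT_T2_deriv_y[OF _ *])
      (use cos_phase_periodic(2)[of k _ 0] in \<open>auto intro!: continuous_intros simp: trig_def\<close>)
qed

lemma LINT_T2_cis: "(LINT p|T2. cis (phase k p)) = (if k = 0 then 1 else 0)"
proof (cases "k = 0")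
  case True
  then show ?thesis by (simp add: measure_T2_space cis_zero)
next
  case False
  have i: "integrable T2 (\<lambda>p. cis (phase k p))"
    by (rule integrable_T2_continuous) (intro continuous_intros)
  have "Re (LINT p|T2. cis (phase k p)) = (LINT p|T2. trig 1 k 0 p)"
    by (subst integral_Re[symmetric, OF i]) (simp add: trig_def[abs_def])
  moreover have "Im (LINT p|T2. cis (phase k p)) = (LINT p|T2. trig 1 k (- pi/2) p)"
    by (subst integral_Im[symmetric, OF i]) (simp add: trig_def[abs_def] cos_diff)
  ultimately show ?thesis using LINT_T2_trig[OF False] False by (simp add: complex_eq_iff)
qed

section \<open>Fourier coefficients as bounded linear functionals\<close>

lemma sq_integrable_bounded_mult:
  "continuous_on UNIV f \<Longrightarrow> integrable T2 (\<lambda>p. fun_of v p * f p)"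
  by (intro sq_integrable_integrable sq_integrable_mult_continuous sq_integrable_fun_of)

lemma integrable_coef: "integrable T2 (\<lambda>p. complex_of_real (fun_of v p) * cis (- phase k p))"
proof (rule Bochner_Integration.integrable_bound)
  show "integrable T2 (fun_of v)" by (intro sq_integrable_integrable sq_integrable_fun_of)
  show "(\<lambda>p. complex_of_real (fun_of v p) * cis (- phase k p)) \<in> borel_measurable T2"
    by (intro borel_measurable_times measurable_compose[OF fun_of_measurable]
        continuous_measurable_T2) (auto intro!: borel_measurable_continuous_onI continuous_intros)
  show "AE p in T2. norm (complex_of_real (fun_of v p) * cis (- phase k p)) \<le> norm (fun_of v p)"
    by (simp add: norm_mult)
qed

text \<open>The dictionary between real integrals against \<open>trig\<close> and complex
  coefficients; \<open>\<theta>\<close> = 0 and pi/2 suffice to recover the coefficient.\<close>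

lemma Re_coef: "Re (cis (- \<theta>) * coef v k) = (LINT p|T2. fun_of v p * trig 1 k \<theta> p)"
proof -
  have "cis (- \<theta>) * coef v k = (LINT p|T2. cis (- \<theta>) * (complex_of_real (fun_of v p) * cis (- phase k p)))"
    by (simp add: coef_def fourier_def)
  also have "Re \<dots> = (LINT p|T2. Re (cis (- \<theta>) * (complex_of_real (fun_of v p) * cis (- phase k p))))"
    by (subst integral_Re) (auto intro: integrable_mult_right integrable_coef)
  also have "\<dots> = (LINT p|T2. fun_of v p * trig 1 k \<theta> p)"
    by (intro Bochner_Integration.integral_cong refl) (simp add: trig_def cos_add algebra_simps)
  finally show ?thesis .
qed

lemma complex_eqI_rotations:
  assumes "\<And>\<theta>. Re (cis (- \<theta>) * z) = Re (cis (- \<theta>) * w)"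
  shows "z = w"
  using assms[of 0] assms[of "pi/2"] by (auto simp: complex_eq_iff)

lemma coef_add: "coef (v + w) k = coef v k + coef w k"
proof -
  have "coef (v + w) k = (LINT p|T2. complex_of_real (fun_of v p) * cis (- phase k p)
      + complex_of_real (fun_of w p) * cis (- phase k p))"
    unfolding coef_def fourier_def
  proof (rule integral_cong_AE)
    show "AE p in T2. complex_of_real (fun_of (v + w) p) * cis (- phase k p)
        = complex_of_real (fun_of v p) * cis (- phase k p) + complex_of_real (fun_of w p) * cis (- phase k p)"
      using fun_of_add[of v w] by eventually_elim (simp add: algebra_simps)
  qed (use integrable_coef in \<open>auto intro!: borel_measurable_integrable Bochner_Integration.integrable_add\<close>)
  also have "\<dots> = coef v k + coef w k"
    unfolding coef_def fourier_def by (intro Bochner_Integration.integral_add integrable_coef)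
  finally show ?thesis .
qed

lemma coef_scaleR: "coef (c *\<^sub>R v) k = c *\<^sub>R coef v k"
proof -
  have "coef (c *\<^sub>R v) k = (LINT p|T2. complex_of_real c * (complex_of_real (fun_of v p) * cis (- phase k p)))"
    unfolding coef_def fourier_def
  proof (rule integral_cong_AE)
    show "AE p in T2. complex_of_real (fun_of (c *\<^sub>R v) p) * cis (- phase k p)
        = complex_of_real c * (complex_of_real (fun_of v p) * cis (- phase k p))"
      using fun_of_scaleR[of c v] by eventually_elim simp
  qed (use integrable_coef in \<open>auto intro!: borel_measurable_integrable integrable_mult_right\<close>)
  then show ?thesis by (simp add: coef_def fourier_def scaleR_conv_of_real)
qed

lemma coef_uminus: "coef (- v) k = - coef v k"
  using coef_scaleR[of "-1" v k] by simp

lemma coef_diff: "coef (v - w) k = coef v k - coef w k"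
  using coef_add[of v "- w" k] by (simp add: coef_uminus)

lemma coef_zero [simp]: "coef 0 k = 0"
  using coef_scaleR[of 0 0 k] by simp

lemma norm_coef_le: "cmod (coef v k) \<le> norm v"
proof -
  have "cmod (coef v k) \<le> (LINT p|T2. cmod (complex_of_real (fun_of v p) * cis (- phase k p)))"
    unfolding coef_def fourier_def by (rule integral_norm_bound)
  also have "\<dots> = (LINT p|T2. \<bar>fun_of v p\<bar>)" by (simp add: norm_mult)
  also have "\<dots> = (LINT p|T2. \<bar>fun_of v p - fun_of 0 p\<bar>)"
  proof (rule integral_cong_AE)
    show "AE p in T2. \<bar>fun_of v p\<bar> = \<bar>fun_of v p - fun_of 0 p\<bar>"
      using fun_of_zero by eventually_elim simp
  qed measurable
  also have "\<dots> \<le> norm v" using L1_le_norm_diff[of v 0] by simp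
  finally show ?thesis .
qed

text \<open>Allows coefficients to be taken under L2 limits and under time derivatives.\<close>

lemma bounded_linear_coef: "bounded_linear (\<lambda>v. coef v k)"
  by (rule bounded_linear_intro[where K=1]) (auto simp: coef_add coef_scaleR norm_coef_le)

lemma coef_minus: "coef v (- k) = cnj (coef v k)"
proof -
  have "cnj (coef v k) = (LINT p|T2. cnj (complex_of_real (fun_of v p) * cis (- phase k p)))"
    unfolding coef_def fourier_def by (rule Bochner_Integration.integral_cnj[symmetric])
  also have "\<dots> = coef v (- k)" by (simp add: coef_def fourier_def cis_cnj)
  finally show ?thesis by simp
qed

lemma coef_class_of:
  assumes "sq_integrable f"
  shows "coef (class_of f) = fourier (\<lambda>p. complex_of_real (f p))"
proof
  fix k
  have [measurable]: "f \<in> borel_measurable T2" using assms by (simp add: sq_integrable_def)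
  have [measurable]: "(\<lambda>p. cis (- phase k p)) \<in> borel_measurable T2"
    by (rule continuous_measurable_T2) (intro continuous_intros)
  show "coef (class_of f) k = fourier (\<lambda>p. complex_of_real (f p)) k"
    unfolding coef_def fourier_def
  proof (rule integral_cong_AE)
    show "AE p in T2. complex_of_real (fun_of (class_of f) p) * cis (- phase k p) =
        complex_of_real (f p) * cis (- phase k p)"
      using fun_of_class_of[OF assms] by eventually_elim simp
  qed measurable
qed

lemma inner_class_of:
  assumes "sq_integrable f"
  shows "inner v (class_of f) = (LINT p|T2. fun_of v p * f p)"
  unfolding inner_L2T_def
proof (rule integral_cong_AE)
  have [measurable]: "f \<in> borel_measurable T2" using assms by (simp add: sq_integrable_def)
  show "(\<lambda>p. fun_of v p * f p) \<in> borel_measurable T2" by measurable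
  show "AE p in T2. fun_of v p * fun_of (class_of f) p = fun_of v p * f p"
    using fun_of_class_of[OF assms] by eventually_elim simp
qed measurable

section \<open>Completeness of the trigonometric system\<close>

lemma trig_mult: "trig 1 k \<theta> p * trig 1 l \<eta> p = trig (1/2) (k + l) (\<theta> + \<eta>) p + trig (1/2) (k - l) (\<theta> - \<eta>) p"
proof -
  have "cos (phase k p + \<theta>) * cos (phase l p + \<eta>)
    = (cos ((phase k p + \<theta>) - (phase l p + \<eta>)) + cos ((phase k p + \<theta>) + (phase l p + \<eta>))) / 2"
    by (rule cos_times_cos)
  moreover have "(phase k p + \<theta>) - (phase l p + \<eta>) = phase (k - l) p + (\<theta> - \<eta>)"
    "(phase k p + \<theta>) + (phase l p + \<eta>) = phase (k + l) p + (\<theta> + \<eta>)"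
    by (simp_all add: phase_add phase_diff)
  ultimately show ?thesis by (simp add: trig_def)
qed

lemma trig_half: "trig (1/2) k \<theta> p = (1/2) * trig 1 k \<theta> p"
  by (simp add: trig_def)

text \<open>The \<open>trig\<close> factor is built into the condition so that the set is stable
  under multiplication by trigonometric functions, which is what lets polynomials in them be
  reached.\<close>

definition ann :: "L2T \<Rightarrow> (real \<times> real \<Rightarrow> real) set" where
  "ann v = {f. continuous_on UNIV f \<and> (\<forall>k \<theta>. (LINT p|T2. fun_of v p * (trig 1 k \<theta> p * f p)) = 0)}"

lemma ann_integrable:
  assumes "f \<in> ann v"
  shows "integrable T2 (\<lambda>p. fun_of v p * f p)" "integrable T2 (\<lambda>p. fun_of v p * (trig 1 k \<theta> p * f p))"
  using assms by (auto simp: ann_def intro!: sq_integrable_bounded_mult continuous_intros)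

lemma annD: "f \<in> ann v \<Longrightarrow> (LINT p|T2. fun_of v p * (trig 1 k \<theta> p * f p)) = 0"
  unfolding ann_def by blast

lemma ann_LINT: "f \<in> ann v \<Longrightarrow> (LINT p|T2. fun_of v p * f p) = 0"
  using annD[of f v 0 0] unfolding trig_def by simp

lemma ann_one:
  assumes "\<And>k. coef v k = 0"
  shows "(\<lambda>_. 1) \<in> ann v"
  using Re_coef[of _ v] assms by (simp add: ann_def)

lemma ann_scale: "f \<in> ann v \<Longrightarrow> (\<lambda>p. c * f p) \<in> ann v"
  by (auto simp: ann_def mult.left_commute intro!: continuous_intros)

lemma ann_add:
  assumes "f \<in> ann v" "g \<in> ann v"
  shows "(\<lambda>p. f p + g p) \<in> ann v"
  using assms ann_integrable[OF assms(1)] ann_integrable[OF assms(2)]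
  by (auto simp: ann_def distrib_left intro!: continuous_intros)

text \<open>The product-to-sum formula absorbs the new factor into the test frequencies
  \<open>k + l\<close> and \<open>k - l\<close>.\<close>

lemma ann_trig:
  assumes f: "f \<in> ann v"
  shows "(\<lambda>p. f p * trig 1 l \<eta> p) \<in> ann v"
  unfolding ann_def
proof (intro CollectI conjI allI)
  show "continuous_on UNIV (\<lambda>p. f p * trig 1 l \<eta> p)"
    using f by (auto simp: ann_def intro!: continuous_intros)
  fix k \<theta>
  have eq: "fun_of v p * (trig 1 k \<theta> p * (f p * trig 1 l \<eta> p))
     = (1/2) * (fun_of v p * (trig 1 (k + l) (\<theta> + \<eta>) p * f p))
      + (1/2) * (fun_of v p * (trig 1 (k - l) (\<theta> - \<eta>) p * f p))" for p
  proof -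
    have "fun_of v p * (trig 1 k \<theta> p * (f p * trig 1 l \<eta> p))
      = (fun_of v p * f p) * (trig 1 k \<theta> p * trig 1 l \<eta> p)" by (simp add: mult_ac)
    then show ?thesis unfolding trig_mult trig_half by (simp add: algebra_simps)
  qed
  have "(LINT p|T2. fun_of v p * (trig 1 k \<theta> p * (f p * trig 1 l \<eta> p)))
     = (LINT p|T2. (1/2) * (fun_of v p * (trig 1 (k + l) (\<theta> + \<eta>) p * f p)))
      + (LINT p|T2. (1/2) * (fun_of v p * (trig 1 (k - l) (\<theta> - \<eta>) p * f p)))"
    unfolding eq by (intro Bochner_Integration.integral_add integrable_mult_right ann_integrable f)
  then show "(LINT p|T2. fun_of v p * (trig 1 k \<theta> p * (f p * trig 1 l \<eta> p))) = 0"
    using annD[OF f, of "k + l" "\<theta> + \<eta>"] annD[OF f, of "k - l" "\<theta> - \<eta>"] by simp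
qed

lemma ann_trig_power:
  assumes f: "f \<in> ann v"
  shows "(\<lambda>p. f p * trig 1 l \<eta> p ^ n) \<in> ann v"
proof (induction n)
  case (Suc n)
  from ann_trig[OF this, of l \<eta>] show ?case by (simp add: mult_ac)
qed (use f in simp)

lemma ann_sum:
  assumes "finite A" "\<And>i. i \<in> A \<Longrightarrow> F i \<in> ann v"
  shows "(\<lambda>p. \<Sum>i\<in>A. F i p) \<in> ann v"
  using assms by (induction A rule: finite_induct) (auto simp: ann_add, simp add: ann_def)

text \<open>The argument of \<open>g\<close> stays in [-1, 1], so Weierstrass approximates
  \<open>g\<close> by polynomials, for which \<open>ann_trig_power\<close> applies; the error is at
  most \<open>e\<close> times an L1 norm.\<close>

lemma ann_compose_continuous:
  assumes f: "f \<in> ann v" and g: "continuous_on UNIV (g :: real \<Rightarrow> real)"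
  shows "(\<lambda>p. f p * g (trig 1 l \<eta> p)) \<in> ann v"
  unfolding ann_def
proof (intro CollectI conjI allI)
  have cf: "continuous_on UNIV f" using f by (simp add: ann_def)
  have cg: "continuous_on UNIV (\<lambda>p. g (trig 1 l \<eta> p))"
    by (rule continuous_on_compose2[OF g]) (auto intro!: continuous_intros)
  show "continuous_on UNIV (\<lambda>p. f p * g (trig 1 l \<eta> p))"
    by (intro continuous_intros cf cg)
  fix k \<theta>
  let ?F = "\<lambda>p. fun_of v p * (trig 1 k \<theta> p * f p)"
  let ?I = "LINT p|T2. fun_of v p * (trig 1 k \<theta> p * (f p * g (trig 1 l \<eta> p)))"
  have iF: "integrable T2 (\<lambda>p. \<bar>?F p\<bar>)"
    using ann_integrable[OF f] by (intro integrable_abs)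
  have bound: "\<bar>?I\<bar> \<le> e * (LINT p|T2. \<bar>?F p\<bar>)" if e: "e > 0" for e
  proof -
    obtain q where q: "real_polynomial_function q" "\<And>x. x \<in> {-1..1} \<Longrightarrow> \<bar>g x - q x\<bar> < e"
      using Stone_Weierstrass_real_polynomial_function[OF compact_Icc continuous_on_subset[OF g subset_UNIV] e]
      by metis
    obtain a n where an: "q = (\<lambda>x. \<Sum>i\<le>n. a i * x ^ i)"
      using q(1) unfolding real_polynomial_function_iff_sum by auto
    let ?g = "\<lambda>p. fun_of v p * (trig 1 k \<theta> p * (f p * g (trig 1 l \<eta> p)))"
    let ?q = "\<lambda>p. fun_of v p * (trig 1 k \<theta> p * (f p * q (trig 1 l \<eta> p)))"
    have "(\<lambda>p. \<Sum>i\<le>n. a i * (f p * trig 1 l \<eta> p ^ i)) \<in> ann v"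
      by (intro ann_sum ann_scale ann_trig_power f) auto
    then have qa: "(\<lambda>p. f p * q (trig 1 l \<eta> p)) \<in> ann v"
      by (simp add: an sum_distrib_left mult_ac)
    have ig: "integrable T2 (\<lambda>p. ?g p)"
      by (intro sq_integrable_bounded_mult continuous_intros cf cg)
    have "?I = ?I - (LINT p|T2. ?q p)"
      unfolding annD[OF qa] by (rule diff_zero[symmetric])
    also have "\<dots> = (LINT p|T2. ?g p - ?q p)"
      by (intro Bochner_Integration.integral_diff[symmetric] ig ann_integrable[OF qa])
    finally have I_eq: "?I = (LINT p|T2. ?g p - ?q p)" .
    have "\<bar>?I\<bar> \<le> (LINT p|T2. \<bar>?g p - ?q p\<bar>)"
      by (subst I_eq) (rule integral_abs_bound)
    also have "\<dots> \<le> (LINT p|T2. e * \<bar>?F p\<bar>)"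
    proof (rule integral_mono)
      show "integrable T2 (\<lambda>p. \<bar>?g p - ?q p\<bar>)"
        by (intro integrable_abs Bochner_Integration.integrable_diff ig ann_integrable[OF qa])
      show "integrable T2 (\<lambda>p. e * \<bar>?F p\<bar>)" by (intro integrable_mult_right iF)
      fix p
      have "trig 1 l \<eta> p \<in> {-1..1}" by (simp add: trig_def)
      then have *: "\<bar>g (trig 1 l \<eta> p) - q (trig 1 l \<eta> p)\<bar> \<le> e" using q(2) less_imp_le by blast
      have "\<bar>?g p - ?q p\<bar>
        = \<bar>?F p * (g (trig 1 l \<eta> p) - q (trig 1 l \<eta> p))\<bar>"
        unfolding right_diff_distrib mult.assoc by (rule refl)
      also have "\<dots> = \<bar>?F p\<bar> * \<bar>g (trig 1 l \<eta> p) - q (trig 1 l \<eta> p)\<bar>" by (rule abs_mult)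
      also have "\<dots> \<le> \<bar>?F p\<bar> * e" by (intro mult_left_mono *) auto
      also have "\<dots> = e * \<bar>?F p\<bar>" by (rule mult.commute)
      finally show "\<bar>?g p - ?q p\<bar> \<le> e * \<bar>?F p\<bar>" .
    qed
    finally show ?thesis unfolding integral_mult_right_zero .
  qed
  \<comment> \<open>With e = |I| / (2 (c + 1)), where c is the L1 norm, the bound would give |I| <
    |I|; the summand 1 covers c = 0.\<close>
  show "?I = 0"
  proof (rule ccontr)
    assume "?I \<noteq> 0"
    let ?c = "LINT p|T2. \<bar>?F p\<bar>"
    have c: "?c \<ge> 0" by (rule integral_nonneg_AE) simp
    have pos: "0 < 2 * (c + 1)" if "0 \<le> c" for c :: real using that by simp
    have "\<bar>?I\<bar> \<le> (\<bar>?I\<bar> / (2 * (?c + 1))) * ?c"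
      by (rule bound, rule divide_pos_pos) (use \<open>?I \<noteq> 0\<close> pos[OF c] in \<open>simp_all only: zero_less_abs_iff\<close>, simp_all)
    moreover have "(i / (2 * (c + 1))) * c < i" if "i > 0" "c \<ge> 0" for i c :: real
      using that by (simp add: field_simps add_nonneg_pos)
    from this[of "\<bar>?I\<bar>" ?c] have "(\<bar>?I\<bar> / (2 * (?c + 1))) * ?c < \<bar>?I\<bar>"
      using \<open>?I \<noteq> 0\<close> c by simp
    ultimately show False by linarith
  qed
qed

text \<open>The half-line \<open>{a<..}\<close> meets the unit interval in an arc of the circle centred at the
  midpoint of \<open>(a, 1)\<close>.\<close>

lemma halfline_arc:
  assumes "0 \<le> a" "a < 1" "0 \<le> x" "x < (1::real)"
  shows "cos (2 * pi * x - pi * (1 + a)) > cos (pi * (1 - a)) \<longleftrightarrow> a < x"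
proof -
  let ?y = "\<bar>2 * x - 1 - a\<bar>"
  have "2 * pi * x - pi * (1 + a) = pi * (2 * x - 1 - a)" by (simp add: algebra_simps)
  then have "cos (2 * pi * x - pi * (1 + a)) = cos \<bar>pi * (2 * x - 1 - a)\<bar>" by (simp only: cos_abs_real)
  also have "\<bar>pi * (2 * x - 1 - a)\<bar> = pi * ?y" by (simp add: abs_mult)
  finally have e: "cos (2 * pi * x - pi * (1 + a)) = cos (pi * ?y)" .
  have r: "0 \<le> pi * (1 - a)" "pi * (1 - a) \<le> pi" using assms by (auto simp: mult_le_cancel_left1)
  show ?thesis
  proof
    assume "a < x"
    then have "?y < 1 - a" using assms by auto
    then have "pi * ?y < pi * (1 - a)" by simp
    then show "cos (2 * pi * x - pi * (1 + a)) > cos (pi * (1 - a))"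
      unfolding e using r by (intro cos_monotone_0_pi) auto
  next
    assume L: "cos (2 * pi * x - pi * (1 + a)) > cos (pi * (1 - a))"
    show "a < x"
    proof (rule ccontr)
      assume "\<not> a < x"
      then have y: "1 - a \<le> ?y" "?y \<le> 1 + a" using assms by auto
      have "cos (pi * ?y) \<le> cos (pi * (1 - a))"
      proof (cases "?y \<le> 1")
        case True
        then show ?thesis using y r
          by (intro cos_monotone_0_pi_le) (auto simp: mult_le_cancel_left1)
      next
        case False
        have "cos (pi * ?y) = cos (2 * pi - pi * ?y)" by (simp add: cos_diff)
        also have "2 * pi - pi * ?y = pi * (2 - ?y)" by (simp add: algebra_simps)
        also have "cos (pi * (2 - ?y)) \<le> cos (pi * (1 - a))"
          using y r False by (intro cos_monotone_0_pi_le) (auto simp: mult_le_cancel_left1)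
        finally show ?thesis .
      qed
      then show False using L e by simp
    qed
  qed
qed

text \<open>The ramps \<open>g d n\<close> are continuous, lie between 0 and 1 and converge
  pointwise to the indicator of the half-line, so dominated convergence applies. Two factors are
  needed to produce quadrants.\<close>

lemma ann_limit_halfline:
  assumes z: "\<And>k. coef v k = 0"
  shows "(LINT p|T2. fun_of v p * (indicator {d<..} (trig 1 k \<theta> p) * indicator {e<..} (trig 1 l \<eta> p))) = 0"
proof -
  define g :: "real \<Rightarrow> nat \<Rightarrow> real \<Rightarrow> real" where "g d n t = min 1 (real n * max 0 (t - d))" for d n t
  have g0: "0 \<le> g d n t" "g d n t \<le> 1" for d n t by (auto simp: g_def)
  have gc: "continuous_on UNIV (g d n)" for d n
    unfolding g_def[abs_def] by (intro continuous_intros)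
  have gl: "(\<lambda>n. g d n t) \<longlonglongrightarrow> indicator {d<..} t" for d t
  proof (cases "t > d")
    case True
    obtain N where N: "1 / (t - d) < real N" using reals_Archimedean2 by blast
    have "g d n t = 1" if "n \<ge> N" for n
    proof -
      have "1 / (t - d) < real n" using N that by (meson less_le_trans of_nat_le_iff)
      then have "1 < real n * (t - d)" using True by (simp add: pos_divide_less_eq)
      then show ?thesis using True by (simp add: g_def)
    qed
    then have "eventually (\<lambda>n. g d n t = 1) sequentially"
      using eventually_sequentially by blast
    then show ?thesis using True by (simp add: tendsto_eventually)
  qed (auto simp: g_def)
  have gm: "(\<lambda>p. g d n (trig 1 k \<theta> p)) \<in> borel_measurable T2" for d n k \<theta>
    by (rule continuous_measurable_T2, rule continuous_on_compose2[OF gc])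
      (auto intro!: continuous_intros)
  have "(\<lambda>n. LINT p|T2. fun_of v p * (g d n (trig 1 k \<theta> p) * g e n (trig 1 l \<eta> p)))
    \<longlonglongrightarrow> (LINT p|T2. fun_of v p * (indicator {d<..} (trig 1 k \<theta> p) * indicator {e<..} (trig 1 l \<eta> p)))"
  proof (rule integral_dominated_convergence[where w="\<lambda>p. \<bar>fun_of v p\<bar>"])
    show "integrable T2 (\<lambda>p. \<bar>fun_of v p\<bar>)"
      by (intro integrable_abs sq_integrable_integrable sq_integrable_fun_of)
    show "AE p in T2. (\<lambda>n. fun_of v p * (g d n (trig 1 k \<theta> p) * g e n (trig 1 l \<eta> p)))
       \<longlonglongrightarrow> fun_of v p * (indicator {d<..} (trig 1 k \<theta> p) * indicator {e<..} (trig 1 l \<eta> p))"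
      by (intro AE_I2 tendsto_intros gl)
    fix n
    show "AE p in T2. norm (fun_of v p * (g d n (trig 1 k \<theta> p) * g e n (trig 1 l \<eta> p))) \<le> \<bar>fun_of v p\<bar>"
      by (intro AE_I2) (auto simp: abs_mult g0 intro!: mult_right_le_one_le mult_le_one)
    show "(\<lambda>p. fun_of v p * (g d n (trig 1 k \<theta> p) * g e n (trig 1 l \<eta> p))) \<in> borel_measurable T2"
      using gm by measurable
  qed measurable
  moreover have "(LINT p|T2. fun_of v p * (g d n (trig 1 k \<theta> p) * g e n (trig 1 l \<eta> p))) = 0" for n
    using ann_LINT[OF ann_compose_continuous[OF ann_compose_continuous[OF ann_one[OF z] gc[of d n], of k \<theta>] gc[of e n], of l \<eta>]]
    by simp
  ultimately have "(\<lambda>n. 0) \<longlonglongrightarrow> (LINT p|T2. fun_of v p * (indicator {d<..} (trig 1 k \<theta> p) * indicator {e<..} (trig 1 l \<eta> p)))"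
    by simp
  from LIMSEQ_unique[OF tendsto_const this] show ?thesis by (rule sym)
qed

text \<open>Thresholds -2 and 2 lie outside the range of the cosine and settle the cases in which
  the half-line contains or misses the whole unit interval; otherwise the half-line cuts out an
  arc.\<close>

lemma halfline_indicator_exists:
  fixes a :: real
  shows "\<exists>d \<theta>. \<forall>x\<in>{0..<1}. indicator {a<..} x = (indicator {d<..} (cos (2 * pi * x + \<theta>)) :: real)"
proof -
  have c: "- 2 < cos t" "\<not> 2 < cos t" for t :: real
    using cos_ge_minus_one[of t] cos_le_one[of t] by linarith+
  consider "a < 0" | "0 \<le> a" "a < 1" | "1 \<le> a" by linarith
  then show ?thesis
  proof cases
    case 1
    show ?thesis by (rule exI[of _ "-2"], rule exI[of _ 0]) (use 1 c(1) in \<open>auto simp: indicator_def\<close>)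
  next
    case 2
    then show ?thesis using halfline_arc[OF 2]
      by (intro exI[of _ "cos (pi * (1 - a))"] exI[of _ "- (pi * (1 + a))"]) (simp add: indicator_def)
  next
    case 3
    show ?thesis by (rule exI[of _ 2], rule exI[of _ 0]) (use 3 c(2) in \<open>auto simp: indicator_def\<close>)
  qed
qed

lemma space_T2: "space T2 = {0..<1} \<times> {0..<1}"
  by (simp add: T2_def space_restrict_space)

lemma sets_T2: "sets T2 = (\<lambda>A. ({0..<1} \<times> {0..<1}) \<inter> A) ` sets borel"
  by (simp add: T2_def sets_restrict_space)

lemma eucl_less_pair: "eucl_less a x \<longleftrightarrow> fst a < fst x \<and> snd a < snd (x :: real \<times> real)"
  by (cases a; cases x) (auto simp: eucl_less_def Basis_prod_def)

text \<open>On the cell, an open quadrant is an intersection of two arcs, so \<open>v\<close> has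
  integral zero over it. Quadrants form a pi-system generating the Borel sets; Dynkin's argument
  extends this to all Borel sets, and \<open>v\<close> vanishes almost everywhere.\<close>

theorem coef_eq_0_imp_0:
  assumes z: "\<And>k. coef v k = 0"
  shows "v = 0"
proof -
  have iv: "integrable T2 (fun_of v)" by (intro sq_integrable_integrable sq_integrable_fun_of)
  let ?c = "{0..<1} \<times> {0..<1} :: (real \<times> real) set"
  have tot: "(LINT p|T2. fun_of v p) = 0"
    using ann_LINT[OF ann_one[OF z]] by simp
  have ind: "(LINT p|T2. indicator A p * fun_of v p) = 0" if "A \<in> sets borel" for A
  proof -
    have meas: "?c \<inter> A \<in> sets T2" if "A \<in> sets borel" for A using that by (auto simp: sets_T2)
    have indm: "(indicator A :: _ \<Rightarrow> real) \<in> borel_measurable T2" if "A \<in> sets borel" for A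
      unfolding T2_def by (rule measurable_restrict_space1) (use that in auto)
    have ii: "integrable T2 (\<lambda>p. indicator A p * fun_of v p)" if "A \<in> sets borel" for A
    proof (rule Bochner_Integration.integrable_bound[OF iv])
      show "(\<lambda>p. indicator A p * fun_of v p) \<in> borel_measurable T2"
        using indm[OF that] by measurable
    qed (simp add: indicator_def)
    \<comment> \<open>Two quadrants meet in the quadrant whose corner is the coordinatewise
      maximum.\<close>
    have "Int_stable (range (\<lambda>a::real \<times> real. {x. eucl_less a x}))"
    proof (rule Int_stableI)
      fix A B assume "A \<in> range (\<lambda>a::real \<times> real. {x. eucl_less a x})" "B \<in> range (\<lambda>a::real \<times> real. {x. eucl_less a x})"
      then obtain a b where "A = {x. eucl_less a x}" "B = {x. eucl_less b x}" by auto
      then have "A \<inter> B = {x. eucl_less (max (fst a) (fst b), max (snd a) (snd b)) x}"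
        by (auto simp: eucl_less_pair)
      then show "A \<inter> B \<in> range (\<lambda>a::real \<times> real. {x. eucl_less a x})" by blast
    qed
    moreover have "range (\<lambda>a::real \<times> real. {x. eucl_less a x}) \<subseteq> Pow UNIV" by simp
    moreover have "A \<in> sigma_sets UNIV (range (\<lambda>a::real \<times> real. {x. eucl_less a x}))"
      using that unfolding borel_eq_greaterThan by simp
    ultimately show ?thesis
    proof (induction rule: sigma_sets_induct_disjoint[consumes 3])
      case (basic A)
      then obtain a where a: "A = {x. eucl_less a x}" by auto
      obtain d \<theta> where d: "\<And>x. x \<in> {0..<1} \<Longrightarrow> indicator {fst a<..} x = (indicator {d<..} (cos (2 * pi * x + \<theta>)) :: real)"
        using halfline_indicator_exists[of "fst a"] by blast
      obtain e \<eta> where e: "\<And>x. x \<in> {0..<1} \<Longrightarrow> indicator {snd a<..} x = (indicator {e<..} (cos (2 * pi * x + \<eta>)) :: real)"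
        using halfline_indicator_exists[of "snd a"] by blast
      have "(LINT p|T2. indicator A p * fun_of v p)
        = (LINT p|T2. fun_of v p * (indicator {d<..} (trig 1 (1,0) \<theta> p) * indicator {e<..} (trig 1 (0,1) \<eta> p)))"
      proof (rule Bochner_Integration.integral_cong[OF refl])
        fix p assume "p \<in> space T2"
        then have "fst p \<in> {0..<1}" "snd p \<in> {0..<1}" by (auto simp: space_T2)
        moreover have "indicator A p = (indicator {fst a<..} (fst p) * indicator {snd a<..} (snd p) :: real)"
          by (auto simp: a indicator_def eucl_less_pair)
        ultimately show "indicator A p * fun_of v p
          = fun_of v p * (indicator {d<..} (trig 1 (1,0) \<theta> p) * indicator {e<..} (trig 1 (0,1) \<eta> p))"
          using d e by (simp add: trig_def phase_def)
      qed
      then show ?case using ann_limit_halfline[OF z] by simp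
    next
      case empty
      then show ?case by simp
    next
      case (compl A)
      then have A: "A \<in> sets borel" unfolding borel_eq_greaterThan by simp
      have "(LINT p|T2. indicator (UNIV - A) p * fun_of v p) = (LINT p|T2. fun_of v p - indicator A p * fun_of v p)"
        by (intro Bochner_Integration.integral_cong) (auto simp: indicator_def)
      also have "\<dots> = 0" using ii[OF A] iv tot compl by simp
      finally show ?case .
    next
      case (union A)
      then have A: "A i \<in> sets borel" for i unfolding borel_eq_greaterThan by auto
      have si: "set_integrable T2 (\<Union>i. ?c \<inter> A i) (fun_of v)"
        unfolding set_integrable_def
      proof (rule Bochner_Integration.integrable_bound[OF iv])
        have [measurable]: "(\<Union>i. ?c \<inter> A i) \<in> sets T2"
          using meas[OF A] by (intro sets.countable_UN) auto
        show "(\<lambda>p. indicator (\<Union>i. ?c \<inter> A i) p *\<^sub>R fun_of v p) \<in> borel_measurable T2"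
          by measurable
      qed (auto simp: indicator_def)
      have eq: "(LINT p|T2. indicator B p * fun_of v p) = (LINT p:(?c \<inter> B)|T2. fun_of v p)" for B
        unfolding set_lebesgue_integral_def
        by (intro Bochner_Integration.integral_cong) (auto simp: space_T2 indicator_def)
      have "(LINT p|T2. indicator (\<Union>i. A i) p * fun_of v p) = (LINT p:(\<Union>i. ?c \<inter> A i)|T2. fun_of v p)"
        unfolding eq by simp
      also have "\<dots> = (\<Sum>i. (LINT p:(?c \<inter> A i)|T2. fun_of v p))"
        by (rule lebesgue_integral_countable_add[OF meas[OF A] _ si])
          (use union(1) in \<open>auto simp: disjoint_family_on_def\<close>)
      also have "\<dots> = 0" unfolding eq[symmetric] using union(3) by simp
      finally show ?case .
    qed
  qed
  \<comment> \<open>Two integrable densities with equal integrals over every measurable set agree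
    almost everywhere.\<close>
  have "AE p in T2. fun_of v p = fun_of 0 p"
  proof (rule density_unique_real)
    show "integrable T2 (fun_of 0)" by (intro sq_integrable_integrable sq_integrable_fun_of)
    fix A assume A: "A \<in> sets T2"
    then obtain B where B: "A = ?c \<inter> B" "B \<in> sets borel" by (auto simp: sets_T2)
    have "(LINT p:A|T2. fun_of v p) = (LINT p|T2. indicator B p * fun_of v p)"
      unfolding set_lebesgue_integral_def B
      by (intro Bochner_Integration.integral_cong) (auto simp: space_T2 indicator_def)
    moreover have "(LINT p:A|T2. fun_of 0 p) = (LINT p|T2. 0)"
      unfolding set_lebesgue_integral_def
    proof (rule integral_cong_AE)
      show "AE p in T2. indicator A p *\<^sub>R fun_of 0 p = 0"
        using fun_of_zero by eventually_elim simp
    qed (use A in measurable)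
    ultimately show "(LINT p:A|T2. fun_of v p) = (LINT p:A|T2. fun_of 0 p)"
      using ind[OF B(2)] by simp
  qed (rule iv)
  then show ?thesis by (rule L2T_eqI)
qed

lemma coef_inject: "(\<And>k. coef v k = coef w k) \<Longrightarrow> v = w"
  using coef_eq_0_imp_0[of "v - w"] by (simp add: coef_diff)

section \<open>Riesz--Fischer and Parseval\<close>

definition grid :: "nat \<Rightarrow> freq set" where
  "grid n = {- int n..int n} \<times> {- int n..int n}"

definition hermitian :: "(freq \<Rightarrow> complex) \<Rightarrow> bool" where
  "hermitian c \<longleftrightarrow> (\<forall>k. c (- k) = cnj (c k))"

text \<open>The real part only fixes the type: for hermitian coefficients over a set symmetric under
  negation, such as \<open>grid n\<close>, the sum is already real.\<close>

definition trig_poly :: "freq set \<Rightarrow> (freq \<Rightarrow> complex) \<Rightarrow> real \<times> real \<Rightarrow> real" where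
  "trig_poly F c p = Re (\<Sum>k\<in>F. c k * cis (phase k p))"

text \<open>Sums are bounded through their finite partial sums, which avoids side conditions on summability.\<close>

definition ell2 :: "('a \<Rightarrow> real) \<Rightarrow> real \<Rightarrow> bool" where
  "ell2 x N \<longleftrightarrow> 0 \<le> N \<and> (\<forall>F. finite F \<longrightarrow> (\<Sum>k\<in>F. (x k)^2) \<le> N^2)"

definition ell1 :: "('a \<Rightarrow> real) \<Rightarrow> real \<Rightarrow> bool" where
  "ell1 x N \<longleftrightarrow> 0 \<le> N \<and> (\<forall>F. finite F \<longrightarrow> (\<Sum>k\<in>F. \<bar>x k\<bar>) \<le> N)"

lemma finite_box [simp]: "finite (grid n)" by (simp add: grid_def)

lemma uminus_box: "uminus ` grid n = grid n"
proof -
  have "uminus ` grid n \<subseteq> grid n" for n by (auto simp: grid_def)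
  moreover from image_mono[OF this[of n], of uminus] have "grid n \<subseteq> uminus ` grid n"
    by (simp add: image_image)
  ultimately show ?thesis by blast
qed

lemma box_mono: "m \<le> n \<Longrightarrow> grid m \<subseteq> grid n" by (auto simp: grid_def)

lemma in_box: "k \<in> grid (nat (max \<bar>fst k\<bar> \<bar>snd k\<bar>))"
  by (cases k) (auto simp: grid_def)

lemma finite_subset_box:
  assumes "finite F"
  shows "\<exists>n. F \<subseteq> grid n"
  using assms
proof (induction F rule: finite_induct)
  case (insert k F)
  then obtain n where "F \<subseteq> grid n" by blast
  then have "insert k F \<subseteq> grid (max n (nat (max \<bar>fst k\<bar> \<bar>snd k\<bar>)))"
    using in_box[of k] box_mono[of _ "max n (nat (max \<bar>fst k\<bar> \<bar>snd k\<bar>))"]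
    by (meson insert_subset max.cobounded1 max.cobounded2 subset_eq)
  then show ?case by blast
qed simp

text \<open>Turns an unordered infinite sum into the limit of its sums over the squares
  \<open>grid n\<close>.\<close>

lemma filterlim_box: "filterlim grid (finite_subsets_at_top UNIV) sequentially"
  unfolding filterlim_finite_subsets_at_top
proof (intro allI impI)
  fix F :: "freq set" assume "finite F \<and> F \<subseteq> UNIV"
  then obtain n where n: "F \<subseteq> grid n" using finite_subset_box by blast
  show "\<forall>\<^sub>F m in sequentially. finite (grid m) \<and> F \<subseteq> grid m \<and> grid m \<subseteq> UNIV"
    using eventually_ge_at_top[of n] by eventually_elim (use n box_mono in auto)
qed

lemma hermitianD: "hermitian c \<Longrightarrow> c (- k) = cnj (c k)"
  unfolding hermitian_def by blast

lemma hermitian_coef: "hermitian (coef v)"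
  by (simp add: hermitian_def coef_minus)

lemma continuous_trig_poly: "continuous_on UNIV (trig_poly F c)"
  unfolding trig_poly_def[abs_def] by (intro continuous_intros)

lemma sq_trig_poly: "sq_integrable (trig_poly F c)"
  by (intro sq_integrable_continuous continuous_trig_poly)

lemma trig_poly_real:
  assumes "hermitian c" "uminus ` F = F"
  shows "complex_of_real (trig_poly F c p) = (\<Sum>k\<in>F. c k * cis (phase k p))"
proof -
  let ?s = "\<Sum>k\<in>F. c k * cis (phase k p)"
  have "cnj ?s = (\<Sum>k\<in>F. c (- k) * cis (phase (- k) p))"
    by (simp add: hermitianD[OF assms(1)] cis_cnj)
  also have "\<dots> = (\<Sum>k\<in>uminus ` F. c k * cis (phase k p))"
    by (subst sum.reindex) (auto simp: inj_on_def)
  also have "\<dots> = ?s" by (simp add: assms)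
  finally have "Im ?s = 0" by (metis add.inverse_inverse add_eq_0_iff cnj.simps(2) equal_neg_zero)
  then show ?thesis by (simp add: trig_poly_def complex_eq_iff)
qed

lemma coef_trig_poly:
  assumes "finite F" "hermitian c" "uminus ` F = F"
  shows "coef (class_of (trig_poly F c)) m = (if m \<in> F then c m else 0)"
proof -
  have i: "integrable T2 (\<lambda>p. c k * cis (phase (k - m) p))" for k
    by (rule integrable_T2_continuous) (intro continuous_intros)
  have "coef (class_of (trig_poly F c)) m = (LINT p|T2. (\<Sum>k\<in>F. c k * cis (phase k p)) * cis (- phase m p))"
    unfolding coef_class_of[OF sq_trig_poly] fourier_def trig_poly_real[OF assms(2,3)] ..
  also have "\<dots> = (LINT p|T2. (\<Sum>k\<in>F. c k * cis (phase (k - m) p)))"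
    by (simp add: sum_distrib_right mult.assoc cis_mult phase_diff)
  also have "\<dots> = (\<Sum>k\<in>F. LINT p|T2. c k * cis (phase (k - m) p))"
    by (rule Bochner_Integration.integral_sum) (rule i)
  also have "\<dots> = (\<Sum>k\<in>F. c k * (if k = m then 1 else 0))"
    by (simp add: LINT_T2_cis)
  also have "\<dots> = (if m \<in> F then c m else 0)"
    using assms(1) by (simp add: if_distrib sum.delta' cong: if_cong)
  finally show ?thesis .
qed

lemma inner_trig_poly:
  assumes "finite F" "hermitian c" "uminus ` F = F"
  shows "complex_of_real (inner w (class_of (trig_poly F c))) = (\<Sum>k\<in>F. c k * cnj (coef w k))"
proof -
  have i: "integrable T2 (\<lambda>p. c k * (complex_of_real (fun_of w p) * cis (phase k p)))" for k
    using integrable_coef[of w "- k"] by (intro integrable_mult_right) simp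
  have "complex_of_real (inner w (class_of (trig_poly F c)))
    = (LINT p|T2. complex_of_real (fun_of w p * trig_poly F c p))"
    unfolding inner_class_of[OF sq_trig_poly]
    by (intro integral_of_real[symmetric] sq_integrable_bounded_mult continuous_trig_poly)
  also have "\<dots> = (LINT p|T2. (\<Sum>k\<in>F. c k * (complex_of_real (fun_of w p) * cis (phase k p))))"
    unfolding of_real_mult trig_poly_real[OF assms(2,3)] by (simp add: sum_distrib_left mult_ac)
  also have "\<dots> = (\<Sum>k\<in>F. LINT p|T2. c k * (complex_of_real (fun_of w p) * cis (phase k p)))"
    by (rule Bochner_Integration.integral_sum) (rule i)
  also have "\<dots> = (\<Sum>k\<in>F. c k * coef w (- k))"
    by (simp add: coef_def fourier_def)
  finally show ?thesis by (simp add: coef_minus)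
qed

lemma norm_trig_poly:
  assumes "finite F" "hermitian c" "uminus ` F = F"
  shows "(norm (class_of (trig_poly F c)))^2 = (\<Sum>k\<in>F. (cmod (c k))^2)"
proof -
  have "complex_of_real ((norm (class_of (trig_poly F c)))^2) = (\<Sum>k\<in>F. c k * cnj (c k))"
    unfolding power2_norm_eq_inner inner_trig_poly[OF assms]
    by (intro sum.cong) (auto simp: coef_trig_poly[OF assms])
  also have "\<dots> = complex_of_real (\<Sum>k\<in>F. (cmod (c k))^2)"
    by (simp only: of_real_sum complex_norm_square)
  finally show ?thesis using of_real_eq_iff by blast
qed

text \<open>Bessel's inequality: a partial sum S over a symmetric square satisfies <v, S> = |S|^2,
  and Cauchy-Schwarz gives |S| <= |v|.\<close>

lemma ell2_coef: "ell2 (\<lambda>k. cmod (coef v k)) (norm v)"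
  unfolding ell2_def
proof (intro conjI allI impI)
  fix F :: "freq set" assume F: "finite F"
  then obtain n where n: "F \<subseteq> grid n" using finite_subset_box by blast
  let ?S = "class_of (trig_poly (grid n) (coef v))"
  note box = finite_box hermitian_coef uminus_box
  have "complex_of_real (inner v ?S) = complex_of_real ((norm ?S)^2)"
    unfolding inner_trig_poly[OF box] norm_trig_poly[OF box] by (simp only: of_real_sum complex_norm_square)
  then have "(norm ?S)^2 \<le> norm v * norm ?S"
    using norm_cauchy_schwarz[of v ?S] of_real_eq_iff by metis
  then have "norm ?S \<le> norm v"
    by (cases "norm ?S = 0") (auto simp: power2_eq_square)
  then have "(norm ?S)^2 \<le> (norm v)^2" by (intro power_mono) auto
  moreover have "(\<Sum>k\<in>F. (cmod (coef v k))^2) \<le> (\<Sum>k\<in>grid n. (cmod (coef v k))^2)"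
    by (rule sum_mono2) (use n in auto)
  ultimately show "(\<Sum>k\<in>F. (cmod (coef v k))^2) \<le> (norm v)^2"
    unfolding norm_trig_poly[OF box] by simp
qed simp

text \<open>Squared distances of partial sums are differences of a bounded increasing sequence, so
  completeness of \<open>L2T\<close> yields a limit. The convergence is recorded as well, since with
  \<open>c\<close> = \<open>coef v\<close> it says that the Fourier series of \<open>v\<close>
  converges to \<open>v\<close>.\<close>

lemma riesz_fischer_box:
  assumes h: "hermitian c" and N: "ell2 (\<lambda>k. cmod (c k)) N"
  shows "\<exists>v. coef v = c \<and> (\<lambda>n. class_of (trig_poly (grid n) c)) \<longlonglongrightarrow> v"
proof -
  define S where "S n = class_of (trig_poly (grid n) c)" for n
  define s where "s n = (\<Sum>k\<in>grid n. (cmod (c k))^2)" for n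
  have sinc: "incseq s"
    unfolding s_def incseq_def using box_mono by (auto intro!: sum_mono2)
  have "convergent s"
  proof -
    have "\<forall>i. s i \<le> N^2" using N by (simp add: s_def ell2_def)
    then show ?thesis using incseq_convergent[OF sinc, of "N^2"] unfolding convergent_def by metis
  qed
  then have cs: "Cauchy s" by (simp add: Cauchy_convergent_iff)
  have diff: "(norm (S m - S n))^2 = s m - s n" if "n \<le> m" for m n
  proof -
    let ?D = "grid m - grid n"
    have D: "finite ?D" "uminus ` ?D = ?D"
      by (auto simp: image_set_diff uminus_box)
    have "S m - S n = class_of (trig_poly ?D c)"
      by (rule coef_inject)
        (use box_mono[OF that] in \<open>auto simp: S_def coef_diff coef_trig_poly[OF finite_box h uminus_box] coef_trig_poly[OF D(1) h D(2)]\<close>)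
    then show ?thesis using box_mono[OF that]
      by (simp add: norm_trig_poly[OF D(1) h D(2)] s_def sum_diff)
  qed
  have "Cauchy S"
  proof (rule metric_CauchyI)
    fix e :: real assume e: "e > 0"
    then obtain M where M: "\<And>m n. m \<ge> M \<Longrightarrow> n \<ge> M \<Longrightarrow> dist (s m) (s n) < e^2"
      using metric_CauchyD[OF cs, of "e^2"] by auto
    have 1: "norm (S m - S n) < e" if "n \<ge> M" "n \<le> m" for m n
    proof (rule power2_less_imp_less)
      show "(norm (S m - S n))^2 < e^2"
        using diff[OF that(2)] M[of m n] that sinc by (auto simp: dist_real_def incseq_def)
    qed (use e in simp)
    show "\<exists>M. \<forall>m\<ge>M. \<forall>n\<ge>M. dist (S m) (S n) < e"
      by (rule exI[of _ M]) (metis 1 dist_norm norm_minus_commute nle_le)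
  qed
  then obtain v where v: "S \<longlonglongrightarrow> v" using Cauchy_convergent_iff convergent_def by blast
  have "coef v k = c k" for k
  proof -
    have "(\<lambda>n. coef (S n) k) \<longlonglongrightarrow> coef v k"
      by (rule bounded_linear.tendsto[OF bounded_linear_coef v])
    moreover have "\<forall>\<^sub>F n in sequentially. coef (S n) k = c k"
      using eventually_ge_at_top[of "nat (max \<bar>fst k\<bar> \<bar>snd k\<bar>)"]
    proof eventually_elim
      case (elim n)
      then have "k \<in> grid n" using in_box[of k] box_mono by blast
      then show ?case by (simp add: S_def coef_trig_poly[OF finite_box h uminus_box])
    qed
    then have "(\<lambda>n. coef (S n) k) \<longlonglongrightarrow> c k" by (rule tendsto_eventually)
    ultimately show ?thesis using LIMSEQ_unique by blast
  qed
  then show ?thesis using v unfolding S_def by blast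
qed

lemma trig_poly_coef_tendsto: "(\<lambda>n. class_of (trig_poly (grid n) (coef v))) \<longlonglongrightarrow> v"
  using riesz_fischer_box[OF hermitian_coef ell2_coef, of v] coef_inject by metis

lemma norm_le_ell2:
  assumes "ell2 (\<lambda>k. cmod (coef v k)) N"
  shows "norm v \<le> N"
proof (rule LIMSEQ_le_const2[OF tendsto_norm[OF trig_poly_coef_tendsto[of v]]], intro exI allI impI)
  fix n
  have "(norm (class_of (trig_poly (grid n) (coef v))))^2 \<le> N^2"
    unfolding norm_trig_poly[OF finite_box hermitian_coef uminus_box] using assms by (simp add: ell2_def)
  then show "norm (class_of (trig_poly (grid n) (coef v))) \<le> N"
    by (rule power2_le_imp_le) (use assms in \<open>simp add: ell2_def\<close>)
qed

theorem riesz_fischer: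
  assumes "hermitian c" and "ell2 (\<lambda>k. cmod (c k)) N"
  obtains v where "coef v = c" "norm v \<le> N"
  using riesz_fischer_box[OF assms] norm_le_ell2 assms by metis

lemma summable_on_bounded:
  fixes f :: "'a \<Rightarrow> 'b::banach"
  assumes "\<And>F. finite F \<Longrightarrow> (\<Sum>k\<in>F. norm (f k)) \<le> B"
  shows "f summable_on UNIV"
proof (rule abs_summable_summable, rule nonneg_bdd_above_summable_on)
  show "bdd_above (sum (\<lambda>k. norm (f k)) ` {F. F \<subseteq> UNIV \<and> finite F})"
    using assms by (auto intro!: bdd_aboveI2)
qed simp

text \<open>Bessel gives absolute convergence; the value is then identified along the squares, where
  the sum is an inner product with a partial Fourier sum.\<close>

theorem parseval: "((\<lambda>k. coef v k * cnj (coef w k)) has_sum complex_of_real (inner v w)) UNIV"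
proof -
  let ?f = "\<lambda>k. coef v k * cnj (coef w k)"
  have "?f summable_on UNIV"
  proof (rule summable_on_bounded)
    fix F :: "freq set" assume F: "finite F"
    have "norm (?f k) \<le> (cmod (coef v k))^2 + (cmod (coef w k))^2" for k
      using sum_squares_bound[of "cmod (coef v k)" "cmod (coef w k)"]
      by (auto simp: norm_mult intro: order_trans[rotated])
    then have "(\<Sum>k\<in>F. norm (?f k)) \<le> (\<Sum>k\<in>F. (cmod (coef v k))^2 + (cmod (coef w k))^2)"
      by (rule sum_mono)
    also have "\<dots> \<le> (norm v)^2 + (norm w)^2"
      unfolding sum.distrib using ell2_coef[of v] ell2_coef[of w] F by (intro add_mono) (auto simp: ell2_def)
    finally show "(\<Sum>k\<in>F. norm (?f k)) \<le> (norm v)^2 + (norm w)^2" .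
  qed
  then obtain s where s: "(?f has_sum s) UNIV" by (auto simp: summable_on_def)
  have "(\<lambda>n. sum ?f (grid n)) \<longlonglongrightarrow> s"
    using filterlim_compose[OF s[unfolded has_sum_def] filterlim_box] .
  moreover have "(\<lambda>n. complex_of_real (inner w (class_of (trig_poly (grid n) (coef v)))))
      \<longlonglongrightarrow> complex_of_real (inner w v)"
    by (intro tendsto_intros trig_poly_coef_tendsto)
  ultimately have "s = complex_of_real (inner w v)"
    unfolding inner_trig_poly[OF finite_box hermitian_coef uminus_box] using LIMSEQ_unique by blast
  then show ?thesis using s by (simp add: inner_commute)
qed

text \<open>The convolution theorem. As \<open>inner\<close> is real valued, Parseval is applied
  separately to the cosine and sine modulations of the continuous factor and the results are
  combined with -i.\<close>

lemma coef_mult_continuous: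
  assumes \<phi>: "continuous_on UNIV \<phi>"
  shows "((\<lambda>k. coef v k * coef (class_of \<phi>) (l - k)) has_sum coef (class_of (\<lambda>p. fun_of v p * \<phi> p)) l) UNIV"
proof -
  let ?c = "\<lambda>p. \<phi> p * cos (phase l p)" and ?s = "\<lambda>p. \<phi> p * sin (phase l p)"
  have cc: "continuous_on UNIV ?c" "continuous_on UNIV ?s"
    using \<phi> by (auto intro!: continuous_intros)
  note sq = sq_integrable_continuous[OF cc(1)] sq_integrable_continuous[OF cc(2)] sq_integrable_continuous[OF \<phi>]
  have "((\<lambda>k. coef v k * cnj (coef (class_of ?c) k) + (- \<i>) * (coef v k * cnj (coef (class_of ?s) k)))
      has_sum (complex_of_real (inner v (class_of ?c)) + (- \<i>) * complex_of_real (inner v (class_of ?s)))) UNIV"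
    by (intro has_sum_add has_sum_cmult_right parseval)
  moreover have "coef v k * cnj (coef (class_of ?c) k) + (- \<i>) * (coef v k * cnj (coef (class_of ?s) k))
      = coef v k * coef (class_of \<phi>) (l - k)" for k
  proof -
    have i: "integrable T2 (\<lambda>p. complex_of_real (?c p) * cis (- phase k p))"
      "integrable T2 (\<lambda>p. \<i> * (complex_of_real (?s p) * cis (- phase k p)))"
      using \<phi> by (auto intro!: integrable_T2_continuous continuous_intros)
    have "coef (class_of ?c) k + \<i> * coef (class_of ?s) k
      = (LINT p|T2. complex_of_real (?c p) * cis (- phase k p) + \<i> * (complex_of_real (?s p) * cis (- phase k p)))"
      unfolding coef_class_of[OF sq(1)] coef_class_of[OF sq(2)] fourier_def
      using i by (subst Bochner_Integration.integral_add) auto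
    also have "\<dots> = coef (class_of \<phi>) (k - l)"
      unfolding coef_class_of[OF sq(3)] fourier_def
      by (intro Bochner_Integration.integral_cong refl)
        (simp add: phase_diff complex_eq_iff cos_diff sin_diff algebra_simps)
    finally have "cnj (coef (class_of ?c) k + \<i> * coef (class_of ?s) k) = coef (class_of \<phi>) (l - k)"
      using coef_minus[of "class_of \<phi>" "k - l"] by simp
    then show ?thesis by (simp add: algebra_simps flip: distrib_left)
  qed
  moreover have "complex_of_real (inner v (class_of ?c)) + (- \<i>) * complex_of_real (inner v (class_of ?s))
      = coef (class_of (\<lambda>p. fun_of v p * \<phi> p)) l"
  proof -
    have i: "integrable T2 (\<lambda>p. complex_of_real (fun_of v p * ?c p))"
      "integrable T2 (\<lambda>p. \<i> * complex_of_real (fun_of v p * ?s p))"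
      using sq_integrable_bounded_mult[OF cc(1)] sq_integrable_bounded_mult[OF cc(2)]
      by (auto simp del: of_real_mult intro: integrable_of_real)
    have "complex_of_real (inner v (class_of ?c)) + (- \<i>) * complex_of_real (inner v (class_of ?s))
      = (LINT p|T2. complex_of_real (fun_of v p * ?c p)) - (LINT p|T2. \<i> * complex_of_real (fun_of v p * ?s p))"
      unfolding inner_class_of[OF sq(1)] inner_class_of[OF sq(2)] by (simp del: of_real_mult)
    also have "\<dots> = (LINT p|T2. complex_of_real (fun_of v p * ?c p) - \<i> * complex_of_real (fun_of v p * ?s p))"
      by (intro Bochner_Integration.integral_diff[symmetric] i)
    also have "\<dots> = coef (class_of (\<lambda>p. fun_of v p * \<phi> p)) l"
      unfolding coef_class_of[OF sq_integrable_mult_continuous[OF sq_integrable_fun_of \<phi>]] fourier_def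
      by (intro Bochner_Integration.integral_cong refl) (simp add: complex_eq_iff algebra_simps)
    finally show ?thesis .
  qed
  ultimately show ?thesis by simp
qed

section \<open>Weak derivatives and Fourier coefficients\<close>

definition dmult :: "nat \<Rightarrow> nat \<Rightarrow> freq \<Rightarrow> complex" where
  "dmult i j k = (\<i> * of_real (2 * pi * of_int (fst k))) ^ i * (\<i> * of_real (2 * pi * of_int (snd k))) ^ j"

text \<open>The maximum norm is always the modulus of one coordinate, so the two pure derivatives of
  order n control |k|^n; its balls are the squares \<open>grid n\<close>.\<close>

definition wnorm :: "freq \<Rightarrow> real" where
  "wnorm k = of_int (max \<bar>fst k\<bar> \<bar>snd k\<bar>)"

lemma test_smooth: "\<phi> \<in> test_functions \<Longrightarrow> smooth \<phi>"
  by (simp add: test_functions_def)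

lemma test_differentiable: "\<phi> \<in> test_functions \<Longrightarrow> \<phi> differentiable (at p)"
  using test_smooth smooth.cases by blast

lemma test_continuous: "\<phi> \<in> test_functions \<Longrightarrow> continuous_on UNIV \<phi>"
  using test_differentiable differentiable_imp_continuous_on[of \<phi> UNIV]
  by (auto simp: differentiable_on_def)

lemma test_periodic:
  assumes "\<phi> \<in> test_functions"
  shows "\<phi> (x + 1, y) = \<phi> (x, y)" "\<phi> (x, y + 1) = \<phi> (x, y)"
  using assms by (auto simp: test_functions_def)

lemma test_deriv_x:
  assumes "\<phi> \<in> test_functions"
  shows "((\<lambda>s. \<phi> (s, y)) has_real_derivative pd_x \<phi> (x, y)) (at x)"
proof -
  have "(\<phi> \<circ> (\<lambda>s. (s, y))) differentiable (at x)"
    by (rule differentiable_chain_at[OF _ test_differentiable[OF assms]])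
      (auto simp: differentiable_def intro!: exI derivative_eq_intros)
  then show ?thesis by (simp add: o_def DERIV_deriv_iff_real_differentiable pd_x_def)
qed

lemma test_deriv_y:
  assumes "\<phi> \<in> test_functions"
  shows "((\<lambda>s. \<phi> (x, s)) has_real_derivative pd_y \<phi> (x, y)) (at y)"
proof -
  have "(\<phi> \<circ> (\<lambda>s. (x, s))) differentiable (at y)"
    by (rule differentiable_chain_at[OF _ test_differentiable[OF assms]])
      (auto simp: differentiable_def intro!: exI derivative_eq_intros)
  then show ?thesis by (simp add: o_def DERIV_deriv_iff_real_differentiable pd_y_def)
qed

lemma test_pd_x:
  assumes "\<phi> \<in> test_functions"
  shows "pd_x \<phi> \<in> test_functions"
proof -
  have "pd_x \<phi> (x + 1, y) = pd_x \<phi> (x, y)" for x y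
  proof -
    have "((\<lambda>s. \<phi> (s + 1, y)) has_real_derivative pd_x \<phi> (x + 1, y)) (at x)"
      using test_deriv_x[OF assms, of y "x + 1"] by (simp add: DERIV_shift)
    then have "((\<lambda>s. \<phi> (s, y)) has_real_derivative pd_x \<phi> (x + 1, y)) (at x)"
      by (simp add: test_periodic[OF assms])
    then show ?thesis using DERIV_unique test_deriv_x[OF assms] by blast
  qed
  moreover have "pd_x \<phi> (x, y + 1) = pd_x \<phi> (x, y)" for x y
    by (simp add: pd_x_def test_periodic[OF assms])
  moreover have "smooth (pd_x \<phi>)" using test_smooth[OF assms] smooth.cases by blast
  ultimately show ?thesis by (simp add: test_functions_def)
qed

lemma test_pd_y:
  assumes "\<phi> \<in> test_functions"
  shows "pd_y \<phi> \<in> test_functions"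
proof -
  have "pd_y \<phi> (x, y + 1) = pd_y \<phi> (x, y)" for x y
  proof -
    have "((\<lambda>s. \<phi> (x, s + 1)) has_real_derivative pd_y \<phi> (x, y + 1)) (at y)"
      using test_deriv_y[OF assms, of x "y + 1"] by (simp add: DERIV_shift)
    then have "((\<lambda>s. \<phi> (x, s)) has_real_derivative pd_y \<phi> (x, y + 1)) (at y)"
      by (simp add: test_periodic[OF assms])
    then show ?thesis using DERIV_unique test_deriv_y[OF assms] by blast
  qed
  moreover have "pd_y \<phi> (x + 1, y) = pd_y \<phi> (x, y)" for x y
    by (simp add: pd_y_def test_periodic[OF assms])
  moreover have "smooth (pd_y \<phi>)" using test_smooth[OF assms] smooth.cases by blast
  ultimately show ?thesis by (simp add: test_functions_def)
qed

lemma Re_coef_class_of: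
  assumes "continuous_on UNIV \<phi>"
  shows "Re (cis (- \<theta>) * coef (class_of \<phi>) k) = (LINT p|T2. \<phi> p * trig 1 k \<theta> p)"
  unfolding Re_coef
proof (rule integral_cong_AE)
  show "AE p in T2. fun_of (class_of \<phi>) p * trig 1 k \<theta> p = \<phi> p * trig 1 k \<theta> p"
    using fun_of_class_of[OF sq_integrable_continuous[OF assms]] by eventually_elim simp
  show "(\<lambda>p. \<phi> p * trig 1 k \<theta> p) \<in> borel_measurable T2"
    using assms by (intro continuous_measurable_T2 continuous_intros)
qed measurable

text \<open>Shared by both coordinates. Shifting the phase by pi/2 rotates a coefficient by -i,
  which turns the sign of integration by parts into the factor i c.\<close>

lemma coef_derivative:
  assumes c: "continuous_on UNIV \<phi>" "continuous_on UNIV D"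
    and by_parts: "\<And>\<theta>. (LINT p|T2. D p * trig 1 k \<theta> p + \<phi> p * trig c k (\<theta> + pi/2) p) = 0"
  shows "coef (class_of D) k = \<i> * of_real c * coef (class_of \<phi>) k"
proof (rule complex_eqI_rotations)
  fix \<theta>
  have i: "integrable T2 (\<lambda>p. D p * trig 1 k \<theta> p)" "integrable T2 (\<lambda>p. \<phi> p * trig c k (\<theta> + pi/2) p)"
    using c by (auto intro!: integrable_T2_continuous continuous_intros)
  have "(LINT p|T2. D p * trig 1 k \<theta> p) = - (LINT p|T2. \<phi> p * trig c k (\<theta> + pi/2) p)"
    using by_parts[of \<theta>] unfolding Bochner_Integration.integral_add[OF i] by linarith
  also have "(\<lambda>p. \<phi> p * trig c k (\<theta> + pi/2) p) = (\<lambda>p. c * (\<phi> p * trig 1 k (\<theta> + pi/2) p))"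
    by (simp add: fun_eq_iff trig_def)
  finally have "(LINT p|T2. D p * trig 1 k \<theta> p) = - (c * (LINT p|T2. \<phi> p * trig 1 k (\<theta> + pi/2) p))"
    unfolding integral_mult_right_zero .
  then have "Re (cis (- \<theta>) * coef (class_of D) k) = - c * Re (cis (- (\<theta> + pi/2)) * coef (class_of \<phi>) k)"
    unfolding Re_coef_class_of[OF c(1)] Re_coef_class_of[OF c(2)] by simp
  also have "cis (- (\<theta> + pi/2)) = - \<i> * cis (- \<theta>)"
    by (simp add: complex_eq_iff cos_add sin_add cos_diff sin_diff)
  also have "- c * Re (- \<i> * cis (- \<theta>) * coef (class_of \<phi>) k) = Re (cis (- \<theta>) * (\<i> * of_real c * coef (class_of \<phi>) k))"
    by (simp add: algebra_simps)
  finally show "Re (cis (- \<theta>) * coef (class_of D) k) = Re (cis (- \<theta>) * (\<i> * of_real c * coef (class_of \<phi>) k))" .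
qed

lemma coef_pd_x:
  assumes \<phi>: "\<phi> \<in> test_functions"
  shows "coef (class_of (pd_x \<phi>)) k = \<i> * of_real (2 * pi * of_int (fst k)) * coef (class_of \<phi>) k"
proof (rule coef_derivative)
  let ?c = "2 * pi * of_int (fst k) :: real"
  show c: "continuous_on UNIV \<phi>" "continuous_on UNIV (pd_x \<phi>)"
    by (intro test_continuous test_pd_x \<phi>)+
  show "(LINT p|T2. pd_x \<phi> p * trig 1 k \<theta> p + \<phi> p * trig ?c k (\<theta> + pi/2) p) = 0" for \<theta>
  proof (rule LINT_T2_deriv_x[where F = "\<lambda>p. \<phi> p * trig 1 k \<theta> p"])
    show "continuous_on UNIV (\<lambda>p. pd_x \<phi> p * trig 1 k \<theta> p + \<phi> p * trig ?c k (\<theta> + pi/2) p)"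
      using c by (intro continuous_intros)
    show "((\<lambda>s. \<phi> (s, y) * trig 1 k \<theta> (s, y)) has_real_derivative
      pd_x \<phi> (x, y) * trig 1 k \<theta> (x, y) + \<phi> (x, y) * trig ?c k (\<theta> + pi/2) (x, y)) (at x)" for x y
      using DERIV_mult[OF test_deriv_x[OF \<phi>] trig_deriv_x[of 1 k \<theta>]] by (simp add: algebra_simps)
  qed (use test_periodic(1)[OF \<phi>, of 0] test_periodic(1)[OF trig_test, of 1 k \<theta> 0] in simp)
qed

lemma coef_pd_y:
  assumes \<phi>: "\<phi> \<in> test_functions"
  shows "coef (class_of (pd_y \<phi>)) k = \<i> * of_real (2 * pi * of_int (snd k)) * coef (class_of \<phi>) k"
proof (rule coef_derivative)
  let ?c = "2 * pi * of_int (snd k) :: real"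
  show c: "continuous_on UNIV \<phi>" "continuous_on UNIV (pd_y \<phi>)"
    by (intro test_continuous test_pd_y \<phi>)+
  show "(LINT p|T2. pd_y \<phi> p * trig 1 k \<theta> p + \<phi> p * trig ?c k (\<theta> + pi/2) p) = 0" for \<theta>
  proof (rule LINT_T2_deriv_y[where F = "\<lambda>p. \<phi> p * trig 1 k \<theta> p"])
    show "continuous_on UNIV (\<lambda>p. pd_y \<phi> p * trig 1 k \<theta> p + \<phi> p * trig ?c k (\<theta> + pi/2) p)"
      using c by (intro continuous_intros)
    show "((\<lambda>s. \<phi> (x, s) * trig 1 k \<theta> (x, s)) has_real_derivative
      pd_y \<phi> (x, y) * trig 1 k \<theta> (x, y) + \<phi> (x, y) * trig ?c k (\<theta> + pi/2) (x, y)) (at y)" for x y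
      using DERIV_mult[OF test_deriv_y[OF \<phi>] trig_deriv_y[of 1 k \<theta>]] by (simp add: algebra_simps)
  qed (use test_periodic(2)[OF \<phi>, of _ 0] test_periodic(2)[OF trig_test, of 1 k \<theta> _ 0] in simp)
qed

lemma test_pd:
  assumes "\<phi> \<in> test_functions"
  shows "(pd_x ^^ i) ((pd_y ^^ j) \<phi>) \<in> test_functions"
    and "coef (class_of ((pd_x ^^ i) ((pd_y ^^ j) \<phi>))) k = dmult i j k * coef (class_of \<phi>) k"
proof -
  have y: "(pd_y ^^ j) \<phi> \<in> test_functions
    \<and> coef (class_of ((pd_y ^^ j) \<phi>)) k = dmult 0 j k * coef (class_of \<phi>) k" for j
    by (induction j) (auto simp: assms test_pd_y coef_pd_y dmult_def)
  have "(pd_x ^^ i) ((pd_y ^^ j) \<phi>) \<in> test_functions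
    \<and> coef (class_of ((pd_x ^^ i) ((pd_y ^^ j) \<phi>))) k = dmult i j k * coef (class_of \<phi>) k"
    by (induction i) (use y in \<open>auto simp: test_pd_x coef_pd_x dmult_def\<close>)
  then show "(pd_x ^^ i) ((pd_y ^^ j) \<phi>) \<in> test_functions"
    and "coef (class_of ((pd_x ^^ i) ((pd_y ^^ j) \<phi>))) k = dmult i j k * coef (class_of \<phi>) k" by auto
qed

lemma cnj_dmult: "cnj (dmult i j k) = (- 1) ^ (i + j) * dmult i j k"
proof -
  have "cnj (dmult i j k) = (- (\<i> * of_real (2 * pi * of_int (fst k)))) ^ i * (- (\<i> * of_real (2 * pi * of_int (snd k)))) ^ j"
    unfolding dmult_def by simp
  also have "\<dots> = (- 1) ^ (i + j) * dmult i j k"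
    unfolding dmult_def power_minus[of "\<i> * _"] power_add by (simp only: mult_ac)
  finally show ?thesis .
qed

lemma dmult_uminus: "dmult i j (- k) = cnj (dmult i j k)"
  by (simp add: dmult_def)

text \<open>Forward, cosines of all phases serve as test functions. Backward, Parseval moves the
  multiplier onto the test function, and its conjugation yields the sign (-1)^(i+j).\<close>

theorem has_weak_deriv_iff: "has_weak_deriv v i j g \<longleftrightarrow> (\<forall>k. coef g k = dmult i j k * coef v k)"
proof
  assume L: "has_weak_deriv v i j g"
  show "\<forall>k. coef g k = dmult i j k * coef v k"
  proof
    fix k
    let ?A = "(2 * pi * of_int (fst k)) ^ i * (2 * pi * of_int (snd k)) ^ j :: real"
    let ?n = "i + j"
    \<comment> \<open>Writes i^n as (-1)^n times a rotation by -n pi/2, the form in which n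
      differentiations of a cosine produce it.\<close>
    have d: "dmult i j k = (- 1) ^ ?n * of_real ?A * cis (- (of_nat ?n * (pi/2)))"
    proof -
      have c: "cis (- (pi/2)) = - \<i>" by (simp add: complex_eq_iff)
      have "cis (- (of_nat ?n * (pi/2))) = (- \<i>) ^ ?n"
        unfolding c[symmetric] Complex.DeMoivre by simp
      then have "(- 1) ^ ?n * cis (- (of_nat ?n * (pi/2))) = \<i> ^ ?n"
        by (simp add: power_mult_distrib[symmetric])
      then show ?thesis unfolding dmult_def power_mult_distrib of_real_mult of_real_power power_add
        by (simp add: mult_ac)
    qed
    show "coef g k = dmult i j k * coef v k"
    proof (rule complex_eqI_rotations)
      fix \<theta>
      let ?\<eta> = "\<theta> + of_nat ?n * (pi/2)"
      have "(LINT p|T2. fun_of v p * trig ?A k ?\<eta> p) = (-1) ^ ?n * (LINT p|T2. fun_of g p * trig 1 k \<theta> p)"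
        using L trig_test[of 1 k \<theta>] unfolding has_weak_deriv_def by (auto simp: pd_xy_trig)
      moreover have "(LINT p|T2. fun_of v p * trig A k ?\<eta> p) = A * Re (cis (- ?\<eta>) * coef v k)" for A
      proof -
        have "(\<lambda>p. fun_of v p * trig A k ?\<eta> p) = (\<lambda>p. A * (fun_of v p * trig 1 k ?\<eta> p))"
          by (simp add: fun_eq_iff trig_def)
        then show ?thesis unfolding Re_coef by simp
      qed
      ultimately have 1: "?A * Re (cis (- ?\<eta>) * coef v k) = (-1) ^ ?n * Re (cis (- \<theta>) * coef g k)"
        unfolding Re_coef by metis
      have 2: "t = s * (a * r)" if "a * r = s * t" "s * s = 1" for a r s t :: real
        unfolding that(1) using that(2) by (metis mult.assoc mult_1)
      have 3: "Re (cis (- \<theta>) * coef g k) = (-1) ^ ?n * (?A * Re (cis (- ?\<eta>) * coef v k))"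
        by (rule 2[OF 1]) (metis power_mult_distrib mult_minus1 minus_minus power_one)
      have 4: "s * (a * Re z) = Re (of_real s * of_real a * z)" for s a z by simp
      have "(-1) ^ ?n * of_real ?A * (cis (- ?\<eta>) * coef v k) = cis (- \<theta>) * (dmult i j k * coef v k)"
        unfolding d minus_add_distrib cis_mult[symmetric] by (simp only: mult_ac)
      moreover have "complex_of_real ((-1) ^ ?n) = (-1) ^ ?n" by simp
      ultimately have 5: "complex_of_real ((-1) ^ ?n) * of_real ?A * (cis (- ?\<eta>) * coef v k)
          = cis (- \<theta>) * (dmult i j k * coef v k)" by (simp only:)
      show "Re (cis (- \<theta>) * coef g k) = Re (cis (- \<theta>) * (dmult i j k * coef v k))"
        by (rule trans[OF 3], rule trans[OF 4], rule arg_cong[OF 5])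
    qed
  qed
next
  assume R: "\<forall>k. coef g k = dmult i j k * coef v k"
  show "has_weak_deriv v i j g"
    unfolding has_weak_deriv_def
  proof
    fix \<phi> assume \<phi>: "\<phi> \<in> test_functions"
    let ?D = "(pd_x ^^ i) ((pd_y ^^ j) \<phi>)"
    have sq: "sq_integrable \<phi>" "sq_integrable ?D"
      by (intro sq_integrable_continuous test_continuous \<phi> test_pd(1))+
    have "((\<lambda>k. (-1) ^ (i + j) * (coef g k * cnj (coef (class_of \<phi>) k)))
        has_sum (-1) ^ (i + j) * complex_of_real (inner g (class_of \<phi>))) UNIV"
      by (intro has_sum_cmult_right parseval)
    moreover have "(\<lambda>k. (-1) ^ (i + j) * (coef g k * cnj (coef (class_of \<phi>) k))) = (\<lambda>k. coef v k * cnj (coef (class_of ?D) k))"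
      using R by (simp add: test_pd(2)[OF \<phi>] cnj_dmult fun_eq_iff)
    ultimately have "((\<lambda>k. coef v k * cnj (coef (class_of ?D) k))
        has_sum (-1) ^ (i + j) * complex_of_real (inner g (class_of \<phi>))) UNIV"
      by (simp only:)
    from has_sum_unique[OF parseval this]
    have "complex_of_real (inner v (class_of ?D)) = (-1) ^ (i + j) * complex_of_real (inner g (class_of \<phi>))" .
    also have "\<dots> = complex_of_real ((-1) ^ (i + j) * inner g (class_of \<phi>))" by simp
    finally have "inner v (class_of ?D) = (-1) ^ (i + j) * inner g (class_of \<phi>)"
      unfolding of_real_eq_iff .
    then show "(LINT p|T2. fun_of v p * ?D p) = (-1) ^ (i + j) * (LINT p|T2. fun_of g p * \<phi> p)"
      unfolding inner_class_of[OF sq(1)] inner_class_of[OF sq(2)] .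
  qed
qed

lemma wderiv_eqI:
  assumes "\<And>k. coef g k = dmult i j k * coef v k"
  shows "wderiv i j v = g"
  unfolding wderiv_def
proof (rule the_equality)
  show "has_weak_deriv v i j g" using assms has_weak_deriv_iff by blast
  show "h = g" if "has_weak_deriv v i j h" for h
  proof (rule coef_inject)
    fix k from that show "coef h k = coef g k" unfolding assms has_weak_deriv_iff by blast
  qed
qed

lemma coef_wderiv:
  assumes "v \<in> W n" "i + j \<le> n"
  shows "coef (wderiv i j v) k = dmult i j k * coef v k"
proof -
  obtain g where "has_weak_deriv v i j g" using assms unfolding W_def by blast
  then have g: "coef g k = dmult i j k * coef v k" for k unfolding has_weak_deriv_iff by blast
  show ?thesis using wderiv_eqI[OF g] g by simp
qed

lemma wderiv_diff:
  assumes "v \<in> W n" "w \<in> W n" "i + j \<le> n"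
  shows "wderiv i j (v - w) = wderiv i j v - wderiv i j w"
  using assms by (intro wderiv_eqI) (simp add: coef_diff coef_wderiv algebra_simps)

lemma W_diff: "v \<in> W n \<Longrightarrow> w \<in> W n \<Longrightarrow> v - w \<in> W n"
  unfolding W_def has_weak_deriv_iff
  by (auto simp: coef_diff right_diff_distrib) (metis coef_diff)

lemma W_mono: "m \<le> n \<Longrightarrow> v \<in> W n \<Longrightarrow> v \<in> W m" by (auto simp: W_def)

lemma wnorm_nonneg [simp]: "0 \<le> wnorm k" by (simp add: wnorm_def)

lemma cmod_dmult_le: "cmod (dmult i j k) \<le> (2 * pi * wnorm k) ^ (i + j)"
proof -
  have "cmod (dmult i j k) = \<bar>2 * pi * of_int (fst k)\<bar> ^ i * \<bar>2 * pi * of_int (snd k)\<bar> ^ j"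
    unfolding dmult_def norm_mult norm_power by (simp add: abs_mult norm_mult)
  also have "\<dots> \<le> (2 * pi * wnorm k) ^ i * (2 * pi * wnorm k) ^ j"
    by (intro mult_mono power_mono) (auto simp: abs_mult wnorm_def intro!: mult_left_mono)
  finally show ?thesis by (simp add: power_add)
qed

lemma ell2_mono:
  assumes "ell2 x N" "\<And>k. \<bar>y k\<bar> \<le> \<bar>x k\<bar>"
  shows "ell2 y N"
  unfolding ell2_def
proof (intro conjI allI impI)
  fix F :: "'a set" assume F: "finite F"
  have "(\<Sum>k\<in>F. (y k)^2) \<le> (\<Sum>k\<in>F. (x k)^2)"
    using assms(2) by (intro sum_mono) (simp add: abs_le_square_iff)
  also have "\<dots> \<le> N^2" using assms(1) F by (simp add: ell2_def)
  finally show "(\<Sum>k\<in>F. (y k)^2) \<le> N^2" .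
qed (use assms in \<open>simp add: ell2_def\<close>)

lemma ell2_scale:
  assumes "ell2 x N" "0 \<le> c"
  shows "ell2 (\<lambda>k. c * x k) (c * N)"
  unfolding ell2_def
proof (intro conjI allI impI)
  fix F :: "'a set" assume F: "finite F"
  have "(\<Sum>k\<in>F. (c * x k)^2) = c^2 * (\<Sum>k\<in>F. (x k)^2)"
    by (simp add: power_mult_distrib sum_distrib_left)
  also have "\<dots> \<le> c^2 * N^2" using assms F by (intro mult_left_mono) (auto simp: ell2_def)
  finally show "(\<Sum>k\<in>F. (c * x k)^2) \<le> (c * N)^2" by (simp add: power_mult_distrib)
qed (use assms in \<open>auto simp: ell2_def\<close>)

text \<open>The converse of \<open>coef_wderiv\<close>: a square summable, hermitian multiplied
  sequence is realised by Riesz-Fischer.\<close>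

lemma W_memI:
  assumes "\<And>i j. i + j \<le> n \<Longrightarrow> \<exists>N. ell2 (\<lambda>k. cmod (dmult i j k) * cmod (coef v k)) N"
  shows "v \<in> W n"
  unfolding W_def
proof (intro CollectI allI impI)
  fix i j assume "i + j \<le> n"
  then obtain N where N: "ell2 (\<lambda>k. cmod (dmult i j k * coef v k)) N"
    using assms unfolding norm_mult by blast
  have h: "hermitian (\<lambda>k. dmult i j k * coef v k)"
    unfolding hermitian_def by (simp only: dmult_uminus coef_minus complex_cnj_mult)
      blast
  obtain g where "coef g = (\<lambda>k. dmult i j k * coef v k)" using riesz_fischer[OF h N] by blast
  then show "\<exists>g. has_weak_deriv v i j g" unfolding has_weak_deriv_iff by metis
qed

section \<open>Trilinear bounds for sequences on the lattice\<close>

lemma ell1_mono: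
  assumes "ell1 x N" "\<And>k. \<bar>y k\<bar> \<le> \<bar>x k\<bar>"
  shows "ell1 y N"
  using assms unfolding ell1_def by (meson order_trans sum_mono)

lemma ell2_nonneg: "ell2 x N \<Longrightarrow> 0 \<le> N" by (simp add: ell2_def)

lemma L2_set_le_ell2: "ell2 x N \<Longrightarrow> finite F \<Longrightarrow> L2_set x F \<le> N"
  unfolding L2_set_def by (rule real_le_lsqrt) (auto simp: ell2_def intro: sum_nonneg)

lemma ell2_reindex:
  assumes "ell2 x N" "inj h"
  shows "ell2 (\<lambda>k. x (h k)) N"
  unfolding ell2_def
proof (intro conjI allI impI)
  fix F :: "'b set" assume F: "finite F"
  have "(\<Sum>k\<in>F. (x (h k))^2) = (\<Sum>k\<in>h ` F. (x k)^2)"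
    using assms(2) by (subst sum.reindex) (auto simp: inj_on_def)
  also have "\<dots> \<le> N^2" using assms(1) F by (simp add: ell2_def)
  finally show "(\<Sum>k\<in>F. (x (h k))^2) \<le> N^2" .
qed (use assms in \<open>simp add: ell2_def\<close>)

lemma sum_mult_le_ell2:
  assumes "ell2 x X" "ell2 y Y" "finite F"
  shows "(\<Sum>k\<in>F. \<bar>x k\<bar> * \<bar>y k\<bar>) \<le> X * Y"
proof -
  have "(\<Sum>k\<in>F. \<bar>x k\<bar> * \<bar>y k\<bar>) \<le> L2_set x F * L2_set y F" by (rule L2_set_mult_ineq)
  also have "\<dots> \<le> X * Y"
    using assms by (intro mult_mono L2_set_le_ell2) (auto simp: L2_set_nonneg ell2_nonneg)
  finally show ?thesis .
qed

lemma ell1_mult: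
  assumes "ell2 x X" "ell2 y Y"
  shows "ell1 (\<lambda>k. x k * y k) (X * Y)"
  using sum_mult_le_ell2[OF assms] ell2_nonneg[OF assms(1)] ell2_nonneg[OF assms(2)]
  by (simp add: ell1_def abs_mult)

text \<open>With m = k - l held fixed, the sum over l is a Cauchy-Schwarz pairing of
  \<open>x\<close> with a translate of \<open>y\<close>; the l1 factor is summed last.\<close>

lemma trilinear1:
  fixes a x y :: "freq \<Rightarrow> real"
  assumes a: "ell1 a A" and x: "ell2 x X" and y: "ell2 y Y" and F: "finite F"
  shows "(\<Sum>(k, l)\<in>F. \<bar>a (k - l)\<bar> * \<bar>x l\<bar> * \<bar>y k\<bar>) \<le> A * X * Y"
proof -
  let ?h = "\<lambda>(k, l). (k - l, l :: freq)"
  let ?M = "(\<lambda>(k, l). k - l) ` F" and ?L = "snd ` F"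
  have inj: "inj_on ?h F" by (auto simp: inj_on_def)
  have "(\<Sum>(k, l)\<in>F. \<bar>a (k - l)\<bar> * \<bar>x l\<bar> * \<bar>y k\<bar>) = (\<Sum>(m, l)\<in>?h ` F. \<bar>a m\<bar> * \<bar>x l\<bar> * \<bar>y (m + l)\<bar>)"
    by (subst sum.reindex[OF inj]) (auto simp: case_prod_beta intro!: sum.cong)
  also have "\<dots> \<le> (\<Sum>(m, l)\<in>?M \<times> ?L. \<bar>a m\<bar> * \<bar>x l\<bar> * \<bar>y (m + l)\<bar>)"
  proof (rule sum_mono2)
    show "?h ` F \<subseteq> ?M \<times> ?L" by force
  qed (use F in \<open>auto simp: case_prod_beta\<close>)
  also have "\<dots> = (\<Sum>m\<in>?M. \<bar>a m\<bar> * (\<Sum>l\<in>?L. \<bar>x l\<bar> * \<bar>y (m + l)\<bar>))"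
    by (simp add: sum.cartesian_product[symmetric] sum_distrib_left mult.assoc)
  also have "\<dots> \<le> (\<Sum>m\<in>?M. \<bar>a m\<bar> * (X * Y))"
    by (intro sum_mono mult_left_mono sum_mult_le_ell2 x ell2_reindex[OF y]) (use F in \<open>auto simp: inj_def\<close>)
  also have "\<dots> = (\<Sum>m\<in>?M. \<bar>a m\<bar>) * (X * Y)" by (simp add: sum_distrib_right)
  also have "\<dots> \<le> A * (X * Y)"
    using a F ell2_nonneg[OF x] ell2_nonneg[OF y] by (intro mult_right_mono) (auto simp: ell1_def)
  finally show ?thesis by (simp add: mult.assoc)
qed

text \<open>Substituting k - l for l exchanges the kernel and the second factor.\<close>

lemma trilinear2:
  fixes a x y :: "freq \<Rightarrow> real"
  assumes a: "ell2 a A" and x: "ell1 x X" and y: "ell2 y Y" and F: "finite F"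
  shows "(\<Sum>(k, l)\<in>F. \<bar>a (k - l)\<bar> * \<bar>x l\<bar> * \<bar>y k\<bar>) \<le> A * X * Y"
proof -
  let ?h = "\<lambda>(k, l). (k, k - l :: freq)"
  have inj: "inj_on ?h F" by (auto simp: inj_on_def)
  have "(\<Sum>(k, l)\<in>F. \<bar>a (k - l)\<bar> * \<bar>x l\<bar> * \<bar>y k\<bar>) = (\<Sum>(k, l)\<in>?h ` F. \<bar>x (k - l)\<bar> * \<bar>a l\<bar> * \<bar>y k\<bar>)"
    by (subst sum.reindex[OF inj]) (auto simp: case_prod_beta mult_ac intro!: sum.cong)
  also have "\<dots> \<le> X * A * Y" using F by (intro trilinear1 x a y) auto
  finally show ?thesis by (simp add: mult_ac)
qed

text \<open>Exchanging k and l reflects the kernel, which leaves its l2 bound unchanged.\<close>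

lemma trilinear3:
  fixes a x y :: "freq \<Rightarrow> real"
  assumes a: "ell2 a A" and x: "ell2 x X" and y: "ell1 y Y" and F: "finite F"
  shows "(\<Sum>(k, l)\<in>F. \<bar>a (k - l)\<bar> * \<bar>x l\<bar> * \<bar>y k\<bar>) \<le> A * X * Y"
proof -
  have inj: "inj_on prod.swap F" by (auto simp: inj_on_def)
  have "(\<Sum>(k, l)\<in>F. \<bar>a (k - l)\<bar> * \<bar>x l\<bar> * \<bar>y k\<bar>) = (\<Sum>(l, k)\<in>prod.swap ` F. \<bar>a (- (l - k))\<bar> * \<bar>y k\<bar> * \<bar>x l\<bar>)"
    by (subst sum.reindex[OF inj]) (auto simp: case_prod_beta mult_ac intro!: sum.cong)
  also have "\<dots> \<le> A * Y * X"
    using F by (intro trilinear2[of "\<lambda>m. a (- m)"] ell2_reindex[OF a] x y) (auto simp: inj_def)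
  finally show ?thesis by (simp add: mult_ac)
qed

lemma wnorm_triangle: "wnorm (k + l) \<le> wnorm k + wnorm l"
proof -
  have "max \<bar>fst (k + l)\<bar> \<bar>snd (k + l)\<bar> \<le> max \<bar>fst k\<bar> \<bar>snd k\<bar> + max \<bar>fst l\<bar> \<bar>snd l\<bar>"
    unfolding fst_add snd_add by linarith
  then show ?thesis unfolding wnorm_def of_int_add[symmetric] of_int_le_iff .
qed

lemma wnorm_minus [simp]: "wnorm (- k) = wnorm k" by (simp add: wnorm_def)

lemma wnorm_zero [simp]: "wnorm 0 = 0" by (simp add: wnorm_def)

lemma wnorm_zero_iff [simp]: "wnorm k = 0 \<longleftrightarrow> k = 0"
  by (cases k) (auto simp: wnorm_def max_def zero_prod_def)

lemma wnorm_ge_1: "k \<noteq> 0 \<Longrightarrow> 1 \<le> wnorm k"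
proof -
  assume "k \<noteq> 0"
  then have "max \<bar>fst k\<bar> \<bar>snd k\<bar> \<ge> 1" by (cases k) (auto simp: zero_prod_def)
  then show ?thesis unfolding wnorm_def by linarith
qed

lemma wnorm_le_power: "0 < n \<Longrightarrow> wnorm k \<le> wnorm k ^ n"
  using wnorm_ge_1[of k] self_le_power[of "wnorm k" n] by (cases "k = 0") (auto simp: wnorm_def)

lemma wnorm_power_mono: "0 < m \<Longrightarrow> m \<le> n \<Longrightarrow> wnorm k ^ m \<le> wnorm k ^ n"
  using wnorm_ge_1[of k] power_increasing[of m n "wnorm k"] by (cases "k = 0") (auto simp: power_0_left)

text \<open>The correction 2 / (n + 1) makes the induction close by telescoping: 2 / (n+2)^2 <= 2 /
  (n+1) - 2 / (n+2).\<close>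

lemma sum_inverse_squares: "(\<Sum>i\<in>{- int n..int n}. 1 / (1 + real_of_int \<bar>i\<bar>)^2) \<le> 4 - 2 / (real n + 1)"
proof (induction n)
  case (Suc n)
  have "{- int (Suc n)..int (Suc n)} = insert (int (Suc n)) (insert (- int (Suc n)) {- int n..int n})"
    by auto
  then have "(\<Sum>i\<in>{- int (Suc n)..int (Suc n)}. 1 / (1 + real_of_int \<bar>i\<bar>)^2)
    = 2 / (real n + 2)^2 + (\<Sum>i\<in>{- int n..int n}. 1 / (1 + real_of_int \<bar>i\<bar>)^2)"
    by (simp add: algebra_simps)
  also have "\<dots> \<le> 2 / (real n + 2)^2 + (4 - 2 / (real n + 1))" using Suc by simp
  also have "\<dots> \<le> 4 - 2 / (real (Suc n) + 1)"
  proof -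
    have "2 / (real n + 2)^2 \<le> 2 / ((real n + 1) * (real n + 2))"
      by (intro divide_left_mono) (auto simp: power2_eq_square)
    also have "\<dots> = 2 / (real n + 1) - 2 / (real n + 2)" by (simp add: field_simps)
    finally show ?thesis by (simp add: add.commute)
  qed
  finally show ?case .
qed simp

text \<open>Summability of \<open>\<bar>k\<bar>\<^sup>-\<^sup>4\<close> on the lattice replaces the Sobolev embeddings in two dimensions.\<close>

lemma ell2_wnorm: "ell2 (\<lambda>k. 1 / wnorm k ^ 2) 16"
  unfolding ell2_def
proof (intro conjI allI impI)
  fix F :: "freq set" assume "finite F"
  then obtain n where n: "F \<subseteq> grid n" using finite_subset_box by blast
  let ?g = "\<lambda>i::int. 1 / (1 + real_of_int \<bar>i\<bar>)^2"
  \<comment> \<open>Off the origin each 1 + |k_i| is at most 2 \<open>wnorm k\<close>, and 2^4 = 16;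
    the two one-dimensional sums are at most 4, giving 16 * 4 * 4 = 16^2. At the origin 1 / 0 =
    0.\<close>
  have b: "(1 / wnorm k ^ 2)^2 \<le> 16 * (?g (fst k) * ?g (snd k))" for k
  proof (cases "k = 0")
    case False
    then have w: "1 \<le> wnorm k" by (rule wnorm_ge_1)
    have "1 + real_of_int \<bar>fst k\<bar> \<le> 2 * wnorm k" "1 + real_of_int \<bar>snd k\<bar> \<le> 2 * wnorm k"
      using w by (auto simp: wnorm_def)
    then have "(1 + real_of_int \<bar>fst k\<bar>) * (1 + real_of_int \<bar>snd k\<bar>) \<le> (2 * wnorm k) * (2 * wnorm k)"
      by (intro mult_mono) auto
    then have "((1 + real_of_int \<bar>fst k\<bar>) * (1 + real_of_int \<bar>snd k\<bar>))^2 \<le> ((2 * wnorm k) * (2 * wnorm k))^2"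
      by (rule power_mono) auto
    then have "((1 + real_of_int \<bar>fst k\<bar>) * (1 + real_of_int \<bar>snd k\<bar>))^2 \<le> 16 * (wnorm k ^ 2)^2"
      by (simp add: power_mult_distrib power2_eq_square mult_ac)
    then have "16 / (16 * (wnorm k ^ 2)^2) \<le> 16 / ((1 + real_of_int \<bar>fst k\<bar>) * (1 + real_of_int \<bar>snd k\<bar>))^2"
      using w by (intro divide_left_mono mult_pos_pos) auto
    then show ?thesis by (simp add: power_divide power_mult_distrib)
  qed simp
  have "(\<Sum>k\<in>F. (1 / wnorm k ^ 2)^2) \<le> (\<Sum>k\<in>grid n. (1 / wnorm k ^ 2)^2)"
    by (rule sum_mono2) (use n in auto)
  also have "\<dots> \<le> (\<Sum>k\<in>grid n. 16 * (?g (fst k) * ?g (snd k)))"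
    by (intro sum_mono b)
  also have "\<dots> = 16 * ((\<Sum>i\<in>{- int n..int n}. ?g i) * (\<Sum>i\<in>{- int n..int n}. ?g i))"
    unfolding grid_def sum_product sum.cartesian_product
    by (simp only: sum_distrib_left case_prod_beta)
  also have "\<dots> \<le> 16 * (4 * 4)"
    using sum_inverse_squares[of n]
    by (intro mult_left_mono mult_mono) (auto intro: sum_nonneg order_trans)
  finally show "(\<Sum>k\<in>F. (1 / wnorm k ^ 2)^2) \<le> 16^2" by simp
qed simp

text \<open>Cauchy-Schwarz against |k|^-2: an l1 bound costs two derivatives. For n = 0 the weight
  0^0 = 1 does not remove the zero mode, so it must vanish.\<close>

lemma ell1_wnorm:
  assumes "ell2 (\<lambda>k. wnorm k ^ (n + 2) * x k) N" "n = 0 \<Longrightarrow> x 0 = 0"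
  shows "ell1 (\<lambda>k. wnorm k ^ n * x k) (16 * N)"
proof (rule ell1_mono[OF ell1_mult[OF ell2_wnorm assms(1)]])
  fix k
  show "\<bar>wnorm k ^ n * x k\<bar> \<le> \<bar>1 / wnorm k ^ 2 * (wnorm k ^ (n + 2) * x k)\<bar>"
    using assms(2) by (cases "k = 0") (auto simp: power_add power_0_left power2_eq_square)
qed

section \<open>The transport term in Fourier variables\<close>

definition wedge :: "freq \<Rightarrow> freq \<Rightarrow> real" where
  "wedge k l = of_int (fst k * snd l - snd k * fst l)"

text \<open>One derivative on each factor gives (2 pi i)^2 = - 4 pi^2, and the frequency k - l of
  the stream function may be replaced by k because l wedge l = 0.\<close>

abbreviation symb :: "freq \<Rightarrow> freq \<Rightarrow> complex" where
  "symb k l \<equiv> of_real (- 4 * pi^2 * wedge k l)"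

text \<open>The coefficients of \<open>\<nabla>\<^sup>\<bottom>\<psi> \<cdot> \<nabla>v\<close>, where \<open>p\<close> and \<open>x\<close> are those of \<open>\<psi>\<close> and \<open>v\<close>.\<close>

definition jac :: "(freq \<Rightarrow> complex) \<Rightarrow> (freq \<Rightarrow> complex) \<Rightarrow> freq \<Rightarrow> complex" where
  "jac p x k = (\<Sum>\<^sub>\<infinity>l. symb k l * p (k - l) * x l)"

abbreviation majorant :: "(freq \<Rightarrow> complex) \<Rightarrow> (freq \<Rightarrow> complex) \<Rightarrow> freq \<Rightarrow> freq \<Rightarrow> real" where
  "majorant p x k l \<equiv> 4 * pi^2 * \<bar>wedge k l\<bar> * cmod (p (k - l)) * cmod (x l)"

text \<open>Four derivatives in l2 are what the fourth order elliptic inverse gains from L2; they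
  make the second derivatives of the stream function absolutely summable.\<close>

definition stream :: "(freq \<Rightarrow> complex) \<Rightarrow> real \<Rightarrow> bool" where
  "stream p P \<longleftrightarrow> hermitian p \<and> ell2 (\<lambda>k. wnorm k ^ 4 * cmod (p k)) P"

lemma abs_wedge_le: "\<bar>wedge k l\<bar> \<le> 2 * wnorm k * wnorm l"
proof -
  have m: "\<bar>i * j\<bar> \<le> max \<bar>fst k\<bar> \<bar>snd k\<bar> * max \<bar>fst l\<bar> \<bar>snd l\<bar>"
    if "\<bar>i\<bar> \<le> max \<bar>fst k\<bar> \<bar>snd k\<bar>" "\<bar>j\<bar> \<le> max \<bar>fst l\<bar> \<bar>snd l\<bar>" for i j
    using that unfolding abs_mult by (intro mult_mono) (auto simp: le_max_iff_disj)
  have "\<bar>fst k * snd l - snd k * fst l\<bar> \<le> 2 * (max \<bar>fst k\<bar> \<bar>snd k\<bar> * max \<bar>fst l\<bar> \<bar>snd l\<bar>)"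
    using m[of "fst k" "snd l"] m[of "snd k" "fst l"] by linarith
  then have "real_of_int \<bar>fst k * snd l - snd k * fst l\<bar> \<le> of_int (2 * (max \<bar>fst k\<bar> \<bar>snd k\<bar> * max \<bar>fst l\<bar> \<bar>snd l\<bar>))"
    by (simp only: of_int_le_iff)
  then show ?thesis by (simp add: wedge_def wnorm_def)
qed

lemma wedge_diff: "wedge (k - l) l = wedge k l" "wedge k (k - l) = - wedge k l" "wedge (k - l) k = wedge k l"
  by (simp_all add: wedge_def algebra_simps)

lemma wedge_swap: "wedge l k = - wedge k l" by (simp add: wedge_def)

lemma wedge_minus [simp]: "wedge (- k) (- l) = wedge k l" by (simp add: wedge_def)

text \<open>As k wedge k = 0, either argument may be replaced by k - l: one derivative falls on the
  stream function and the other on whichever of k and l is preferred.\<close>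

lemma abs_wedge_diff_le:
  "\<bar>wedge k l\<bar> \<le> 2 * wnorm (k - l) * wnorm l" "\<bar>wedge k l\<bar> \<le> 2 * wnorm (k - l) * wnorm k"
  using abs_wedge_le[of "k - l" l] abs_wedge_le[of "k - l" k] by (simp_all add: wedge_diff)

lemma stream_ell1:
  assumes "stream p P"
  shows "ell1 (\<lambda>k. wnorm k ^ 2 * cmod (p k)) (16 * P)" "ell1 (\<lambda>k. wnorm k * cmod (p k)) (16 * P)"
proof -
  show *: "ell1 (\<lambda>k. wnorm k ^ 2 * cmod (p k)) (16 * P)"
    using assms ell1_wnorm[of 2 "\<lambda>k. cmod (p k)" P] by (simp add: stream_def)
  show "ell1 (\<lambda>k. wnorm k * cmod (p k)) (16 * P)"
    by (rule ell1_mono[OF *]) (auto simp: abs_mult intro!: mult_right_mono wnorm_le_power)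
qed

text \<open>The velocity has absolutely summable coefficients and the advected function spends one
  derivative. The constant is 4 from the kernel, 2 from the wedge and 16 from the l1 bound.\<close>

lemma sum_transport_le:
  assumes p: "stream p P" and x: "ell2 (\<lambda>k. wnorm k * cmod (x k)) X" and y: "ell2 y Y" and F: "finite F"
  shows "(\<Sum>(k, l)\<in>F. majorant p x k l * \<bar>y k\<bar>) \<le> 128 * pi^2 * P * X * Y"
proof -
  let ?t = "\<lambda>k l. \<bar>wnorm (k - l) * cmod (p (k - l))\<bar> * \<bar>wnorm l * cmod (x l)\<bar> * \<bar>y k\<bar>"
  have "majorant p x k l * \<bar>y k\<bar> \<le> 8 * pi^2 * ?t k l" for k l
  proof -
    have "(4 * pi^2 * \<bar>wedge k l\<bar>) * (cmod (p (k - l)) * cmod (x l) * \<bar>y k\<bar>)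
      \<le> (4 * pi^2 * (2 * wnorm (k - l) * wnorm l)) * (cmod (p (k - l)) * cmod (x l) * \<bar>y k\<bar>)"
      by (intro mult_right_mono mult_left_mono abs_wedge_diff_le) auto
    then show ?thesis by (simp add: abs_mult mult_ac)
  qed
  then have "(\<Sum>(k, l)\<in>F. majorant p x k l * \<bar>y k\<bar>)
      \<le> (\<Sum>(k, l)\<in>F. 8 * pi^2 * ?t k l)"
    by (intro sum_mono) (auto simp: case_prod_beta)
  also have "\<dots> = 8 * pi^2 * (\<Sum>(k, l)\<in>F. ?t k l)" by (simp add: sum_distrib_left case_prod_beta)
  also have "\<dots> \<le> 8 * pi^2 * (16 * P * X * Y)"
    by (intro mult_left_mono trilinear1[OF stream_ell1(2)[OF p] x y F]) auto
  finally show ?thesis by (simp add: mult_ac)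
qed

text \<open>Testing the bilinear bound with the unit sequence at \<open>k\<close> gives absolute
  convergence for that single \<open>k\<close>.\<close>

lemma jac_has_sum:
  assumes p: "stream p P" and x: "ell2 (\<lambda>k. wnorm k * cmod (x k)) X"
  shows "((\<lambda>l. symb k l * p (k - l) * x l) has_sum jac p x k) UNIV"
  unfolding jac_def
proof (rule has_sum_infsum, rule summable_on_bounded)
  fix F :: "freq set" assume F: "finite F"
  have y: "ell2 (\<lambda>k'. if k' = k then 1 else 0) 1"
    unfolding ell2_def by (simp add: if_distrib[of "\<lambda>t. t^2"] cong: if_cong)
  have "(\<Sum>l\<in>F. norm (symb k l * p (k - l) * x l))
     = (\<Sum>(k', l)\<in>{k} \<times> F. majorant p x k' l * \<bar>if k' = k then 1 else 0\<bar>)"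
    by (simp add: sum.cartesian_product[symmetric] norm_mult abs_mult norm_power)
  also have "\<dots> \<le> 128 * pi^2 * P * X * 1"
    using F by (intro sum_transport_le[OF p x y]) auto
  finally show "(\<Sum>l\<in>F. norm (symb k l * p (k - l) * x l)) \<le> 128 * pi^2 * P * X * 1" .
qed

lemma has_sum_norm_le:
  assumes "(f has_sum s) UNIV" "\<And>F. finite F \<Longrightarrow> (\<Sum>k\<in>F. norm (f k)) \<le> D"
  shows "norm s \<le> D"
proof (rule Lim_norm_ubound[OF _ assms(1)[unfolded has_sum_def]])
  have "norm (sum f F) \<le> D" if "finite F" for F using norm_sum[of f F] assms(2)[OF that] by linarith
  then show "\<forall>\<^sub>F F in finite_subsets_at_top UNIV. norm (sum f F) \<le> D"
    by (intro eventually_finite_subsets_at_top_weakI) auto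
qed simp

text \<open>The bound D on finite sums of moduli makes the double series absolutely convergent, so
  it may be summed over l first, or reindexed as a whole; the third conclusion is kept for the
  latter.\<close>

lemma jac_pairing:
  assumes p: "stream p P" and x: "ell2 (\<lambda>k. wnorm k * cmod (x k)) X"
    and D: "\<And>F. finite F \<Longrightarrow>
      (\<Sum>(k, l)\<in>F. majorant p x k l * cmod (z k)) \<le> D"
  obtains s where "((\<lambda>k. z k * jac p x k) has_sum s) UNIV" "cmod s \<le> D"
    "((\<lambda>(k, l). z k * (symb k l * p (k - l) * x l)) has_sum s) UNIV"
proof -
  let ?f = "\<lambda>(k, l). z k * (symb k l * p (k - l) * x l)"
  have b: "(\<Sum>kl\<in>F. norm (?f kl)) \<le> D" if "finite F" for F
    using D[OF that] by (simp add: norm_mult abs_mult norm_power case_prod_beta mult_ac)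
  then obtain s where s: "(?f has_sum s) UNIV"
    using summable_on_bounded[of ?f D] by (auto simp: summable_on_def)
  then have "(?f has_sum s) (Sigma UNIV (\<lambda>_. UNIV))" by simp
  then have "((\<lambda>k. z k * jac p x k) has_sum s) UNIV"
  proof (rule has_sum_SigmaD)
    show "((\<lambda>l. ?f (k, l)) has_sum z k * jac p x k) UNIV" for k
      using has_sum_cmult_right[OF jac_has_sum[OF p x, of k], of "z k"] by (simp only: prod.case)
  qed
  then show ?thesis using that has_sum_norm_le[OF s b] s by blast
qed

text \<open>Duality: pairing with the conjugate of \<open>jac\<close> itself, restricted to a finite
  set, gives s <= C sqrt s for the sum s of squares.\<close>

lemma ell2_jac:
  assumes p: "stream p P" and x: "ell2 (\<lambda>k. wnorm k * cmod (x k)) X"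
  shows "ell2 (\<lambda>k. cmod (jac p x k)) (128 * pi^2 * P * X)"
proof -
  let ?C = "128 * pi^2 * P * X"
  have C0: "0 \<le> ?C" using p ell2_nonneg[OF x] by (auto simp: stream_def ell2_nonneg)
  show ?thesis unfolding ell2_def
  proof (intro conjI allI impI C0)
    fix F :: "freq set" assume F: "finite F"
    let ?s = "\<Sum>k\<in>F. (cmod (jac p x k))^2"
    define z where "z k = (if k \<in> F then cnj (jac p x k) else 0)" for k
    have s0: "0 \<le> ?s" by (rule sum_nonneg) simp
    have z2: "ell2 (\<lambda>k. cmod (z k)) (sqrt ?s)"
      unfolding ell2_def
    proof (intro conjI allI impI)
      fix G :: "freq set" assume G: "finite G"
      have "(\<Sum>k\<in>G. (cmod (z k))^2) = (\<Sum>k\<in>G \<inter> F. (cmod (jac p x k))^2)"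
        by (rule sum.mono_neutral_cong_right) (use G in \<open>auto simp: z_def\<close>)
      also have "\<dots> \<le> ?s" by (rule sum_mono2) (use F in auto)
      finally show "(\<Sum>k\<in>G. (cmod (z k))^2) \<le> (sqrt ?s)^2" using s0 by simp
    qed (use s0 in simp)
    obtain t where t: "((\<lambda>k. z k * jac p x k) has_sum t) UNIV" "cmod t \<le> ?C * sqrt ?s"
    proof (rule jac_pairing[OF p x])
      fix G :: "(freq \<times> freq) set" assume G: "finite G"
      show "(\<Sum>(k, l)\<in>G. majorant p x k l * cmod (z k)) \<le> ?C * sqrt ?s"
        using sum_transport_le[OF p x z2 G] by simp
    qed
    have "((\<lambda>k. z k * jac p x k) has_sum (\<Sum>k\<in>F. z k * jac p x k)) UNIV"
      by (rule has_sum_finite_neutralI) (use F in \<open>auto simp: z_def\<close>)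
    then have "t = (\<Sum>k\<in>F. z k * jac p x k)" using has_sum_unique[OF t(1)] by blast
    also have "\<dots> = (\<Sum>k\<in>F. complex_of_real ((cmod (jac p x k))^2))"
      unfolding complex_norm_square by (rule sum.cong) (auto simp: z_def)
    also have "\<dots> = complex_of_real ?s" by (rule of_real_sum[symmetric])
    finally have "?s \<le> ?C * sqrt ?s" using t(2) s0 by (simp del: of_real_sum)
    then have "sqrt ?s * sqrt ?s \<le> ?C * sqrt ?s" using s0 by simp
    moreover have "r \<le> c" if "r * r \<le> c * r" "0 \<le> c" "0 \<le> r" for r c :: real
      using that by (cases "r = 0") auto
    ultimately have "sqrt ?s \<le> ?C" using C0 s0 real_sqrt_ge_0_iff by blast
    then show "?s \<le> ?C^2" using s0 by (metis power_mono real_sqrt_ge_0_iff real_sqrt_pow2)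
  qed
qed

text \<open>Exchanging the two frequencies and conjugating changes the sign of the kernel, which leaves
  only the difference of the weights.\<close>

lemma jac_antisymmetric:
  assumes p: "stream p P" and x0: "ell2 (\<lambda>k. cmod (x k)) X\<^sub>0" and x: "ell2 (\<lambda>k. wnorm k * cmod (x k)) X"
    and w: "\<And>k. \<bar>w k\<bar> \<le> B"
    and D: "\<And>F. finite F \<Longrightarrow> (\<Sum>(k, l)\<in>F. \<bar>w k - w l\<bar> *
      (majorant p x k l * cmod (x k))) \<le> D"
  obtains s where "((\<lambda>k. of_real (w k) * cnj (x k) * jac p x k) has_sum s) UNIV" "\<bar>2 * Re s\<bar> \<le> D"
proof -
  have B: "0 \<le> B" using w[of 0] by linarith
  let ?z = "\<lambda>k. of_real (w k) * cnj (x k)"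
  let ?f = "\<lambda>(k, l). ?z k * (symb k l * p (k - l) * x l)"
  have z: "ell2 (\<lambda>k. cmod (?z k)) (B * X\<^sub>0)"
    by (rule ell2_mono[OF ell2_scale[OF x0 B]]) (use w B in \<open>auto simp: norm_mult abs_mult intro!: mult_right_mono\<close>)
  \<comment> \<open>\<open>B\<close> and \<open>X\<^sub>0\<close> only secure absolute convergence
    here; the final bound is governed by \<open>D\<close>.\<close>
  obtain s where s: "((\<lambda>k. ?z k * jac p x k) has_sum s) UNIV" "(?f has_sum s) UNIV"
  proof (rule jac_pairing[OF p x])
    fix F :: "(freq \<times> freq) set" assume F: "finite F"
    show "(\<Sum>(k, l)\<in>F. majorant p x k l * cmod (?z k))
      \<le> 128 * pi^2 * P * X * (B * X\<^sub>0)"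
      using sum_transport_le[OF p x z F] by simp
  qed
  let ?g = "\<lambda>(k, l). of_real (w k - w l) * (cnj (x k) * (symb k l * p (k - l) * x l))"
  have "((\<lambda>kl. cnj (?f (prod.swap kl))) has_sum cnj s) UNIV"
  proof -
    have "((\<lambda>kl. ?f (prod.swap kl)) has_sum s) UNIV"
      using s(2) has_sum_reindex_bij_betw[of prod.swap UNIV UNIV ?f s] by simp
    then show ?thesis by (simp only: has_sum_cnj_iff)
  qed
  then have "((\<lambda>kl. ?f kl + cnj (?f (prod.swap kl))) has_sum (s + cnj s)) UNIV"
    by (intro has_sum_add s)
  moreover have "?f kl + cnj (?f (prod.swap kl)) = ?g kl" for kl
  proof -
    obtain k l where kl: "kl = (k, l)" by (cases kl)
    have "cnj (p (l - k)) = p (k - l)"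
      using p hermitianD[of p "k - l"] by (auto simp: stream_def)
    then show ?thesis unfolding kl by (simp add: wedge_swap[of l k] algebra_simps)
  qed
  ultimately have g: "(?g has_sum (s + cnj s)) UNIV" by simp
  have "cmod (s + cnj s) \<le> D"
  proof (rule has_sum_norm_le[OF g])
    fix F :: "(freq \<times> freq) set" assume F: "finite F"
    have "norm (?g (k, l)) = \<bar>w k - w l\<bar> * (majorant p x k l * cmod (x k))" for k l
      by (simp add: norm_mult abs_mult norm_power mult_ac flip: of_real_diff)
    then show "(\<Sum>kl\<in>F. norm (?g kl)) \<le> D" using D[OF F] by (simp add: case_prod_beta)
  qed
  moreover have "s + cnj s = complex_of_real (2 * Re s)" by (simp add: complex_eq_iff)
  ultimately have "\<bar>2 * Re s\<bar> \<le> D" by (simp only: norm_of_real)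
  then show ?thesis using that s(1) by blast
qed

section \<open>Flux divergence and velocity in Fourier variables\<close>

lemma hermitian_jac:
  assumes p: "hermitian p" and x: "hermitian x"
  shows "hermitian (jac p x)"
  unfolding hermitian_def
proof
  fix k
  have "cnj (jac p x k) = (\<Sum>\<^sub>\<infinity>l. cnj (symb k l * p (k - l) * x l))"
    unfolding jac_def by (rule infsum_cnj[symmetric])
  also have "\<dots> = (\<Sum>\<^sub>\<infinity>l. symb (- k) l * p (- k - l) * x l)"
  proof (rule infsum_reindex_bij_witness[of _ uminus uminus])
    fix l
    have "cnj (p (k - l)) = p (- k - - l)" using hermitianD[OF p, of "k - l"] by simp
    then show "symb (- k) (- l) * p (- k - - l) * x (- l)
      = cnj (symb k l * p (k - l) * x l)"
      by (simp add: hermitianD[OF x])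
  qed auto
  finally show "jac p x (- k) = cnj (jac p x k)" unfolding jac_def by simp
qed

text \<open>Cosines are test functions and determine all coefficients; this gives the uniqueness
  behind \<open>flux_div\<close>.\<close>

lemma inner_test_eq_coef:
  assumes "\<And>\<phi>. \<phi> \<in> test_functions \<Longrightarrow> (LINT p|T2. fun_of g p * \<phi> p) = (LINT p|T2. fun_of h p * \<phi> p)"
  shows "g = h"
proof (rule coef_inject, rule complex_eqI_rotations)
  show "Re (cis (- \<theta>) * coef g k) = Re (cis (- \<theta>) * coef h k)" for k \<theta>
    unfolding Re_coef by (rule assms[OF trig_test])
qed

lemma flux_div_eqI:
  assumes "has_flux_div v u g"
  shows "flux_div v u = g"
  unfolding flux_div_def
proof (rule the_equality[where a=g])
  show "h = g" if "has_flux_div v u h" for h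
    by (rule inner_test_eq_coef) (use that assms in \<open>auto simp: has_flux_div_def\<close>)
qed (rule assms)

lemma dmult_simps:
  "dmult 0 0 k = 1" "dmult (Suc 0) 0 k = \<i> * of_real (2 * pi * of_int (fst k))"
  "dmult 0 (Suc 0) k = \<i> * of_real (2 * pi * of_int (snd k))"
  by (simp_all add: dmult_def)

text \<open>The flux itself is only known to be integrable, so the integrand is regrouped:
  \<open>v\<close> times a derivative of the test function is square integrable, with coefficients
  given by convolution. Parseval against the velocity then gives a double series that is a
  reindexing of the pairing of \<open>jac\<close> with the test function.\<close>

lemma has_flux_div_stream:
  assumes \<psi>: "\<psi> \<in> W 1" and p: "stream (coef \<psi>) P"
    and x: "ell2 (\<lambda>k. wnorm k * cmod (coef v k)) X"
    and g: "coef g = jac (coef \<psi>) (coef v)"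
  shows "has_flux_div v (perp_grad \<psi>) g"
  unfolding has_flux_div_def
proof
  fix \<phi> assume \<phi>: "\<phi> \<in> test_functions"
  have c: "continuous_on UNIV \<phi>" "continuous_on UNIV (pd_x \<phi>)" "continuous_on UNIV (pd_y \<phi>)"
    by (intro test_continuous test_pd_x test_pd_y \<phi>)+
  define u1 where "u1 = - wderiv 0 1 \<psi>"
  define u2 where "u2 = wderiv 1 0 \<psi>"
  define \<Phi> where "\<Phi> = coef (class_of \<phi>)"
  define q1 where "q1 = class_of (\<lambda>p. fun_of v p * pd_x \<phi> p)"
  define q2 where "q2 = class_of (\<lambda>p. fun_of v p * pd_y \<phi> p)"
  have sq: "sq_integrable (\<lambda>p. fun_of v p * pd_x \<phi> p)" "sq_integrable (\<lambda>p. fun_of v p * pd_y \<phi> p)"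
    by (intro sq_integrable_mult_continuous sq_integrable_fun_of c)+
  have u: "coef u1 l = - (\<i> * of_real (2 * pi * of_int (snd l)) * coef \<psi> l)"
    "coef u2 l = \<i> * of_real (2 * pi * of_int (fst l)) * coef \<psi> l" for l
    using coef_wderiv[OF \<psi>, of 0 1 l] coef_wderiv[OF \<psi>, of 1 0 l]
    by (simp_all add: u1_def u2_def coef_uminus dmult_simps)
  have q: "((\<lambda>k. coef v k * (\<i> * of_real (2 * pi * of_int (fst (l - k))) * \<Phi> (l - k))) has_sum coef q1 l) UNIV"
    "((\<lambda>k. coef v k * (\<i> * of_real (2 * pi * of_int (snd (l - k))) * \<Phi> (l - k))) has_sum coef q2 l) UNIV" for l
    using coef_mult_continuous[OF c(2), of v l] coef_mult_continuous[OF c(3), of v l]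
    unfolding coef_pd_x[OF \<phi>] coef_pd_y[OF \<phi>] q1_def q2_def \<Phi>_def by auto
  obtain s where s: "((\<lambda>n. cnj (\<Phi> n) * jac (coef \<psi>) (coef v) n) has_sum s) UNIV"
    "((\<lambda>(n, k). cnj (\<Phi> n) * (symb n k * coef \<psi> (n - k) * coef v k)) has_sum s) UNIV"
  proof (rule jac_pairing[OF p x])
    fix F :: "(freq \<times> freq) set" assume F: "finite F"
    show "(\<Sum>(k, l)\<in>F. majorant (coef \<psi>) (coef v) k l * cmod (cnj (\<Phi> k)))
      \<le> 128 * pi^2 * P * X * norm (class_of \<phi>)"
      using sum_transport_le[OF p x ell2_coef F, of "class_of \<phi>"] by (simp add: \<Phi>_def)
  qed
  have sg: "complex_of_real (inner g (class_of \<phi>)) = s"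
  proof (rule has_sum_unique[OF parseval])
    show "((\<lambda>k. coef g k * cnj (coef (class_of \<phi>) k)) has_sum s) UNIV"
      using s(1) unfolding g \<Phi>_def[symmetric] by (simp only: mult.commute)
  qed
  let ?f = "\<lambda>(l, k). symb l k * coef v k * \<Phi> (l - k) * cnj (coef \<psi> l)"
  let ?F = "\<lambda>(n, k). cnj (\<Phi> n) * (symb n k * coef \<psi> (n - k) * coef v k)"
  have "((\<lambda>nk. - ?F nk) has_sum - s) UNIV"
    using s(2) unfolding has_sum_uminus minus_minus .
  \<comment> \<open>With l = k - n, hermitian symmetry turns reflected arguments into conjugates,
    and the sign change of the kernel supplies the minus sign of the weak divergence.\<close>
  moreover have "((\<lambda>nk. - ?F nk) has_sum - s) UNIV
      \<longleftrightarrow> (?f has_sum - s) UNIV"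
  proof (rule has_sum_reindex_bij_witness[where i = "\<lambda>(l, k). (k - l, k)" and j = "\<lambda>(n, k). (k - n, k)"])
    fix nk :: "freq \<times> freq"
    obtain n k where nk: "nk = (n, k)" by (cases nk)
    have "\<Phi> (- n) = cnj (\<Phi> n)" "coef \<psi> (k - n) = cnj (coef \<psi> (n - k))"
      using coef_minus[of _ n] coef_minus[of \<psi> "n - k"] by (simp_all add: \<Phi>_def)
    moreover have "wedge (k - n) k = - wedge n k" by (simp add: wedge_def algebra_simps)
    ultimately show "?f (case nk of (n, k) \<Rightarrow> (k - n, k))
      = - ?F nk"
      unfolding nk by simp
  qed auto
  ultimately have f: "(?f has_sum - s) (Sigma UNIV (\<lambda>_. UNIV))" by simp
  have "((\<lambda>l. coef q1 l * cnj (coef u1 l) + coef q2 l * cnj (coef u2 l)) has_sum - s) UNIV"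
  proof (rule has_sum_SigmaD[OF f])
    fix l
    have "((\<lambda>k. coef v k * (\<i> * of_real (2 * pi * of_int (fst (l - k))) * \<Phi> (l - k)) * cnj (coef u1 l)
        + coef v k * (\<i> * of_real (2 * pi * of_int (snd (l - k))) * \<Phi> (l - k)) * cnj (coef u2 l))
      has_sum (coef q1 l * cnj (coef u1 l) + coef q2 l * cnj (coef u2 l))) UNIV"
      by (intro has_sum_add has_sum_cmult_left q)
    moreover have "coef v k * (\<i> * of_real (2 * pi * of_int (fst (l - k))) * \<Phi> (l - k)) * cnj (coef u1 l)
        + coef v k * (\<i> * of_real (2 * pi * of_int (snd (l - k))) * \<Phi> (l - k)) * cnj (coef u2 l) = ?f (l, k)" for k
    proof -
      have i: "\<i> * (\<i> * z) = - z" for z by (simp flip: mult.assoc)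
      show ?thesis unfolding u
        by (simp add: wedge_def i algebra_simps power2_eq_square)
    qed
    ultimately show "((\<lambda>k. ?f (l, k)) has_sum (coef q1 l * cnj (coef u1 l) + coef q2 l * cnj (coef u2 l))) UNIV"
      by (simp only:)
  qed
  from has_sum_unique[OF has_sum_add[OF parseval parseval] this]
  have "complex_of_real (inner q1 u1 + inner q2 u2) = complex_of_real (- inner g (class_of \<phi>))"
    unfolding of_real_add of_real_minus sg .
  then have e: "inner q1 u1 + inner q2 u2 = - inner g (class_of \<phi>)" unfolding of_real_eq_iff .
  have "(LINT p|T2. fun_of v p * fun_of (fst (perp_grad \<psi>)) p * pd_x \<phi> p + fun_of v p * fun_of (snd (perp_grad \<psi>)) p * pd_y \<phi> p)
    = (LINT p|T2. fun_of u1 p * (fun_of v p * pd_x \<phi> p) + fun_of u2 p * (fun_of v p * pd_y \<phi> p))"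
    by (simp add: perp_grad_def u1_def u2_def mult_ac)
  also have "\<dots> = inner u1 q1 + inner u2 q2"
    unfolding q1_def q2_def inner_class_of[OF sq(1)] inner_class_of[OF sq(2)]
    by (intro Bochner_Integration.integral_add sq_integrable_mult sq_integrable_fun_of sq)
  also have "\<dots> = - (LINT p|T2. fun_of g p * \<phi> p)"
    using e unfolding inner_class_of[OF sq_integrable_continuous[OF c(1)]] by (simp add: inner_commute)
  finally show "(LINT p|T2. fun_of v p * fun_of (fst (perp_grad \<psi>)) p * pd_x \<phi> p + fun_of v p * fun_of (snd (perp_grad \<psi>)) p * pd_y \<phi> p)
    = - (LINT p|T2. fun_of g p * \<phi> p)" .
qed

text \<open>\<open>jac\<close> is hermitian and square summable, hence realised by a class, which
  uniqueness identifies with the definite description.\<close>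

lemma coef_flux_div:
  assumes \<psi>: "\<psi> \<in> W 1" and p: "stream (coef \<psi>) P"
    and x: "ell2 (\<lambda>k. wnorm k * cmod (coef v k)) X"
  shows "coef (flux_div v (perp_grad \<psi>)) = jac (coef \<psi>) (coef v)"
proof -
  obtain g where g: "coef g = jac (coef \<psi>) (coef v)"
    using riesz_fischer[OF hermitian_jac[OF hermitian_coef hermitian_coef] ell2_jac[OF p x]] by blast
  show ?thesis using flux_div_eqI[OF has_flux_div_stream[OF assms g]] g by simp
qed

section \<open>The elliptic operators as Fourier multipliers\<close>

lemma coef_laplacian:
  assumes "\<psi> \<in> W 2"
  shows "coef (laplacian \<psi>) k = of_real (- 4 * pi^2 * ((of_int (fst k))^2 + (of_int (snd k))^2)) * coef \<psi> k"
proof -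
  have i: "\<i> * (\<i> * z) = - z" for z by (simp flip: mult.assoc)
  show ?thesis unfolding laplacian_def coef_add
    using coef_wderiv[OF assms, of 2 0 k] coef_wderiv[OF assms, of 0 2 k]
    by (simp add: dmult_def power2_eq_square algebra_simps i)
qed

text \<open>The symbol of 1 - \<open>\<beta>\<close> Laplacian; the factor Laplacian - 1 is minus
  the case \<open>\<beta>\<close> = 1.\<close>

definition helm :: "real \<Rightarrow> freq \<Rightarrow> real" where
  "helm \<beta> k = 1 + 4 * pi^2 * \<beta> * ((of_int (fst k))^2 + (of_int (snd k))^2)"

lemma coef_helmholtz:
  assumes "\<psi> \<in> W 2"
  shows "coef (\<psi> - \<beta> *\<^sub>R laplacian \<psi>) k = of_real (helm \<beta> k) * coef \<psi> k"
  unfolding coef_diff coef_scaleR coef_laplacian[OF assms] helm_def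
  by (simp add: scaleR_conv_of_real algebra_simps)

lemma wnorm_square_le: "wnorm k ^ 2 \<le> (of_int (fst k))^2 + (of_int (snd k))^2"
proof -
  have "wnorm k = \<bar>of_int (fst k)\<bar> \<or> wnorm k = \<bar>of_int (snd k)\<bar>" by (auto simp: wnorm_def max_def)
  then show ?thesis by auto
qed

lemma helm_ge:
  assumes "\<beta> > 0"
  shows "1 + 4 * pi^2 * \<beta> * wnorm k ^ 2 \<le> helm \<beta> k" "1 \<le> helm \<beta> k" "\<beta> * wnorm k ^ 2 \<le> helm \<beta> k"
proof -
  show 1: "1 + 4 * pi^2 * \<beta> * wnorm k ^ 2 \<le> helm \<beta> k"
    unfolding helm_def using assms wnorm_square_le by (intro add_left_mono mult_left_mono) auto
  have "0 \<le> 4 * pi^2 * \<beta> * wnorm k ^ 2" using assms by simp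
  then show "1 \<le> helm \<beta> k" using 1 by linarith
  have "1 \<le> 4 * pi^2" using pi_ge_two power_mono[of 2 pi 2] by simp
  then have "1 * (\<beta> * wnorm k ^ 2) \<le> 4 * pi^2 * (\<beta> * wnorm k ^ 2)"
    using assms by (intro mult_right_mono) auto
  then show "\<beta> * wnorm k ^ 2 \<le> helm \<beta> k" using 1 by (simp add: mult.assoc)
qed

text \<open>Surjectivity is what makes the \<open>inv_into\<close> in the definitions a genuine
  right inverse. The solution is obtained by dividing coefficients by the symbol.\<close>

lemma helmholtz_surj:
  assumes "\<beta> > 0"
  shows "\<exists>\<psi>\<in>W 2. \<psi> - \<beta> *\<^sub>R laplacian \<psi> = q"
proof -
  let ?c = "\<lambda>k. of_real (1 / helm \<beta> k) * coef q k"
  have h: "hermitian ?c" unfolding hermitian_def coef_minus complex_cnj_mult helm_def by simp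
  have le: "cmod (?c k) \<le> cmod (coef q k)" for k
    using helm_ge(2)[OF assms, of k] mult_left_mono[of 1 "helm \<beta> k" "cmod (coef q k)"]
    by (simp add: norm_mult norm_divide divide_le_eq)
  obtain \<psi> where \<psi>: "coef \<psi> = ?c"
    using riesz_fischer[OF h ell2_mono[OF ell2_coef[of q]]] le by (metis abs_norm_cancel)
  have W: "\<psi> \<in> W 2"
  proof (rule W_memI)
    fix i j :: nat assume ij: "i + j \<le> 2"
    \<comment> \<open>The last summand absorbs 1 <= \<open>helm \<beta> k\<close>, the middle one 4
      pi^2 |k|^2 through \<open>\<beta>\<close> |k|^2 <= \<open>helm \<beta> k\<close>.\<close>
    let ?C = "4 * pi^2 + 4 * pi^2 / \<beta> + 1"
    have C: "0 \<le> ?C" using assms by simp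
    have b: "cmod (dmult i j k) * cmod (coef \<psi> k) \<le> ?C * cmod (coef q k)" for k
    proof -
      have "cmod (dmult i j k) \<le> (2 * pi * wnorm k) ^ (i + j)" by (rule cmod_dmult_le)
      also have "\<dots> \<le> 1 + (2 * pi * wnorm k) ^ 2"
      proof -
        have "i + j = 0 \<or> i + j = 1 \<or> i + j = 2" using ij by linarith
        moreover have "t \<le> 1 + t^2" for t :: real
          using zero_le_power2[of "t - 1"] zero_le_power2[of "t + 1"] by (simp add: power2_diff power2_sum)
        ultimately show ?thesis by auto
      qed
      also have "\<dots> = 1 + 4 * pi^2 * wnorm k ^ 2" by (simp add: power_mult_distrib)
      also have "\<dots> \<le> ?C * helm \<beta> k"
      proof -
        have "wnorm k ^ 2 \<le> helm \<beta> k / \<beta>"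
          using helm_ge(3)[OF assms, of k] assms by (simp add: pos_le_divide_eq mult.commute)
        then have "4 * pi^2 * wnorm k ^ 2 \<le> 4 * pi^2 * (helm \<beta> k / \<beta>)" by (intro mult_left_mono) auto
        moreover have "0 \<le> 4 * pi^2 * helm \<beta> k" using helm_ge(2)[OF assms, of k] by simp
        moreover have "?C * helm \<beta> k = 4 * pi^2 * helm \<beta> k + 4 * pi^2 * (helm \<beta> k / \<beta>) + helm \<beta> k"
          by (simp add: distrib_right)
        ultimately show ?thesis using helm_ge(2)[OF assms, of k] by linarith
      qed
      finally have "cmod (dmult i j k) / helm \<beta> k \<le> ?C"
        using helm_ge(2)[OF assms, of k] by (simp add: pos_divide_le_eq)
      then have "cmod (dmult i j k) / helm \<beta> k * cmod (coef q k) \<le> ?C * cmod (coef q k)"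
        by (intro mult_right_mono) auto
      moreover have "cmod (coef \<psi> k) = cmod (coef q k) / helm \<beta> k"
        using helm_ge(2)[OF assms, of k] unfolding \<psi> by (simp add: norm_mult norm_divide)
      ultimately show ?thesis by simp
    qed
    have "ell2 (\<lambda>k. cmod (dmult i j k) * cmod (coef \<psi> k)) (?C * norm q)"
    proof (rule ell2_mono[OF ell2_scale[OF ell2_coef[of q] C]])
      show "\<bar>cmod (dmult i j k) * cmod (coef \<psi> k)\<bar> \<le> \<bar>?C * cmod (coef q k)\<bar>" for k
        unfolding abs_of_nonneg[OF mult_nonneg_nonneg[OF norm_ge_zero norm_ge_zero]]
        by (rule order_trans[OF b abs_ge_self])
    qed
    then show "\<exists>N. ell2 (\<lambda>k. cmod (dmult i j k) * cmod (coef \<psi> k)) N" by blast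
  qed
  have "\<psi> - \<beta> *\<^sub>R laplacian \<psi> = q"
  proof (rule coef_inject)
    fix k
    show "coef (\<psi> - \<beta> *\<^sub>R laplacian \<psi>) k = coef q k"
      unfolding coef_helmholtz[OF W] unfolding \<psi> using helm_ge(2)[OF assms, of k] by (simp flip: of_real_mult)
  qed
  then show ?thesis using W by blast
qed

text \<open>The coefficients follow by dividing the equation by its nonvanishing symbol, so the
  choice inside \<open>inv_into\<close> is immaterial.\<close>

lemma inv_1_minus_laplacian:
  assumes "\<alpha> > 0"
  shows "inv_1_minus_laplacian \<alpha> q \<in> W 2"
    and "coef (inv_1_minus_laplacian \<alpha> q) k = of_real (1 / helm \<alpha> k) * coef q k"
proof -
  let ?L = "\<lambda>\<psi>. \<psi> - \<alpha> *\<^sub>R laplacian \<psi>"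
  have q: "q \<in> ?L ` W 2" using helmholtz_surj[OF assms, of q] by force
  have e: "?L (inv_1_minus_laplacian \<alpha> q) = q"
    unfolding inv_1_minus_laplacian_def by (rule f_inv_into_f[OF q])
  show W: "inv_1_minus_laplacian \<alpha> q \<in> W 2"
    unfolding inv_1_minus_laplacian_def by (rule inv_into_into[OF q])
  have "of_real (helm \<alpha> k) * coef (inv_1_minus_laplacian \<alpha> q) k = coef q k"
    using coef_helmholtz[OF W, of \<alpha> k] unfolding e by simp
  then show "coef (inv_1_minus_laplacian \<alpha> q) k = of_real (1 / helm \<alpha> k) * coef q k"
    using helm_ge(2)[OF assms, of k] by (simp add: field_simps)
qed

lemma inv_laplacian_minus_1:
  "coef (inv_laplacian_minus_1 q) k = - (of_real (1 / helm 1 k) * coef q k)"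
proof -
  let ?L = "\<lambda>\<psi>. laplacian \<psi> - \<psi>"
  obtain \<psi>' where \<psi>': "\<psi>' \<in> W 2" "\<psi>' - 1 *\<^sub>R laplacian \<psi>' = - q" using helmholtz_surj[of 1 "- q"] by auto
  have "?L \<psi>' = - (\<psi>' - 1 *\<^sub>R laplacian \<psi>')" by simp
  also have "\<dots> = q" unfolding \<psi>'(2) by simp
  finally have q: "q \<in> ?L ` W 2" using \<psi>'(1) by force
  have e: "?L (inv_laplacian_minus_1 q) = q"
    unfolding inv_laplacian_minus_1_def by (rule f_inv_into_f[OF q])
  have W: "inv_laplacian_minus_1 q \<in> W 2"
    unfolding inv_laplacian_minus_1_def by (rule inv_into_into[OF q])
  have "inv_laplacian_minus_1 q - 1 *\<^sub>R laplacian (inv_laplacian_minus_1 q) = - q"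
    using e by (simp add: algebra_simps)
  then have "of_real (helm 1 k) * coef (inv_laplacian_minus_1 q) k = - coef q k"
    using coef_helmholtz[OF W, of 1 k] by (simp add: coef_uminus)
  then show ?thesis using helm_ge(2)[of 1 k] by (simp add: field_simps)
qed

definition psi :: "real \<Rightarrow> L2T \<Rightarrow> L2T" where
  "psi \<alpha> q = inv_1_minus_laplacian \<alpha> (inv_laplacian_minus_1 q)"

lemma velocity_psi: "velocity \<alpha> f w = perp_grad (psi \<alpha> (w - f))"
  by (simp add: velocity_def psi_def)

lemma coef_psi:
  assumes "\<alpha> > 0"
  shows "coef (psi \<alpha> q) k = of_real (- 1 / (helm \<alpha> k * helm 1 k)) * coef q k"
  unfolding psi_def inv_1_minus_laplacian(2)[OF assms] inv_laplacian_minus_1 by simp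

lemma psi_W: "\<alpha> > 0 \<Longrightarrow> psi \<alpha> q \<in> W 1"
  unfolding psi_def by (rule W_mono[OF _ inv_1_minus_laplacian(1)]) auto

lemma psi_diff:
  assumes "\<alpha> > 0"
  shows "psi \<alpha> (q - r) = psi \<alpha> q - psi \<alpha> r"
  by (rule coef_inject) (simp add: coef_psi[OF assms] coef_diff right_diff_distrib diff_divide_distrib)

text \<open>Each factor gains two derivatives: the product of the symbols is at least
  \<open>\<alpha>\<close> |k|^4, whence the constant 1 / \<open>\<alpha>\<close>.\<close>

lemma stream_psi:
  assumes "\<alpha> > 0"
  shows "stream (coef (psi \<alpha> q)) (norm q / \<alpha>)"
  unfolding stream_def
proof
  have "ell2 (\<lambda>k. 1 / \<alpha> * cmod (coef q k)) (1 / \<alpha> * norm q)"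
    using assms by (intro ell2_scale ell2_coef) auto
  then have 1: "ell2 (\<lambda>k. 1 / \<alpha> * cmod (coef q k)) (norm q / \<alpha>)" by simp
  show "ell2 (\<lambda>k. wnorm k ^ 4 * cmod (coef (psi \<alpha> q) k)) (norm q / \<alpha>)"
  proof (rule ell2_mono[OF 1])
    fix k
    have h: "1 \<le> helm \<alpha> k" "1 \<le> helm 1 k" using helm_ge(2) assms by auto
    have "(\<alpha> * wnorm k ^ 2) * (1 * wnorm k ^ 2) \<le> helm \<alpha> k * helm 1 k"
      using assms helm_ge[OF assms, of k] helm_ge[of 1 k] by (intro mult_mono) auto
    then have "\<alpha> * wnorm k ^ 4 \<le> helm \<alpha> k * helm 1 k" by (simp add: mult.assoc flip: power_add)
    then have "wnorm k ^ 4 / (helm \<alpha> k * helm 1 k) \<le> 1 / \<alpha>"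
      using h assms by (simp add: field_simps)
    then have "wnorm k ^ 4 / (helm \<alpha> k * helm 1 k) * cmod (coef q k) \<le> 1 / \<alpha> * cmod (coef q k)"
      by (intro mult_right_mono) auto
    moreover have "cmod (coef (psi \<alpha> q) k) = cmod (coef q k) / (helm \<alpha> k * helm 1 k)"
      unfolding coef_psi[OF assms] using h by (simp add: norm_mult norm_divide)
    ultimately have "wnorm k ^ 4 * cmod (coef (psi \<alpha> q) k) \<le> 1 / \<alpha> * cmod (coef q k)" by simp
    then show "\<bar>wnorm k ^ 4 * cmod (coef (psi \<alpha> q) k)\<bar> \<le> \<bar>1 / \<alpha> * cmod (coef q k)\<bar>"
      unfolding abs_of_nonneg[OF mult_nonneg_nonneg[OF zero_le_power[OF wnorm_nonneg] norm_ge_zero]]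
      by (rule order_trans[OF _ abs_ge_self])
  qed
qed (rule hermitian_coef)

section \<open>Weighted energy estimates\<close>

text \<open>
  The cut-off makes the energies finite sums, hence differentiable in time although the highest
  derivatives of a solution are not, and keeps the Lipschitz bound of \<open>r\<^sup>n\<close> uniformly in \<open>N\<close>.
\<close>

definition wt :: "nat \<Rightarrow> nat \<Rightarrow> real \<Rightarrow> real" where
  "wt n N r = r ^ n * max 0 (1 - r / real N)"

lemma power_diff_le:
  fixes a b :: real
  assumes "0 \<le> b" "b \<le> a"
  shows "a ^ Suc n - b ^ Suc n \<le> (real n + 1) * (a - b) * a ^ n"
proof (induction n)
  case (Suc n)
  have "a ^ Suc (Suc n) - b ^ Suc (Suc n) = a * (a ^ Suc n - b ^ Suc n) + (a - b) * b ^ Suc n"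
    by (simp add: algebra_simps)
  also have "\<dots> \<le> a * ((real n + 1) * (a - b) * a ^ n) + (a - b) * a ^ Suc n"
    using assms Suc by (intro add_mono mult_left_mono power_mono) auto
  also have "\<dots> = (real (Suc n) + 1) * (a - b) * a ^ Suc n" by (simp add: algebra_simps)
  finally show ?case .
qed (use assms in simp)

lemma wt_bounds: "0 \<le> r \<Longrightarrow> 0 \<le> wt n N r" "0 \<le> r \<Longrightarrow> wt n N r \<le> r ^ n"
  by (auto simp: wt_def intro!: mult_nonneg_nonneg mult_right_le_one_le)

lemma wt_eq_0: "0 < N \<Longrightarrow> real N \<le> r \<Longrightarrow> wt n N r = 0"
  by (simp add: wt_def max_def field_simps)

text \<open>The constant is (n + 1) + (n + 2): the second part comes from r^(n+2) / N, where a / N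
  <= 1 below the cut-off removes N. If only \<open>a\<close> lies beyond the cut-off, N - b <= a - b
  suffices.\<close>

lemma wt_lipschitz:
  assumes ab: "0 \<le> b" "b \<le> a" and N: "0 < N"
  shows "\<bar>wt (Suc n) N a - wt (Suc n) N b\<bar> \<le> (2 * real n + 3) * (a - b) * a ^ n"
proof -
  have N': "0 < real N" using N by simp
  have an: "0 \<le> (a - b) * a ^ n" using ab by simp
  consider "a \<le> real N" | "real N < a" "b \<le> real N" | "real N < a" "real N < b" by linarith
  then show ?thesis
  proof cases
    case 1
    let ?x = "a ^ Suc n - b ^ Suc n" and ?y = "(a ^ Suc (Suc n) - b ^ Suc (Suc n)) / real N"
    have "a / real N \<le> 1" "b / real N \<le> 1" using 1 ab N' by auto
    then have e: "wt (Suc n) N a - wt (Suc n) N b = ?x - ?y"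
      using N' by (simp add: wt_def max_def field_simps)
    have x: "0 \<le> ?x" "?x \<le> (real n + 1) * (a - b) * a ^ n"
      using power_mono[of b a "Suc n"] ab power_diff_le[OF ab, of n] by auto
    have y0: "0 \<le> ?y" using power_mono[of b a "Suc (Suc n)"] ab N' by (intro divide_nonneg_pos) auto
    have "?y \<le> ((real (Suc n) + 1) * (a - b) * a ^ Suc n) / real N"
      using power_diff_le[OF ab, of "Suc n"] N' by (intro divide_right_mono) auto
    also have "\<dots> = ((real n + 2) * ((a - b) * a ^ n)) * (a / real N)" by simp
    also have "\<dots> \<le> (real n + 2) * ((a - b) * a ^ n)"
      using an 1 N' ab by (intro mult_right_le_one_le mult_nonneg_nonneg) auto
    finally have "?y \<le> (real n + 2) * ((a - b) * a ^ n)" .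
    moreover have "(2 * real n + 3) * (a - b) * a ^ n = (real n + 1) * (a - b) * a ^ n + (real n + 2) * ((a - b) * a ^ n)"
      by (simp add: algebra_simps)
    ultimately show ?thesis unfolding e using x y0 by linarith
  next
    case 2
    have "wt (Suc n) N a = 0" using 2 N by (intro wt_eq_0) auto
    moreover have "wt (Suc n) N b = b ^ n * ((b / real N) * (real N - b))"
      using 2 N' by (simp add: wt_def max_def field_simps)
    moreover have "b ^ n * ((b / real N) * (real N - b)) \<le> a ^ n * (1 * (a - b))"
      using ab 2 N' by (intro mult_mono power_mono) auto
    ultimately have "\<bar>wt (Suc n) N a - wt (Suc n) N b\<bar> \<le> 1 * ((a - b) * a ^ n)"
      using wt_bounds(1)[OF ab(1), of "Suc n" N] by (simp add: mult.commute)
    also have "\<dots> \<le> (2 * real n + 3) * ((a - b) * a ^ n)" using an by (intro mult_right_mono) auto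
    finally show ?thesis by (simp add: mult.assoc)
  next
    case 3
    then have "wt (Suc n) N a = 0" "wt (Suc n) N b = 0" using N by (auto intro: wt_eq_0)
    then show ?thesis using an by (simp add: mult.assoc)
  qed
qed

text \<open>Here a, b, m stand for |k|, |l|, |k - l|, and 2 m min a b bounds the wedge. For the
  larger frequency a <= b + m, so two of its powers become 2 b^2 + 2 m^2: they fall on the other
  factor or on the stream function. The constant is 13 * 2 * 2 with 13 = 2 * 5 + 3.\<close>

lemma weight3:
  assumes "0 \<le> a" "0 \<le> b" "\<bar>a - b\<bar> \<le> m" "0 < N"
  shows "\<bar>wt 6 N a - wt 6 N b\<bar> * (2 * m * min a b) \<le> 52 * (m^2 * a^3 * b^3 + m^4 * (a^3 * b + a * b^3))"
  using assms
proof (induction a b rule: linorder_wlog)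
  case (le b a)
  then have m: "a - b \<le> m" "0 \<le> m" by auto
  have "\<bar>wt 6 N b - wt 6 N a\<bar> * (2 * m * min b a) \<le> (13 * (a - b) * a^5) * (2 * m * b)"
    using wt_lipschitz[of b a N 5] le m by (intro mult_mono) (auto simp: abs_minus_commute)
  also have "\<dots> \<le> (13 * m * a^5) * (2 * m * b)"
    using le m by (intro mult_right_mono mult_left_mono) auto
  also have "\<dots> = (26 * m^2 * a^3 * b) * a^2" by (simp add: power_numeral_reduce algebra_simps)
  also have "\<dots> \<le> (26 * m^2 * a^3 * b) * (2 * b^2 + 2 * m^2)"
  proof (rule mult_left_mono)
    have "a^2 \<le> (b + m)^2" using le m by (intro power_mono) auto
    also have "\<dots> \<le> 2 * b^2 + 2 * m^2" using sum_squares_bound[of b m] by (simp add: power2_sum)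
    finally show "a^2 \<le> 2 * b^2 + 2 * m^2" .
  qed (use le m in auto)
  also have "\<dots> = 52 * (m^2 * b^3 * a^3 + m^4 * (a^3 * b))" by (simp add: power_numeral_reduce algebra_simps)
  also have "\<dots> \<le> 52 * (m^2 * b^3 * a^3 + m^4 * (b^3 * a + b * a^3))"
    using le m by (intro mult_left_mono add_left_mono) (auto simp: mult.commute)
  finally show ?case .
next
  case (sym b a)
  then show ?case by (simp add: abs_minus_commute min.commute mult_ac add.commute)
qed

text \<open>
  The critical term \<open>m\<^sup>3 min a b\<close> is split by AM-GM: in two dimensions neither of its two factors
  leads to an \<open>\<ell>\<^sup>1\<close> sequence.
\<close>

lemma weight2:
  assumes "0 \<le> a" "0 \<le> b" "\<bar>a - b\<bar> \<le> m" "0 < N"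
  shows "\<bar>wt 4 N a - wt 4 N b\<bar> * (2 * m * min a b) \<le> 52 * (m^2 * a^2 * b^2 + m^4 * (a^2 + b^2))"
  using assms
proof (induction a b rule: linorder_wlog)
  case (le b a)
  then have m: "a - b \<le> m" "0 \<le> m" by auto
  have "\<bar>wt 4 N b - wt 4 N a\<bar> * (2 * m * min b a) \<le> (9 * (a - b) * a^3) * (2 * m * b)"
    using wt_lipschitz[of b a N 3] le m by (intro mult_mono) (auto simp: abs_minus_commute)
  also have "\<dots> \<le> (9 * m * a^3) * (2 * m * b)"
    using le m by (intro mult_right_mono mult_left_mono) auto
  also have "\<dots> = (18 * m^2 * a^2) * (a * b)" by (simp add: power_numeral_reduce algebra_simps)
  also have "\<dots> \<le> (18 * m^2 * a^2) * (2 * b^2 + 2 * m^2)"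
  proof (rule mult_left_mono)
    have "a * b \<le> (b + m) * b" using le m by (intro mult_right_mono) auto
    also have "\<dots> = b^2 + m * b" by (simp add: power2_eq_square algebra_simps)
    also have "\<dots> \<le> 2 * b^2 + 2 * m^2"
      using sum_squares_bound[of b m] zero_le_power2[of m] zero_le_power2[of b] mult.commute[of m b] by linarith
    finally show "a * b \<le> 2 * b^2 + 2 * m^2" .
  qed (use le m in auto)
  also have "\<dots> = 36 * (m^2 * b^2 * a^2 + m^4 * a^2)" by (simp add: power_numeral_reduce algebra_simps)
  \<comment> \<open>36 = 9 * 2 * 2 is relaxed to 52 so that both weights satisfy one common
    inequality.\<close>
  also have "\<dots> \<le> 52 * (m^2 * b^2 * a^2 + m^4 * (b^2 + a^2))"
    using le m by (intro mult_mono add_left_mono mult_left_mono) auto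
  finally show ?case .
next
  case (sym b a)
  then show ?case by (simp add: abs_minus_commute min.commute mult_ac add.commute)
qed

section \<open>From weight inequalities to truncated energy bounds\<close>

lemma abs_wnorm_diff_le: "\<bar>wnorm k - wnorm l\<bar> \<le> wnorm (k - l)"
  using wnorm_triangle[of "k - l" l] wnorm_triangle[of "l - k" k] wnorm_minus[of "k - l"]
  by (simp add: abs_le_iff)

lemma abs_wedge_le_min: "\<bar>wedge k l\<bar> \<le> 2 * wnorm (k - l) * min (wnorm k) (wnorm l)"
  using abs_wedge_diff_le[of k l] by (simp add: min_def)

text \<open>Three ways to choose the factor placed in l1 at the price of two derivatives: the stream
  function, \<open>x\<close>, or \<open>y\<close>. The 16 is that of
  \<open>ell1_wnorm\<close>.\<close>

lemma sum_le_trilinear_terms: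
  assumes p: "stream p P" and x: "ell2 (\<lambda>k. wnorm k ^ (n + 2) * cmod (x k)) X" "n = 0 \<Longrightarrow> x 0 = 0"
    and y: "ell2 (\<lambda>k. wnorm k ^ (m + 2) * cmod (y k)) Y" "m = 0 \<Longrightarrow> y 0 = 0" and F: "finite F"
  shows "(\<Sum>(k, l)\<in>F. (wnorm (k - l) ^ 2 * cmod (p (k - l))) * (wnorm l ^ (n + 2) * cmod (x l)) * (wnorm k ^ (m + 2) * cmod (y k))) \<le> 16 * P * X * Y" (is "?A")
    and "(\<Sum>(k, l)\<in>F. (wnorm (k - l) ^ 4 * cmod (p (k - l))) * (wnorm l ^ n * cmod (x l)) * (wnorm k ^ (m + 2) * cmod (y k))) \<le> 16 * P * X * Y" (is "?B")
    and "(\<Sum>(k, l)\<in>F. (wnorm (k - l) ^ 4 * cmod (p (k - l))) * (wnorm l ^ (n + 2) * cmod (x l)) * (wnorm k ^ m * cmod (y k))) \<le> 16 * P * X * Y" (is "?C")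
proof -
  have p4: "ell2 (\<lambda>k. wnorm k ^ 4 * cmod (p k)) P" using p by (simp add: stream_def)
  have x1: "ell1 (\<lambda>k. wnorm k ^ n * cmod (x k)) (16 * X)" by (rule ell1_wnorm) (use x in auto)
  have y1: "ell1 (\<lambda>k. wnorm k ^ m * cmod (y k)) (16 * Y)" by (rule ell1_wnorm) (use y in auto)
  have n: "\<bar>wnorm k ^ i * cmod z\<bar> = wnorm k ^ i * cmod z" for k i z by (simp add: abs_mult)
  show ?A
    using trilinear1[OF stream_ell1(1)[OF p] x(1) y(1) F] unfolding n .
  show ?B
    using trilinear2[OF p4 x1 y(1) F] unfolding n by (simp add: mult_ac)
  show ?C
    using trilinear3[OF p4 x(1) y1 F] unfolding n by (simp add: mult_ac)
qed

lemma sum_pairs_linear: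
  fixes c :: real
  shows "(\<Sum>(k, l)\<in>F. c * (f k l + g k l)) = c * ((\<Sum>(k, l)\<in>F. f k l) + (\<Sum>(k, l)\<in>F. g k l))"
  by (simp add: case_prod_beta sum.distrib sum_distrib_left[symmetric])

text \<open>n = 1 serves \<open>b\<close> and n = 0 serves \<open>\<omega>\<close>. The kernel gives
  4 * 52 = 208, the three trilinear terms 3 * 16, in total 9984, rounded up to 10^4.\<close>

lemma sum_weight_commutator_le:
  assumes p: "stream p P" and x: "ell2 (\<lambda>k. wnorm k ^ (n + 2) * cmod (x k)) X" "n = 0 \<Longrightarrow> x 0 = 0"
    and F: "finite F"
    and w: "\<And>k l. \<bar>w k - w l\<bar> * (2 * wnorm (k - l) * min (wnorm k) (wnorm l)) \<le>
      52 * (wnorm (k - l) ^ 2 * wnorm k ^ (n + 2) * wnorm l ^ (n + 2)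
        + wnorm (k - l) ^ 4 * (wnorm k ^ (n + 2) * wnorm l ^ n + wnorm k ^ n * wnorm l ^ (n + 2)))"
  shows "(\<Sum>(k, l)\<in>F. \<bar>w k - w l\<bar> * (majorant p x k l * cmod (x k)))
    \<le> 10^4 * pi^2 * P * X^2"
proof -
  let ?t1 = "\<lambda>k l. (wnorm (k - l) ^ 2 * cmod (p (k - l))) * (wnorm l ^ (n + 2) * cmod (x l)) * (wnorm k ^ (n + 2) * cmod (x k))"
  let ?t2 = "\<lambda>k l. (wnorm (k - l) ^ 4 * cmod (p (k - l))) * (wnorm l ^ n * cmod (x l)) * (wnorm k ^ (n + 2) * cmod (x k))"
  let ?t3 = "\<lambda>k l. (wnorm (k - l) ^ 4 * cmod (p (k - l))) * (wnorm l ^ (n + 2) * cmod (x l)) * (wnorm k ^ n * cmod (x k))"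
  have "\<bar>w k - w l\<bar> * (majorant p x k l * cmod (x k))
    \<le> 208 * pi^2 * (?t1 k l + ?t2 k l + ?t3 k l)" for k l
  proof -
    let ?c = "4 * pi^2 * (cmod (p (k - l)) * cmod (x l) * cmod (x k))"
    have "\<bar>w k - w l\<bar> * (majorant p x k l * cmod (x k))
      = (\<bar>w k - w l\<bar> * \<bar>wedge k l\<bar>) * ?c" by (simp only: mult_ac)
    also have "\<dots> \<le> (\<bar>w k - w l\<bar> * (2 * wnorm (k - l) * min (wnorm k) (wnorm l))) * ?c"
      by (intro mult_right_mono mult_left_mono abs_wedge_le_min) auto
    also have "\<dots> \<le> (52 * (wnorm (k - l) ^ 2 * wnorm k ^ (n + 2) * wnorm l ^ (n + 2)
        + wnorm (k - l) ^ 4 * (wnorm k ^ (n + 2) * wnorm l ^ n + wnorm k ^ n * wnorm l ^ (n + 2)))) * ?c"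
      by (intro mult_right_mono w) auto
    also have "\<dots> = 208 * pi^2 * (?t1 k l + ?t2 k l + ?t3 k l)"
    proof -
      have "52 * (a * K2 * L2 + b * (K2 * L0 + K0 * L2)) * (4 * q * (c * z * y))
        = 208 * q * ((a * c) * (L2 * z) * (K2 * y) + (b * c) * (L0 * z) * (K2 * y) + (b * c) * (L2 * z) * (K0 * y))"
        for a b c z y q K2 L2 K0 L0 :: real by (simp add: algebra_simps)
      then show ?thesis .
    qed
    finally show ?thesis .
  qed
  then have "(\<Sum>(k, l)\<in>F. \<bar>w k - w l\<bar> * (majorant p x k l * cmod (x k)))
    \<le> (\<Sum>(k, l)\<in>F. 208 * pi^2 * (?t1 k l + ?t2 k l + ?t3 k l))"
    by (intro sum_mono) (simp only: case_prod_beta)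
  also have "\<dots> = 208 * pi^2 * ((\<Sum>(k, l)\<in>F. ?t1 k l) + (\<Sum>(k, l)\<in>F. ?t2 k l) + (\<Sum>(k, l)\<in>F. ?t3 k l))"
    unfolding sum_pairs_linear using sum_pairs_linear[of 1 ?t1 ?t2 F] by (simp only: mult_1)
  also have "\<dots> \<le> 208 * pi^2 * (16 * P * X * X + 16 * P * X * X + 16 * P * X * X)"
    by (intro mult_left_mono add_mono sum_le_trilinear_terms[OF p x x F]) auto
  also have "\<dots> = 9984 * (pi^2 * P * X^2)" by (simp add: power2_eq_square)
  also have "\<dots> \<le> 10^4 * (pi^2 * P * X^2)"
    using p by (intro mult_right_mono mult_nonneg_nonneg) (auto simp: stream_def ell2_nonneg)
  finally show ?thesis by (simp add: mult.assoc)
qed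

lemma wt_box:
  assumes "0 < N" "k \<notin> grid N"
  shows "wt n N (wnorm k) = 0"
proof (rule wt_eq_0[OF assms(1)])
  have "int N \<le> max \<bar>fst k\<bar> \<bar>snd k\<bar>" using assms(2) by (cases k) (auto simp: grid_def)
  then have "real_of_int (int N) \<le> wnorm k" unfolding wnorm_def of_int_le_iff .
  then show "real N \<le> wnorm k" by simp
qed

text \<open>A crude bound depending on N, used only to make the series in
  \<open>jac_antisymmetric\<close> converge.\<close>

lemma wt_abs_le:
  assumes "0 < N"
  shows "\<bar>wt n N (wnorm k)\<bar> \<le> real N ^ n"
proof (cases "wnorm k \<le> real N")
  case True
  then have "wnorm k ^ n \<le> real N ^ n" by (intro power_mono) auto
  then show ?thesis using wt_bounds[of "wnorm k" n N] by simp
next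
  case False
  then show ?thesis using wt_eq_0[OF assms, of "wnorm k" n] by simp
qed

text \<open>Minus the rate of change of the weighted sum of |y k|^2 when \<open>y\<close> has time
  derivative \<open>- jac p x\<close>.\<close>

abbreviation box_pairing :: "nat \<Rightarrow> nat \<Rightarrow> (freq \<Rightarrow> complex) \<Rightarrow> (freq \<Rightarrow> complex) \<Rightarrow> (freq \<Rightarrow> complex) \<Rightarrow> real" where
  "box_pairing n N y p x \<equiv> (\<Sum>k\<in>grid N. wt n N (wnorm k) * (2 * Re (cnj (y k) * jac p x k)))"

text \<open>Pairing \<open>x\<close> with its own transport, so antisymmetry applies; the weight
  vanishes off the square, which turns the infinite series into this finite sum. Nothing on the
  right depends on N.\<close>

lemma sum_box_transport_le:
  assumes p: "stream p P" and x0: "ell2 (\<lambda>k. cmod (x k)) X\<^sub>0"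
    and x: "ell2 (\<lambda>k. wnorm k ^ (n + 2) * cmod (x k)) X" "n = 0 \<Longrightarrow> x 0 = 0"
    and N: "0 < N" and n: "n = 0 \<or> n = 1"
  shows "\<bar>box_pairing (2 * n + 4) N x p x\<bar> \<le> 10^4 * pi^2 * P * X^2"
proof -
  let ?w = "\<lambda>k. wt (2 * n + 4) N (wnorm k)"
  have x1: "ell2 (\<lambda>k. wnorm k * cmod (x k)) X"
    by (rule ell2_mono[OF x(1)]) (auto simp: abs_mult intro!: mult_right_mono wnorm_le_power[of "Suc (Suc n)", simplified])
  have w: "\<bar>?w k - ?w l\<bar> * (2 * wnorm (k - l) * min (wnorm k) (wnorm l)) \<le>
      52 * (wnorm (k - l) ^ 2 * wnorm k ^ (n + 2) * wnorm l ^ (n + 2)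
        + wnorm (k - l) ^ 4 * (wnorm k ^ (n + 2) * wnorm l ^ n + wnorm k ^ n * wnorm l ^ (n + 2)))" for k l
    using n weight2[OF wnorm_nonneg[of k] wnorm_nonneg[of l] abs_wnorm_diff_le N]
      weight3[OF wnorm_nonneg[of k] wnorm_nonneg[of l] abs_wnorm_diff_le N]
    by (auto simp: numeral_eq_Suc)
  obtain s where s: "((\<lambda>k. of_real (?w k) * cnj (x k) * jac p x k) has_sum s) UNIV"
    "\<bar>2 * Re s\<bar> \<le> 10^4 * pi^2 * P * X^2"
    by (rule jac_antisymmetric[OF p x0 x1 wt_abs_le[OF N] sum_weight_commutator_le[OF p x _ w]])
  have "((\<lambda>k. of_real (?w k) * cnj (x k) * jac p x k) has_sum
      (\<Sum>k\<in>grid N. of_real (?w k) * cnj (x k) * jac p x k)) UNIV"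
    by (rule has_sum_finite_neutralI) (auto simp: wt_box[OF N])
  then have "s = (\<Sum>k\<in>grid N. of_real (?w k) * cnj (x k) * jac p x k)"
    by (rule has_sum_unique[OF s(1)])
  then have "2 * Re s = (\<Sum>k\<in>grid N. ?w k * (2 * Re (cnj (x k) * jac p x k)))"
    by (simp add: sum_distrib_left algebra_simps)
  then show ?thesis using s(2) by simp
qed

text \<open>No antisymmetry is available between different \<open>x\<close> and \<open>y\<close>,
  but \<open>x\<close> has one more derivative: two of the four powers of |k| stay on
  \<open>y\<close>, the others become 2 |k - l|^2 + 2 |l|^2.\<close>

lemma sum_box_forcing_le:
  assumes p: "stream p P" and x: "ell2 (\<lambda>k. wnorm k ^ 3 * cmod (x k)) X"
    and y: "ell2 (\<lambda>k. wnorm k ^ 2 * cmod (y k)) Y" "y 0 = 0" and N: "0 < N"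
  shows "\<bar>box_pairing 4 N y p x\<bar> \<le> 10^4 * pi^2 * P * X * Y"
proof -
  let ?w = "\<lambda>k. wt 4 N (wnorm k)"
  let ?z = "\<lambda>k. of_real (?w k) * cnj (y k)"
  let ?t1 = "\<lambda>k l. (wnorm (k - l) ^ 2 * cmod (p (k - l))) * (wnorm l ^ 3 * cmod (x l)) * (wnorm k ^ 2 * cmod (y k))"
  let ?t2 = "\<lambda>k l. (wnorm (k - l) ^ 4 * cmod (p (k - l))) * (wnorm l * cmod (x l)) * (wnorm k ^ 2 * cmod (y k))"
  have x1: "ell2 (\<lambda>k. wnorm k * cmod (x k)) X"
    by (rule ell2_mono[OF x(1)]) (auto simp: abs_mult intro!: mult_right_mono wnorm_le_power)
  have nn: "0 \<le> P" "0 \<le> X" "0 \<le> Y" using p x y by (auto simp: stream_def ell2_nonneg)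
  have b: "majorant p x k l * cmod (?z k) \<le> 16 * pi^2 * (?t1 k l + ?t2 k l)" for k l
  proof -
    let ?m = "wnorm (k - l)" and ?c = "4 * pi^2 * (cmod (p (k - l)) * cmod (x l) * cmod (y k))"
    have k: "wnorm k ^ 2 \<le> 2 * ?m ^ 2 + 2 * wnorm l ^ 2"
    proof -
      have "wnorm k ^ 2 \<le> (?m + wnorm l) ^ 2"
        using wnorm_triangle[of "k - l" l] by (intro power_mono) auto
      also have "\<dots> \<le> 2 * ?m ^ 2 + 2 * wnorm l ^ 2"
        using sum_squares_bound[of ?m "wnorm l"] by (simp add: power2_sum)
      finally show ?thesis .
    qed
    have "?w k * \<bar>wedge k l\<bar> \<le> wnorm k ^ 4 * (2 * ?m * wnorm l)"
      using wt_bounds[of "wnorm k" 4 N] by (intro mult_mono abs_wedge_diff_le) auto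
    also have "\<dots> = (2 * ?m * wnorm l * wnorm k ^ 2) * wnorm k ^ 2"
      by (simp add: power_numeral_reduce mult_ac)
    also have "\<dots> \<le> (2 * ?m * wnorm l * wnorm k ^ 2) * (2 * ?m ^ 2 + 2 * wnorm l ^ 2)"
      by (intro mult_left_mono k) auto
    also have "\<dots> = 4 * (?m ^ 3 * wnorm l * wnorm k ^ 2 + ?m * wnorm l ^ 3 * wnorm k ^ 2)"
      by (simp add: power_numeral_reduce algebra_simps)
    \<comment> \<open>Nonzero lattice frequencies have norm at least 1, so m^3 and m may be raised
      to the exponents 4 and 2 of the trilinear bounds.\<close>
    also have "\<dots> \<le> 4 * (?m ^ 4 * wnorm l * wnorm k ^ 2 + ?m ^ 2 * wnorm l ^ 3 * wnorm k ^ 2)"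
      by (intro mult_left_mono add_mono mult_right_mono wnorm_power_mono wnorm_le_power) auto
    finally have "(?w k * \<bar>wedge k l\<bar>) * ?c \<le> (4 * (?m ^ 4 * wnorm l * wnorm k ^ 2 + ?m ^ 2 * wnorm l ^ 3 * wnorm k ^ 2)) * ?c"
      by (intro mult_right_mono) auto
    also have "\<dots> = 16 * pi^2 * (?t1 k l + ?t2 k l)"
    proof -
      have "(4 * (m4 * l1 * k2 + m2 * l3 * k2)) * (4 * q * (c * z * u))
        = 16 * q * ((m2 * c) * (l3 * z) * (k2 * u) + (m4 * c) * (l1 * z) * (k2 * u))"
        for m4 l1 k2 m2 l3 q c z u :: real by (simp add: algebra_simps)
      then show ?thesis .
    qed
    finally have "(?w k * \<bar>wedge k l\<bar>) * ?c \<le> 16 * pi^2 * (?t1 k l + ?t2 k l)" .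
    moreover have "cmod (?z k) = ?w k * cmod (y k)"
      using wt_bounds(1)[of "wnorm k" 4 N] by (simp add: norm_mult)
    ultimately show ?thesis by (simp only: mult_ac)
  qed
  \<comment> \<open>512 = 16 * (16 + 16); doubling gives 1024, later relaxed to the common
    10^4.\<close>
  obtain s where s: "((\<lambda>k. ?z k * jac p x k) has_sum s) UNIV" "cmod s \<le> 512 * pi^2 * P * X * Y"
  proof (rule jac_pairing[OF p x1])
    fix F :: "(freq \<times> freq) set" assume F: "finite F"
    have "(\<Sum>(k, l)\<in>F. majorant p x k l * cmod (?z k))
      \<le> (\<Sum>(k, l)\<in>F. 16 * pi^2 * (?t1 k l + ?t2 k l))"
      using b by (intro sum_mono) (simp only: case_prod_beta)
    also have "\<dots> = 16 * pi^2 * ((\<Sum>(k, l)\<in>F. ?t1 k l) + (\<Sum>(k, l)\<in>F. ?t2 k l))"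
      by (rule sum_pairs_linear)
    also have "\<dots> \<le> 16 * pi^2 * (16 * P * X * Y + 16 * P * X * Y)"
    proof (intro mult_left_mono add_mono)
      have X': "ell2 (\<lambda>k. wnorm k ^ (1 + 2) * cmod (x k)) X" and Y': "ell2 (\<lambda>k. wnorm k ^ (0 + 2) * cmod (y k)) Y"
        using x y by (simp_all add: numeral_eq_Suc)
      show "(\<Sum>(k, l)\<in>F. ?t1 k l) \<le> 16 * P * X * Y" "(\<Sum>(k, l)\<in>F. ?t2 k l) \<le> 16 * P * X * Y"
        using sum_le_trilinear_terms(1,2)[OF p X' _ Y' y(2) F] by (simp_all add: numeral_eq_Suc)
    qed auto
    also have "\<dots> = 512 * pi^2 * P * X * Y" by simp
    finally show "(\<Sum>(k, l)\<in>F. majorant p x k l * cmod (?z k))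
      \<le> 512 * pi^2 * P * X * Y" .
  qed
  have "((\<lambda>k. ?z k * jac p x k) has_sum (\<Sum>k\<in>grid N. ?z k * jac p x k)) UNIV"
    by (rule has_sum_finite_neutralI) (auto simp: wt_box[OF N])
  then have "s = (\<Sum>k\<in>grid N. ?z k * jac p x k)" by (rule has_sum_unique[OF s(1)])
  then have "2 * Re s = (\<Sum>k\<in>grid N. ?w k * (2 * Re (cnj (y k) * jac p x k)))"
    by (simp add: sum_distrib_left algebra_simps)
  moreover have "\<bar>2 * Re s\<bar> \<le> 1024 * (pi^2 * P * X * Y)"
    using abs_Re_le_cmod[of s] s(2) by simp
  moreover have "1024 * (pi^2 * P * X * Y) \<le> 10^4 * (pi^2 * P * X * Y)"
    using nn by (intro mult_right_mono mult_nonneg_nonneg) auto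
  ultimately show ?thesis by (simp add: mult.assoc)
qed

text \<open>The constant weight 1 in \<open>jac_antisymmetric\<close> has zero differences, so the
  pairing vanishes: transport does no work in L2.\<close>

lemma inner_jac_eq_0:
  assumes p: "stream p P" and v: "ell2 (\<lambda>k. wnorm k * cmod (coef v k)) X" and g: "coef g = jac p (coef v)"
  shows "inner v g = 0"
proof -
  obtain s where s: "((\<lambda>k. of_real 1 * cnj (coef v k) * jac p (coef v) k) has_sum s) UNIV" "\<bar>2 * Re s\<bar> \<le> 0"
    by (rule jac_antisymmetric[OF p ell2_coef v, of "\<lambda>_. 1" 1 0]) auto
  have "((\<lambda>k. of_real 1 * cnj (coef v k) * jac p (coef v) k) has_sum complex_of_real (inner g v)) UNIV"
    using parseval[of g v] unfolding g by (simp add: mult.commute)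
  from has_sum_unique[OF this s(1)] have "s = complex_of_real (inner g v)" by (rule sym)
  then show ?thesis using s(2) by (simp add: inner_commute)
qed

section \<open>Sobolev norms\<close>

text \<open>Only pure derivatives enter: since \<open>wnorm k\<close> is the modulus of one
  coordinate, they already dominate |k|^n.\<close>

definition top_norm :: "nat \<Rightarrow> L2T \<Rightarrow> real" where
  "top_norm n v = sqrt ((norm (wderiv n 0 v))^2 + (norm (wderiv 0 n v))^2)"

lemma top_norm_nonneg [simp]: "0 \<le> top_norm n v" by (simp add: top_norm_def)

lemma ell2_top_norm:
  assumes "v \<in> W n"
  shows "ell2 (\<lambda>k. wnorm k ^ n * cmod (coef v k)) (top_norm n v)"
  unfolding ell2_def
proof (intro conjI allI impI)
  fix F :: "freq set" assume F: "finite F"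
  have "(wnorm k ^ n * cmod (coef v k))^2 \<le> (cmod (coef (wderiv n 0 v) k))^2 + (cmod (coef (wderiv 0 n v) k))^2" for k
  proof -
    have one: "(t ^ n * c)^2 \<le> ((2 * pi * t) ^ n * c)^2" if "0 \<le> t" "0 \<le> c" for t c :: real
    proof -
      have "t \<le> 2 * pi * t" using mult_right_mono[of 1 "2 * pi" t] pi_ge_two that by simp
      then show ?thesis using that by (intro power_mono mult_right_mono) auto
    qed
    have d: "cmod (dmult n 0 k) = (2 * pi * \<bar>of_int (fst k)\<bar>) ^ n" "cmod (dmult 0 n k) = (2 * pi * \<bar>of_int (snd k)\<bar>) ^ n"
      by (simp_all add: dmult_def norm_power norm_mult)
    have "wnorm k = \<bar>of_int (fst k)\<bar> \<or> wnorm k = \<bar>of_int (snd k)\<bar>" by (auto simp: wnorm_def max_def)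
    then show ?thesis
      unfolding coef_wderiv[OF assms, of n 0, simplified] coef_wderiv[OF assms, of 0 n, simplified] norm_mult d
      using one[of "wnorm k" "cmod (coef v k)"] by (auto simp: add_increasing add_increasing2)
  qed
  then have "(\<Sum>k\<in>F. (wnorm k ^ n * cmod (coef v k))^2)
    \<le> (\<Sum>k\<in>F. (cmod (coef (wderiv n 0 v) k))^2 + (cmod (coef (wderiv 0 n v) k))^2)"
    by (rule sum_mono)
  also have "\<dots> \<le> (norm (wderiv n 0 v))^2 + (norm (wderiv 0 n v))^2"
    unfolding sum.distrib using ell2_coef[of "wderiv n 0 v"] ell2_coef[of "wderiv 0 n v"] F
    by (intro add_mono) (auto simp: ell2_def)
  finally show "(\<Sum>k\<in>F. (wnorm k ^ n * cmod (coef v k))^2) \<le> (top_norm n v)^2"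
    by (simp add: top_norm_def)
qed simp

text \<open>Off the origin |k| >= 1 and lower powers are dominated by |k|^n; at the origin this
  weight gives nothing, and the zero average takes over.\<close>

lemma norm_wderiv_le_ell2:
  assumes v: "v \<in> W n" and ij: "i + j \<le> n" and B: "ell2 (\<lambda>k. wnorm k ^ n * cmod (coef v k)) B"
    and 0: "i + j = n \<or> coef v 0 = 0"
  shows "norm (wderiv i j v) \<le> (2 * pi) ^ n * B"
proof (rule norm_le_ell2, rule ell2_mono[OF ell2_scale[OF B]])
  have one: "1 \<le> 2 * pi" using pi_ge_two by linarith
  fix k
  have "cmod (dmult i j k) * cmod (coef v k) \<le> (2 * pi) ^ n * (wnorm k ^ n * cmod (coef v k))"
  proof (cases "k = 0 \<and> i + j \<noteq> n")
    case True
    then show ?thesis using 0 by simp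
  next
    case False
    have w: "wnorm k ^ (i + j) \<le> wnorm k ^ n"
    proof (cases "i + j = n")
      case neq: False
      then have "1 \<le> wnorm k" using False by (intro wnorm_ge_1) auto
      then show ?thesis using ij by (intro power_increasing) auto
    qed simp
    have "cmod (dmult i j k) \<le> (2 * pi * wnorm k) ^ (i + j)" by (rule cmod_dmult_le)
    also have "\<dots> = (2 * pi) ^ (i + j) * wnorm k ^ (i + j)" by (rule power_mult_distrib)
    also have "\<dots> \<le> (2 * pi) ^ n * wnorm k ^ n"
      using one by (intro mult_mono power_increasing[OF ij one] w) auto
    finally show ?thesis by (simp add: mult_right_mono flip: mult.assoc)
  qed
  then show "\<bar>cmod (coef (wderiv i j v) k)\<bar> \<le> \<bar>(2 * pi) ^ n * (wnorm k ^ n * cmod (coef v k))\<bar>"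
    unfolding coef_wderiv[OF v ij] norm_mult by simp
qed simp

lemma top_norm_le_ell2:
  assumes "v \<in> W n" "ell2 (\<lambda>k. wnorm k ^ n * cmod (coef v k)) B"
  shows "(top_norm n v)^2 \<le> 2 * (2 * pi) ^ (2 * n) * B^2"
proof -
  have "(norm (wderiv n 0 v))^2 \<le> ((2 * pi) ^ n * B)^2" "(norm (wderiv 0 n v))^2 \<le> ((2 * pi) ^ n * B)^2"
    using norm_wderiv_le_ell2[OF assms(1) _ assms(2), of n 0] norm_wderiv_le_ell2[OF assms(1) _ assms(2), of 0 n]
    by (auto intro!: power_mono)
  then show ?thesis
    by (simp add: top_norm_def power_mult_distrib power_mult[symmetric] mult.commute[of n])
qed

lemma finite_multi_index: "finite {(i, j). i + j \<le> (n::nat)}"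
  by (rule finite_subset[of _ "{..n} \<times> {..n}"]) auto

lemma norm_wderiv_le_sob_norm:
  assumes "i + j \<le> n"
  shows "norm (wderiv i j v) \<le> sob_norm n v"
  unfolding sob_norm_def
proof (rule real_le_rsqrt)
  show "(norm (wderiv i j v))^2 \<le> (\<Sum>(i, j)\<in>{(i, j). i + j \<le> n}. (norm (wderiv i j v))^2)"
    using member_le_sum[of "(i, j)" "{(i, j). i + j \<le> n}" "\<lambda>(i, j). (norm (wderiv i j v))^2"]
      finite_multi_index assms by (simp add: case_prod_beta)
qed

text \<open>Poincare's inequality for zero average, summed over the finitely many
  multi-indices.\<close>

lemma sob_norm_le_top_norm:
  assumes v: "v \<in> W n" and 0: "coef v 0 = 0"
  shows "sob_norm n v \<le> sqrt (card {(i, j). i + j \<le> n}) * ((2 * pi) ^ n * top_norm n v)"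
proof -
  let ?I = "{(i, j). i + j \<le> n}" and ?c = "(2 * pi) ^ n * top_norm n v"
  have "(\<Sum>(i, j)\<in>?I. (norm (wderiv i j v))^2) \<le> (\<Sum>(i, j)\<in>?I. ?c^2)"
    using norm_wderiv_le_ell2[OF v _ ell2_top_norm[OF v]] 0
    by (intro sum_mono) (auto intro!: power_mono)
  also have "\<dots> = card ?I * ?c^2" by (simp add: case_prod_beta)
  finally have "sob_norm n v \<le> sqrt (card ?I * ?c^2)"
    unfolding sob_norm_def by (intro real_sqrt_le_mono) simp
  also have "\<dots> = sqrt (card ?I) * ?c" by (simp add: real_sqrt_mult)
  finally show ?thesis .
qed

section \<open>Gronwall's inequality\<close>

lemma deriv_nonpos_imp_le_initial:
  fixes g g' :: "real \<Rightarrow> real"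
  assumes g: "\<And>x. x \<in> {0..T} \<Longrightarrow> (g has_real_derivative g' x) (at x within {0..T})"
    and le: "\<And>x. x \<in> {0..T} \<Longrightarrow> g' x \<le> 0" and t: "t \<in> {0..T}"
  shows "g t \<le> g 0"
proof (rule DERIV_nonpos_imp_decreasing_open[where f = g and a = 0 and b = t])
  show "0 \<le> t" using t by simp
  show "\<exists>y. DERIV g x :> y \<and> y \<le> 0" if "0 < x" "x < t" for x
  proof (intro exI conjI)
    have "at x within {0..T} = at x" using that t by (intro at_within_Icc_at) auto
    then show "DERIV g x :> g' x" using g[of x] that t by auto
    show "g' x \<le> 0" using le that t by auto
  qed
  have "continuous_on {0..T} g"
    unfolding continuous_on_eq_continuous_within using g DERIV_continuous by blast
  then show "continuous_on {0..t} g" by (rule continuous_on_subset) (use t in auto)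
qed

text \<open>With the integrating factor exp(- G), where G is the integral of \<open>g\<close>, the
  claim becomes monotonicity of y exp(- G).\<close>

lemma gronwall:
  fixes y y' g :: "real \<Rightarrow> real"
  assumes g: "continuous_on {0..T} g"
    and y: "\<And>x. x \<in> {0..T} \<Longrightarrow> (y has_real_derivative y' x) (at x within {0..T})"
    and le: "\<And>x. x \<in> {0..T} \<Longrightarrow> y' x \<le> g x * y x" and t: "t \<in> {0..T}"
  shows "y t \<le> y 0 * exp (integral {0..t} g)"
proof -
  let ?G = "\<lambda>x. integral {0..x} g"
  have G: "(?G has_real_derivative g x) (at x within {0..T})" if "x \<in> {0..T}" for x
    by (rule integral_has_real_derivative[OF g that])
  have "y t * exp (- ?G t) \<le> y 0 * exp (- ?G 0)"
  proof (rule deriv_nonpos_imp_le_initial[OF _ _ t])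
    fix x assume x: "x \<in> {0..T}"
    show "((\<lambda>x. y x * exp (- ?G x)) has_real_derivative (y' x - g x * y x) * exp (- ?G x)) (at x within {0..T})"
      by (rule derivative_eq_intros y[OF x] G[OF x] refl)+ (simp add: algebra_simps)
    show "(y' x - g x * y x) * exp (- ?G x) \<le> 0"
      using le[OF x] by (intro mult_nonpos_nonneg) auto
  qed
  then have "y t * exp (- ?G t) * exp (?G t) \<le> y 0 * exp (?G t)" by simp
  then show ?thesis by (simp add: mult.assoc flip: exp_add)
qed

section \<open>Strong solutions\<close>

lemma jac_diff:
  assumes p: "stream p P" and x: "ell2 (\<lambda>k. wnorm k * cmod (x k)) X"
  shows "stream p' P' \<Longrightarrow> jac (\<lambda>k. p k - p' k) x k = jac p x k - jac p' x k"
    and "ell2 (\<lambda>k. wnorm k * cmod (x' k)) X' \<Longrightarrow> jac p (\<lambda>k. x k - x' k) k = jac p x k - jac p x' k"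
proof -
  have neg: "((\<lambda>l. - g l) has_sum - a) UNIV" if "(g has_sum a) UNIV" for g and a :: complex
    using that by (simp only: has_sum_uminus minus_minus)
  note px = jac_has_sum[OF p x, of k]
  show "jac (\<lambda>k. p k - p' k) x k = jac p x k - jac p' x k" if p': "stream p' P'"
    unfolding jac_def[of "\<lambda>k. p k - p' k"] using infsumI[OF has_sum_add[OF px neg[OF jac_has_sum[OF p' x, of k]]]]
    by (simp only: left_diff_distrib right_diff_distrib diff_conv_add_uminus[symmetric])
  show "jac p (\<lambda>k. x k - x' k) k = jac p x k - jac p x' k" if x': "ell2 (\<lambda>k. wnorm k * cmod (x' k)) X'"
    unfolding jac_def[of p "\<lambda>k. x k - x' k"] using infsumI[OF has_sum_add[OF px neg[OF jac_has_sum[OF p x', of k]]]]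
    by (simp only: left_diff_distrib right_diff_distrib diff_conv_add_uminus[symmetric])
qed

definition advect :: "L2T \<Rightarrow> L2T \<Rightarrow> L2T" where
  "advect \<psi> v = flux_div v (perp_grad \<psi>)"

lemma ell2_top_norm_1: "v \<in> W 1 \<Longrightarrow> ell2 (\<lambda>k. wnorm k * cmod (coef v k)) (top_norm 1 v)"
  using ell2_top_norm[of v 1] by simp

lemma coef_advect:
  assumes "\<psi> \<in> W 1" "stream (coef \<psi>) P" "v \<in> W 1"
  shows "coef (advect \<psi> v) = jac (coef \<psi>) (coef v)"
  unfolding advect_def by (rule coef_flux_div[OF assms(1,2) ell2_top_norm_1[OF assms(3)]])

lemma norm_advect_le:
  assumes "\<psi> \<in> W 1" "stream (coef \<psi>) P" "v \<in> W 1"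
  shows "norm (advect \<psi> v) \<le> 128 * pi^2 * P * top_norm 1 v"
  by (rule norm_le_ell2, unfold coef_advect[OF assms]) (rule ell2_jac[OF assms(2) ell2_top_norm_1[OF assms(3)]])

lemma advect_diff_right:
  assumes \<psi>: "\<psi> \<in> W 1" "stream (coef \<psi>) P" and v: "v \<in> W 1" "w \<in> W 1"
  shows "advect \<psi> (v - w) = advect \<psi> v - advect \<psi> w"
proof (rule coef_inject)
  have "coef (v - w) = (\<lambda>k. coef v k - coef w k)" by (simp add: fun_eq_iff coef_diff)
  then show "coef (advect \<psi> (v - w)) k = coef (advect \<psi> v - advect \<psi> w) k" for k
    unfolding coef_diff coef_advect[OF \<psi> W_diff[OF v]] coef_advect[OF \<psi> v(1)] coef_advect[OF \<psi> v(2)]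
    by (simp only: jac_diff(2)[OF \<psi>(2) ell2_top_norm_1[OF v(1)] ell2_top_norm_1[OF v(2)]])
qed

lemma advect_diff_left:
  assumes \<psi>: "\<psi> \<in> W 1" "stream (coef \<psi>) P" and \<xi>: "\<xi> \<in> W 1" "stream (coef \<xi>) P'"
    and d: "stream (coef (\<psi> - \<xi>)) P''" and v: "v \<in> W 1"
  shows "advect (\<psi> - \<xi>) v = advect \<psi> v - advect \<xi> v"
proof (rule coef_inject)
  have "coef (\<psi> - \<xi>) = (\<lambda>k. coef \<psi> k - coef \<xi> k)" by (simp add: fun_eq_iff coef_diff)
  then show "coef (advect (\<psi> - \<xi>) v) k = coef (advect \<psi> v - advect \<xi> v) k" for k
    unfolding coef_diff coef_advect[OF W_diff[OF \<psi>(1) \<xi>(1)] d v] coef_advect[OF \<psi> v] coef_advect[OF \<xi> v]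
    by (simp only: jac_diff(1)[OF \<psi>(2) ell2_top_norm_1[OF v] \<xi>(2)])
qed

lemma top_norm_diff:
  assumes "v \<in> W n" "w \<in> W n"
  shows "top_norm n (v - w) = sqrt ((norm (wderiv n 0 v - wderiv n 0 w))^2 + (norm (wderiv 0 n v - wderiv 0 n w))^2)"
  unfolding top_norm_def using wderiv_diff[OF assms, of n 0] wderiv_diff[OF assms, of 0 n] by simp

lemma zero_avg_coef: "zero_avg v \<longleftrightarrow> coef v 0 = 0"
proof -
  have "coef v 0 = complex_of_real (LINT p|T2. fun_of v p)"
    unfolding coef_def fourier_def
    by (simp add: cis_zero sq_integrable_integrable sq_integrable_fun_of)
  then show ?thesis by (simp add: zero_avg_def)
qed

lemma continuous_sobD:
  assumes c: "continuous_sob n T v" and ij: "i + j \<le> n"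
  shows "continuous_on {0..T} (\<lambda>t. wderiv i j (v t))"
  unfolding continuous_on_def
proof
  fix t assume t: "t \<in> {0..T}"
  have lim: "((\<lambda>s. sob_norm n (v s - v t)) \<longlongrightarrow> 0) (at t within {0..T})"
    using c t by (auto simp: continuous_sob_def)
  have "((\<lambda>s. wderiv i j (v s) - wderiv i j (v t)) \<longlongrightarrow> 0) (at t within {0..T})"
  proof (rule Lim_null_comparison[OF _ lim])
    show "\<forall>\<^sub>F s in at t within {0..T}. norm (wderiv i j (v s) - wderiv i j (v t)) \<le> sob_norm n (v s - v t)"
      unfolding eventually_at_filter
    proof (intro always_eventually allI impI)
      fix s assume "s \<in> {0..T}"
      then show "norm (wderiv i j (v s) - wderiv i j (v t)) \<le> sob_norm n (v s - v t)"
        using wderiv_diff[of "v s" n "v t" i j] norm_wderiv_le_sob_norm[OF ij, of "v s - v t"] c t ij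
        by (simp add: continuous_sob_def)
    qed
  qed
  then show "((\<lambda>s. wderiv i j (v s)) \<longlongrightarrow> wderiv i j (v t)) (at t within {0..T})"
    by (simp add: LIM_zero_iff)
qed

lemma wderiv_0_0: "wderiv 0 0 v = v"
  by (rule wderiv_eqI) (simp add: dmult_simps)

text \<open>\<open>P s t\<close> measures the distance of two stream functions in the norm of
  \<open>stream\<close>; splitting the difference of fluxes bilinearly then proves continuity in L2,
  which makes the time integrals of a solution differentiable.\<close>

lemma continuous_advect:
  assumes \<psi>: "\<And>t. t \<in> S \<Longrightarrow> \<psi> t \<in> W 1" "\<And>s t. s \<in> S \<Longrightarrow> t \<in> S \<Longrightarrow> stream (coef (\<psi> s - \<psi> t)) (P s t)"
    "\<And>t. t \<in> S \<Longrightarrow> ((\<lambda>s. P s t) \<longlongrightarrow> 0) (at t within S)"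
    and Q: "\<And>t. t \<in> S \<Longrightarrow> stream (coef (\<psi> t)) (Q t)"
    and v: "\<And>t. t \<in> S \<Longrightarrow> v t \<in> W 1"
    "continuous_on S (\<lambda>t. wderiv 1 0 (v t))" "continuous_on S (\<lambda>t. wderiv 0 1 (v t))"
  shows "continuous_on S (\<lambda>t. advect (\<psi> t) (v t))"
  unfolding continuous_on_def
proof
  fix t assume t: "t \<in> S"
  let ?C = "128 * pi^2"
  let ?n1 = "\<lambda>s. sqrt ((norm (wderiv 1 0 (v s) - wderiv 1 0 (v t)))^2 + (norm (wderiv 0 1 (v s) - wderiv 0 1 (v t)))^2)"
  let ?n2 = "\<lambda>s. sqrt ((norm (wderiv 1 0 (v s)))^2 + (norm (wderiv 0 1 (v s)))^2)"
  have l: "((\<lambda>s. wderiv 1 0 (v s)) \<longlongrightarrow> wderiv 1 0 (v t)) (at t within S)"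
    "((\<lambda>s. wderiv 0 1 (v s)) \<longlongrightarrow> wderiv 0 1 (v t)) (at t within S)"
    using v t by (auto simp: continuous_on_def)
  have "((\<lambda>s. ?C * P s t * ?n2 s + ?C * Q t * ?n1 s) \<longlongrightarrow> ?C * 0 * ?n2 t + ?C * Q t * ?n1 t) (at t within S)"
    by (intro tendsto_intros l \<psi>(3) t)
  then have lim: "((\<lambda>s. ?C * P s t * ?n2 s + ?C * Q t * ?n1 s) \<longlongrightarrow> 0) (at t within S)" by simp
  have "((\<lambda>s. advect (\<psi> s) (v s) - advect (\<psi> t) (v t)) \<longlongrightarrow> 0) (at t within S)"
  proof (rule Lim_null_comparison[OF _ lim])
    show "\<forall>\<^sub>F s in at t within S. norm (advect (\<psi> s) (v s) - advect (\<psi> t) (v t)) \<le> ?C * P s t * ?n2 s + ?C * Q t * ?n1 s"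
      unfolding eventually_at_filter
    proof (intro always_eventually allI impI)
      fix s assume s: "s \<in> S"
      note ps = \<psi>(1)[OF s] Q[OF s] and pt = \<psi>(1)[OF t] Q[OF t]
      have "advect (\<psi> s) (v s) - advect (\<psi> t) (v t) = advect (\<psi> s - \<psi> t) (v s) + advect (\<psi> t) (v s - v t)"
        unfolding advect_diff_left[OF ps pt \<psi>(2)[OF s t] v(1)[OF s]] advect_diff_right[OF pt v(1)[OF s] v(1)[OF t]]
        by simp
      also have "norm \<dots> \<le> norm (advect (\<psi> s - \<psi> t) (v s)) + norm (advect (\<psi> t) (v s - v t))"
        by (rule norm_triangle_ineq)
      also have "\<dots> \<le> ?C * P s t * top_norm 1 (v s) + ?C * Q t * top_norm 1 (v s - v t)"
        by (intro add_mono norm_advect_le W_diff \<psi> pt v s t)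
      also have "\<dots> = ?C * P s t * ?n2 s + ?C * Q t * ?n1 s"
        unfolding top_norm_diff[OF v(1)[OF s] v(1)[OF t]] by (simp add: top_norm_def)
      finally show "norm (advect (\<psi> s) (v s) - advect (\<psi> t) (v t)) \<le> ?C * P s t * ?n2 s + ?C * Q t * ?n1 s" .
    qed
  qed
  then show "((\<lambda>s. advect (\<psi> s) (v s)) \<longlongrightarrow> advect (\<psi> t) (v t)) (at t within S)"
    by (simp add: LIM_zero_iff)
qed

text \<open>Fixes one time horizon T. The prescribed velocity enters through a stream function
  \<open>\<eta>\<close>, so that every flux in the system is an \<open>advect\<close>.\<close>

locale tqg_solution =
  fixes \<alpha> T H :: real and f \<eta> b\<^sub>0 \<omega>\<^sub>0 :: L2T and b \<omega> :: "real \<Rightarrow> L2T"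
  assumes \<alpha>: "\<alpha> > 0" and \<eta>: "\<eta> \<in> W 1" "stream (coef \<eta>) H"
    and sol: "local_strong_solution \<alpha> (perp_grad \<eta>) f (b\<^sub>0, \<omega>\<^sub>0) b \<omega> T"
begin

abbreviation \<psi> :: "real \<Rightarrow> L2T" where "\<psi> t \<equiv> psi \<alpha> (\<omega> t - f)"

text \<open>Minus the time derivative of \<open>\<omega>\<close>, with the flux of
  \<open>\<omega> - b\<close> split so that the self-transport of \<open>\<omega>\<close> can
  cancel.\<close>

definition \<omega>' :: "real \<Rightarrow> L2T" where
  "\<omega>' t = advect (\<psi> t) (\<omega> t) - advect (\<psi> t) (b t) + advect \<eta> (b t)"

lemma T: "T > 0" using sol by (simp add: local_strong_solution_def)

lemma H0: "0 \<le> H" using \<eta>(2) by (auto simp: stream_def ell2_nonneg)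

lemma cb: "continuous_sob 3 T b" and cw: "continuous_sob 2 T \<omega>"
  using sol by (simp_all add: local_strong_solution_def)

lemma bW: "t \<in> {0..T} \<Longrightarrow> b t \<in> W 3" and wW: "t \<in> {0..T} \<Longrightarrow> \<omega> t \<in> W 2"
  using cb cw by (auto simp: continuous_sob_def)

lemma b1: "t \<in> {0..T} \<Longrightarrow> b t \<in> W 1" and w1: "t \<in> {0..T} \<Longrightarrow> \<omega> t \<in> W 1"
  using W_mono[OF _ bW] W_mono[OF _ wW] by auto

lemma zero_mode: "t \<in> {0..T} \<Longrightarrow> coef (b t) 0 = 0" "t \<in> {0..T} \<Longrightarrow> coef (\<omega> t) 0 = 0"
  using sol by (auto simp: local_strong_solution_def zero_avg_coef)

lemma psi_props: "\<psi> t \<in> W 1" "stream (coef (\<psi> t)) (norm (\<omega> t - f) / \<alpha>)"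
  by (rule psi_W[OF \<alpha>], rule stream_psi[OF \<alpha>])

lemma continuous_w: "continuous_on {0..T} \<omega>"
  using continuous_sobD[OF cw, of 0 0] by (simp add: wderiv_0_0)

lemma continuous_flux:
  assumes "continuous_sob n T v" "1 \<le> n"
  shows "continuous_on {0..T} (\<lambda>t. advect (\<psi> t) (v t))" "continuous_on {0..T} (\<lambda>t. advect \<eta> (v t))"
proof -
  have v: "\<And>t. t \<in> {0..T} \<Longrightarrow> v t \<in> W 1"
    "continuous_on {0..T} (\<lambda>t. wderiv 1 0 (v t))" "continuous_on {0..T} (\<lambda>t. wderiv 0 1 (v t))"
    using assms W_mono[OF assms(2)] by (auto simp: continuous_sob_def intro!: continuous_sobD[OF assms(1)])
  show "continuous_on {0..T} (\<lambda>t. advect (\<psi> t) (v t))"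
  proof (rule continuous_advect[OF psi_props(1) _ _ psi_props(2) v])
    fix s t
    show "stream (coef (\<psi> s - \<psi> t)) (norm (\<omega> s - \<omega> t) / \<alpha>)"
      using stream_psi[OF \<alpha>, of "\<omega> s - \<omega> t"] psi_diff[OF \<alpha>, of "\<omega> s - f" "\<omega> t - f"] by simp
    assume "t \<in> {0..T}"
    then have "((\<lambda>s. \<omega> s) \<longlongrightarrow> \<omega> t) (at t within {0..T})"
      using continuous_w by (auto simp: continuous_on_def)
    then have "((\<lambda>s. norm (\<omega> s - \<omega> t) / \<alpha>) \<longlongrightarrow> norm (\<omega> t - \<omega> t) / \<alpha>) (at t within {0..T})"
      using \<alpha> by (intro tendsto_intros) auto
    then show "((\<lambda>s. norm (\<omega> s - \<omega> t) / \<alpha>) \<longlongrightarrow> 0) (at t within {0..T})" by simp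
  qed
  show "continuous_on {0..T} (\<lambda>t. advect \<eta> (v t))"
  proof (rule continuous_advect[OF \<eta>(1) _ _ \<eta>(2) v])
    show "stream (coef (\<eta> - \<eta>)) 0"
      by (simp add: stream_def hermitian_def ell2_def coef_diff)
  qed (rule tendsto_const)
qed

text \<open>The fundamental theorem of calculus for a continuous integrand with values in
  \<open>L2T\<close>; the derivative is thus taken in L2, not in W^{3,2}.\<close>

lemma b_deriv:
  assumes t: "t \<in> {0..T}"
  shows "(b has_vector_derivative - advect (\<psi> t) (b t)) (at t within {0..T})"
proof -
  have eq: "b t = b\<^sub>0 - integral {0..t} (\<lambda>\<tau>. advect (\<psi> \<tau>) (b \<tau>))" if "t \<in> {0..T}" for t
    using sol that by (simp add: local_strong_solution_def advect_def velocity_psi)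
  have "((\<lambda>t. b\<^sub>0 - integral {0..t} (\<lambda>\<tau>. advect (\<psi> \<tau>) (b \<tau>))) has_vector_derivative 0 - advect (\<psi> t) (b t)) (at t within {0..T})"
    by (intro has_vector_derivative_diff has_vector_derivative_const integral_has_vector_derivative t
        continuous_flux(1)[OF cb]) simp
  then show ?thesis unfolding diff_0 by (rule has_vector_derivative_transform[OF t eq, rotated])
qed

lemma w_deriv:
  assumes t: "t \<in> {0..T}"
  shows "(\<omega> has_vector_derivative - \<omega>' t) (at t within {0..T})"
proof -
  have F: "advect (\<psi> t) (\<omega> t - b t) + advect \<eta> (b t) = \<omega>' t" if "t \<in> {0..T}" for t
    unfolding \<omega>'_def advect_diff_right[OF psi_props w1[OF that] b1[OF that]] ..
  have c: "continuous_on {0..T} \<omega>'"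
    unfolding \<omega>'_def[abs_def] by (intro continuous_intros continuous_flux[OF cb] continuous_flux[OF cw]) auto
  have eq: "\<omega> t = \<omega>\<^sub>0 - integral {0..t} \<omega>'" if "t \<in> {0..T}" for t
  proof -
    have "\<omega> t = \<omega>\<^sub>0 - integral {0..t} (\<lambda>\<tau>. advect (\<psi> \<tau>) (\<omega> \<tau> - b \<tau>) + advect \<eta> (b \<tau>))"
      using sol that by (simp add: local_strong_solution_def advect_def velocity_psi)
    also have "integral {0..t} (\<lambda>\<tau>. advect (\<psi> \<tau>) (\<omega> \<tau> - b \<tau>) + advect \<eta> (b \<tau>)) = integral {0..t} \<omega>'"
      by (rule integral_cong) (use F that in auto)
    finally show ?thesis .
  qed
  have "((\<lambda>t. \<omega>\<^sub>0 - integral {0..t} \<omega>') has_vector_derivative 0 - \<omega>' t) (at t within {0..T})"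
    by (intro has_vector_derivative_diff has_vector_derivative_const integral_has_vector_derivative t c)
  then show ?thesis unfolding diff_0 by (rule has_vector_derivative_transform[OF t eq, rotated])
qed

lemma square_norm_deriv:
  fixes v :: "real \<Rightarrow> 'v::real_inner"
  assumes "(v has_vector_derivative v') (at t within S)"
  shows "((\<lambda>t. (norm (v t))^2) has_real_derivative 2 * inner (v t) v') (at t within S)"
proof -
  have "((\<lambda>t. inner (v t) (v t)) has_vector_derivative inner (v t) v' + inner v' (v t)) (at t within S)"
    by (rule bounded_bilinear.has_vector_derivative[OF bounded_bilinear_inner assms assms])
  then show ?thesis
    by (simp add: has_real_derivative_iff_has_vector_derivative power2_norm_eq_inner inner_commute)
qed

section \<open>The L2 estimate for the vorticity\<close>

definition growth :: real where
  "growth = 128 * pi^2 * ((2 + norm f) / \<alpha> + H)"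

text \<open>The forcing is at most quadratic in x = |\<open>\<omega> t\<close>|, with linear terms
  from \<open>f\<close> and \<open>\<eta>\<close>; 2 x <= 1 + x^2 absorbs them, so Gronwall is run
  on 1 + x^2. From 2 x (x + |f|) <= (2 + |f|) (1 + x^2) and 2 x H <= H (1 + x^2) comes the constant
  \<open>growth\<close>.\<close>

lemma inner_w_bound:
  assumes t: "t \<in> {0..T}"
  shows "2 * inner (\<omega> t) (- \<omega>' t) \<le> growth * top_norm 1 (b t) * (1 + (norm (\<omega> t))^2)"
proof -
  let ?x = "norm (\<omega> t)" and ?G = "top_norm 1 (b t)" and ?C = "128 * pi^2"
  have 0: "inner (\<omega> t) (advect (\<psi> t) (\<omega> t)) = 0"
    by (rule inner_jac_eq_0[OF psi_props(2) ell2_top_norm_1 coef_advect[OF psi_props]]) (use w1[OF t] in auto)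
  have "2 * inner (\<omega> t) (- \<omega>' t) = 2 * inner (\<omega> t) (advect (\<psi> t) (b t)) + 2 * (- inner (\<omega> t) (advect \<eta> (b t)))"
    by (simp add: \<omega>'_def inner_diff_right inner_add_right 0)
  also have "\<dots> \<le> 2 * (?x * norm (advect (\<psi> t) (b t))) + 2 * (?x * norm (advect \<eta> (b t)))"
    using norm_cauchy_schwarz[of "\<omega> t" "advect (\<psi> t) (b t)"] norm_cauchy_schwarz[of "\<omega> t" "- advect \<eta> (b t)"]
    by simp
  also have "\<dots> \<le> 2 * (?x * (?C * (norm (\<omega> t - f) / \<alpha>) * ?G)) + 2 * (?x * (?C * H * ?G))"
    by (intro add_mono mult_left_mono norm_advect_le psi_props \<eta> b1[OF t]) auto
  also have "\<dots> \<le> 2 * (?x * (?C * ((?x + norm f) / \<alpha>) * ?G)) + 2 * (?x * (?C * H * ?G))"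
    using \<alpha> norm_triangle_ineq4[of "\<omega> t" f]
    by (intro add_right_mono mult_left_mono mult_right_mono divide_right_mono) auto
  also have "\<dots> = ?C * ?G * ((2 * ?x^2 + 2 * ?x * norm f) / \<alpha> + 2 * ?x * H)"
    by (simp add: power2_eq_square add_divide_distrib algebra_simps)
  also have "\<dots> \<le> ?C * ?G * ((2 * (1 + ?x^2) + norm f * (1 + ?x^2)) / \<alpha> + H * (1 + ?x^2))"
  proof -
    have x: "2 * ?x \<le> 1 + ?x^2" using sum_squares_bound[of 1 ?x] by simp
    have "2 * ?x * norm f \<le> norm f * (1 + ?x^2)" "2 * ?x * H \<le> H * (1 + ?x^2)"
      using mult_right_mono[OF x, of "norm f"] mult_right_mono[OF x H0] by (simp_all add: mult.commute)
    then show ?thesis using \<alpha> by (intro mult_left_mono add_mono divide_right_mono) auto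
  qed
  also have "\<dots> = growth * ?G * (1 + ?x^2)"
    by (simp add: growth_def add_divide_distrib algebra_simps)
  finally show ?thesis .
qed

lemma continuous_top_norm:
  "continuous_on {0..T} (\<lambda>t. top_norm 1 (b t))" "continuous_on {0..T} (\<lambda>t. (top_norm 3 (b t))^2 + (top_norm 2 (\<omega> t))^2)"
  unfolding top_norm_def by (intro continuous_intros continuous_sobD[OF cb] continuous_sobD[OF cw]; simp)+

lemma w_bound:
  assumes t: "t \<in> {0..T}" and K: "integral {0..t} (\<lambda>s. top_norm 1 (b s)) \<le> K"
  shows "1 + (norm (\<omega> t))^2 \<le> (1 + (norm (\<omega> 0))^2) * exp (growth * K)"
proof -
  have g0: "0 \<le> growth" using \<alpha> H0 by (simp add: growth_def)
  have "1 + (norm (\<omega> t))^2 \<le> (1 + (norm (\<omega> 0))^2) * exp (integral {0..t} (\<lambda>s. growth * top_norm 1 (b s)))"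
  proof (rule gronwall[OF _ _ inner_w_bound t])
    show "continuous_on {0..T} (\<lambda>s. growth * top_norm 1 (b s))"
      by (intro continuous_intros continuous_top_norm)
    show "((\<lambda>t. 1 + (norm (\<omega> t))^2) has_real_derivative 2 * inner (\<omega> t) (- \<omega>' t)) (at t within {0..T})" if "t \<in> {0..T}" for t
      using DERIV_add[OF DERIV_const square_norm_deriv[OF w_deriv[OF that]], of 1] by simp
  qed auto
  also have "\<dots> \<le> (1 + (norm (\<omega> 0))^2) * exp (growth * K)"
    using mult_left_mono[OF K g0] by (intro mult_left_mono) (auto simp: add_nonneg_nonneg)
  finally show ?thesis .
qed

section \<open>The top order energy\<close>

definition Q :: "real \<Rightarrow> real" where
  "Q t = (top_norm 3 (b t))^2 + (top_norm 2 (\<omega> t))^2"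

definition energy :: "nat \<Rightarrow> real \<Rightarrow> real" where
  "energy N t = (\<Sum>k\<in>grid N. wt 6 N (wnorm k) * (cmod (coef (b t) k))^2 + wt 4 N (wnorm k) * (cmod (coef (\<omega> t) k))^2)"

text \<open>Each equation contributes its transport with a minus sign; the plus sign belongs to the
  \<open>b\<close> part of the flux of \<open>\<omega> - b\<close>.\<close>

definition energy' :: "nat \<Rightarrow> real \<Rightarrow> real" where
  "energy' N t = - box_pairing 6 N (coef (b t)) (coef (\<psi> t)) (coef (b t))
    - box_pairing 4 N (coef (\<omega> t)) (coef (\<psi> t)) (coef (\<omega> t))
    + box_pairing 4 N (coef (\<omega> t)) (coef (\<psi> t)) (coef (b t))
    - box_pairing 4 N (coef (\<omega> t)) (coef \<eta>) (coef (b t))"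

lemma coef_square_deriv:
  assumes "(v has_vector_derivative - g) (at t within S)"
  shows "((\<lambda>t. (cmod (coef (v t) k))^2) has_real_derivative - (2 * Re (cnj (coef (v t) k) * coef g k))) (at t within S)"
proof -
  have "((\<lambda>t. coef (v t) k) has_vector_derivative coef (- g) k) (at t within S)"
    by (rule bounded_linear.has_vector_derivative[OF bounded_linear_coef assms])
  from square_norm_deriv[OF this] show ?thesis
    by (simp add: coef_uminus inner_complex_def algebra_simps)
qed

lemma energy_deriv:
  assumes t: "t \<in> {0..T}"
  shows "(energy N has_real_derivative energy' N t) (at t within {0..T})"
proof -
  note b = coef_square_deriv[OF b_deriv[OF t], unfolded coef_advect[OF psi_props b1[OF t]]]
  note w = coef_square_deriv[OF w_deriv[OF t]]
  have w': "coef (\<omega>' t) k = jac (coef (\<psi> t)) (coef (\<omega> t)) k - jac (coef (\<psi> t)) (coef (b t)) k + jac (coef \<eta>) (coef (b t)) k" for k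
    unfolding \<omega>'_def coef_add coef_diff coef_advect[OF psi_props b1[OF t]] coef_advect[OF psi_props w1[OF t]]
      coef_advect[OF \<eta> b1[OF t]] ..
  have "(energy N has_real_derivative (\<Sum>k\<in>grid N.
      wt 6 N (wnorm k) * - (2 * Re (cnj (coef (b t) k) * jac (coef (\<psi> t)) (coef (b t)) k))
      + wt 4 N (wnorm k) * - (2 * Re (cnj (coef (\<omega> t) k) * coef (\<omega>' t) k)))) (at t within {0..T})"
    unfolding energy_def[abs_def] by (intro DERIV_sum DERIV_add DERIV_cmult b w)
  moreover have "(\<Sum>k\<in>grid N.
      wt 6 N (wnorm k) * - (2 * Re (cnj (coef (b t) k) * jac (coef (\<psi> t)) (coef (b t)) k))
      + wt 4 N (wnorm k) * - (2 * Re (cnj (coef (\<omega> t) k) * coef (\<omega>' t) k))) = energy' N t"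
    unfolding energy'_def sum_negf[symmetric] sum_subtractf[symmetric] sum.distrib[symmetric] w'
    by (rule sum.cong[OF refl]) (simp add: algebra_simps)
  ultimately show ?thesis by simp
qed

text \<open>The two transport terms together give P Q and the two mixed ones, by X Y <= Q, give (P +
  H) Q. The bound is linear in \<open>Q t\<close> because P <= R / \<open>\<alpha>\<close> depends
  on the L2 size of \<open>\<omega>\<close> alone.\<close>

lemma energy'_le:
  assumes t: "t \<in> {0..T}" and N: "0 < N" and R: "norm (\<omega> t - f) \<le> R"
  shows "energy' N t \<le> 10^4 * pi^2 * (2 * R / \<alpha> + H) * Q t"
proof -
  let ?P = "norm (\<omega> t - f) / \<alpha>" and ?X = "top_norm 3 (b t)" and ?Y = "top_norm 2 (\<omega> t)" and ?C = "10^4 * pi^2 :: real"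
  have P: "0 \<le> ?P" "?P \<le> R / \<alpha>" using \<alpha> R by (auto simp: divide_right_mono)
  have x: "ell2 (\<lambda>k. wnorm k ^ 3 * cmod (coef (b t) k)) ?X" by (rule ell2_top_norm[OF bW[OF t]])
  have y: "ell2 (\<lambda>k. wnorm k ^ 2 * cmod (coef (\<omega> t) k)) ?Y" by (rule ell2_top_norm[OF wW[OF t]])
  have 1: "\<bar>box_pairing 6 N (coef (b t)) (coef (\<psi> t)) (coef (b t))\<bar> \<le> ?C * ?P * ?X^2"
    using sum_box_transport_le[OF psi_props(2)[of t] ell2_coef[of "b t"], of 1 ?X N] x N by (simp add: numeral_eq_Suc)
  have 2: "\<bar>box_pairing 4 N (coef (\<omega> t)) (coef (\<psi> t)) (coef (\<omega> t))\<bar> \<le> ?C * ?P * ?Y^2"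
    using sum_box_transport_le[OF psi_props(2)[of t] ell2_coef[of "\<omega> t"], of 0 ?Y N] y N zero_mode[OF t] by (simp add: numeral_eq_Suc)
  have 3: "\<bar>box_pairing 4 N (coef (\<omega> t)) (coef (\<psi> t)) (coef (b t))\<bar> \<le> ?C * ?P * ?X * ?Y"
    by (rule sum_box_forcing_le[OF psi_props(2) x y zero_mode(2)[OF t] N])
  have 4: "\<bar>box_pairing 4 N (coef (\<omega> t)) (coef \<eta>) (coef (b t))\<bar> \<le> ?C * H * ?X * ?Y"
    by (rule sum_box_forcing_le[OF \<eta>(2) x y zero_mode(2)[OF t] N])
  have XY: "?X * ?Y \<le> Q t" "0 \<le> Q t"
    using sum_squares_bound[of ?X ?Y] zero_le_power2[of ?X] zero_le_power2[of ?Y]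
    by (auto simp: Q_def simp del: zero_le_power2) (simp add: mult.assoc, smt (verit) mult_nonneg_nonneg top_norm_nonneg)
  have "energy' N t \<le> ?C * ?P * ?X^2 + ?C * ?P * ?Y^2 + ?C * ?P * ?X * ?Y + ?C * H * ?X * ?Y"
    unfolding energy'_def using 1 2 3 4 by linarith
  also have "\<dots> = ?C * (?P * Q t + (?P + H) * (?X * ?Y))" by (simp add: Q_def algebra_simps)
  also have "\<dots> \<le> ?C * (R / \<alpha> * Q t + (R / \<alpha> + H) * Q t)"
    using P H0 XY by (intro mult_left_mono add_mono mult_mono) auto
  also have "\<dots> = 10^4 * pi^2 * (2 * R / \<alpha> + H) * Q t" by (simp add: algebra_simps)
  finally show ?thesis .
qed

text \<open>Continuity is all that is established for \<open>Q\<close> in time; it makes the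
  integral of \<open>Q\<close> differentiable, which is what Gronwall needs later.\<close>

lemma continuous_Q: "continuous_on {0..T} Q"
  unfolding Q_def[abs_def] by (rule continuous_top_norm)

text \<open>The growth of a truncated energy is controlled by the full \<open>Q\<close>, not by
  itself, so it is only integrated here; Gronwall has to wait until N has gone to infinity.\<close>

lemma energy_le:
  assumes t: "t \<in> {0..T}" and N: "0 < N" and M: "\<And>s. s \<in> {0..T} \<Longrightarrow> energy' N s \<le> M * Q s"
  shows "energy N t \<le> Q 0 + M * integral {0..t} Q"
proof -
  have "energy N t - M * integral {0..t} Q \<le> energy N 0 - M * integral {0..0} Q"
  proof (rule deriv_nonpos_imp_le_initial[OF _ _ t, where g = "\<lambda>t. energy N t - M * integral {0..t} Q"])
    fix s assume s: "s \<in> {0..T}"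
    show "((\<lambda>t. energy N t - M * integral {0..t} Q) has_real_derivative energy' N s - M * Q s) (at s within {0..T})"
      by (intro DERIV_diff energy_deriv s DERIV_cmult integral_has_real_derivative continuous_Q)
    show "energy' N s - M * Q s \<le> 0" using M[OF s] by simp
  qed
  moreover have "energy N 0 \<le> Q 0"
  proof -
    have 0: "0 \<in> {0..T}" using T by simp
    have "energy N 0 \<le> (\<Sum>k\<in>grid N. (wnorm k ^ 3 * cmod (coef (b 0) k))^2 + (wnorm k ^ 2 * cmod (coef (\<omega> 0) k))^2)"
      unfolding energy_def power_mult_distrib power_mult[symmetric]
      by (intro sum_mono add_mono mult_right_mono) (auto intro: wt_bounds(2))
    also have "\<dots> \<le> Q 0"
      unfolding sum.distrib Q_def using ell2_top_norm[OF bW[OF 0]] ell2_top_norm[OF wW[OF 0]]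
      by (intro add_mono) (auto simp: ell2_def)
    finally show ?thesis .
  qed
  ultimately show ?thesis by simp
qed

lemma wt_tendsto: "(\<lambda>N. wt n N r) \<longlonglongrightarrow> r ^ n"
proof -
  have "(\<lambda>N. r ^ n * max 0 (1 - r / real N)) \<longlonglongrightarrow> r ^ n * max 0 (1 - 0)"
    by (intro tendsto_intros lim_const_over_n)
  then show ?thesis by (simp add: wt_def)
qed

text \<open>For a fixed finite set of frequencies the weights tend to the full powers, so S bounds
  every finite sum. Each of the two squared top norms costs a factor 2 and at most (2 pi)^6, whence
  4 (2 pi)^6.\<close>

lemma Q_le:
  assumes t: "t \<in> {0..T}" and S: "\<And>N. 0 < N \<Longrightarrow> energy N t \<le> S"
  shows "Q t \<le> 4 * (2 * pi) ^ 6 * S"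
proof -
  let ?x = "\<lambda>k. (wnorm k ^ 3 * cmod (coef (b t) k))^2" and ?y = "\<lambda>k. (wnorm k ^ 2 * cmod (coef (\<omega> t) k))^2"
  have *: "(\<Sum>k\<in>F. ?x k + ?y k) \<le> S" if F: "finite F" for F
  proof (rule LIMSEQ_le_const2)
    have e: "?x k + ?y k = wnorm k ^ 6 * (cmod (coef (b t) k))^2 + wnorm k ^ 4 * (cmod (coef (\<omega> t) k))^2" for k
      unfolding power_mult_distrib power_mult[symmetric] by simp
    show "(\<lambda>N. \<Sum>k\<in>F. wt 6 N (wnorm k) * (cmod (coef (b t) k))^2 + wt 4 N (wnorm k) * (cmod (coef (\<omega> t) k))^2) \<longlonglongrightarrow> (\<Sum>k\<in>F. ?x k + ?y k)"
      unfolding e by (intro tendsto_intros wt_tendsto)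
    obtain n where n: "F \<subseteq> grid n" using finite_subset_box[OF F] by blast
    have "(\<Sum>k\<in>F. wt 6 N (wnorm k) * (cmod (coef (b t) k))^2 + wt 4 N (wnorm k) * (cmod (coef (\<omega> t) k))^2) \<le> S"
      if N: "N \<ge> Suc n" for N
    proof -
      have "(\<Sum>k\<in>F. wt 6 N (wnorm k) * (cmod (coef (b t) k))^2 + wt 4 N (wnorm k) * (cmod (coef (\<omega> t) k))^2) \<le> energy N t"
        unfolding energy_def
        by (rule sum_mono2) (use n N box_mono[of n N] wt_bounds(1)[OF wnorm_nonneg] in auto)
      also have "\<dots> \<le> S" using N by (intro S) auto
      finally show ?thesis .
    qed
    then show "\<exists>N0. \<forall>N\<ge>N0. (\<Sum>k\<in>F. wt 6 N (wnorm k) * (cmod (coef (b t) k))^2 + wt 4 N (wnorm k) * (cmod (coef (\<omega> t) k))^2) \<le> S"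
      by blast
  qed
  have S0: "0 \<le> S" using *[of "{}"] by simp
  have "(\<Sum>k\<in>F. ?x k) \<le> S \<and> (\<Sum>k\<in>F. ?y k) \<le> S" if F: "finite F" for F
    using *[OF F] sum_nonneg[of F ?x] sum_nonneg[of F ?y] unfolding sum.distrib by force
  then have "ell2 (\<lambda>k. wnorm k ^ 3 * cmod (coef (b t) k)) (sqrt S)" "ell2 (\<lambda>k. wnorm k ^ 2 * cmod (coef (\<omega> t) k)) (sqrt S)"
    unfolding ell2_def using S0 by auto
  from top_norm_le_ell2[OF bW[OF t] this(1)] top_norm_le_ell2[OF wW[OF t] this(2)]
  have "(top_norm 3 (b t))^2 \<le> 2 * (2 * pi) ^ 6 * S" "(top_norm 2 (\<omega> t))^2 \<le> 2 * (2 * pi) ^ 4 * S"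
    using S0 by (simp_all only: real_sqrt_pow2) simp_all
  moreover have "2 * (2 * pi) ^ 4 * S \<le> 2 * (2 * pi) ^ 6 * S"
    using S0 pi_ge_two by (intro mult_right_mono mult_left_mono power_increasing) auto
  ultimately show ?thesis unfolding Q_def by linarith
qed

text \<open>Gronwall for Q 0 + M times the integral of \<open>Q\<close>: its derivative is M
  \<open>Q\<close>, and \<open>Q\<close> is in turn bounded by a multiple of this function.
  \<open>R\<close> bounds the L2 norm of \<open>\<omega> - f\<close> on the whole interval.\<close>

lemma Q_bound:
  assumes t: "t \<in> {0..T}" and K: "\<And>s. s \<in> {0..T} \<Longrightarrow> integral {0..s} (\<lambda>r. top_norm 1 (b r)) \<le> K"
  defines "R \<equiv> (1 + (norm (\<omega> 0))^2) * exp (growth * K) + norm f"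
  shows "Q t \<le> 4 * (2 * pi) ^ 6 * (Q 0 * exp (10^4 * pi^2 * (2 * R / \<alpha> + H) * (4 * (2 * pi) ^ 6) * t))"
proof -
  let ?M = "10^4 * pi^2 * (2 * R / \<alpha> + H)" and ?C = "4 * (2 * pi) ^ 6 :: real"
  let ?S = "\<lambda>t. Q 0 + ?M * integral {0..t} Q"
  have R: "norm (\<omega> s - f) \<le> R" if s: "s \<in> {0..T}" for s
  proof -
    have "2 * norm (\<omega> s) \<le> 1 + (norm (\<omega> s))^2" using sum_squares_bound[of 1 "norm (\<omega> s)"] by simp
    then have "norm (\<omega> s) \<le> 1 + (norm (\<omega> s))^2" using norm_ge_zero[of "\<omega> s"] by linarith
    then show ?thesis using w_bound[OF s K[OF s]] norm_triangle_ineq4[of "\<omega> s" f] unfolding R_def by linarith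
  qed
  have "0 \<le> R" unfolding R_def by (intro add_nonneg_nonneg mult_nonneg_nonneg) auto
  then have M0: "0 \<le> ?M" using H0 \<alpha> by (intro mult_nonneg_nonneg add_nonneg_nonneg divide_nonneg_pos) auto
  have QS: "Q s \<le> ?C * ?S s" if s: "s \<in> {0..T}" for s
    by (rule Q_le[OF s energy_le[OF s _ energy'_le[OF _ _ R]]])
  have "?S t \<le> ?S 0 * exp (integral {0..t} (\<lambda>_. ?M * ?C))"
  proof (rule gronwall[OF _ _ _ t])
    fix s assume s: "s \<in> {0..T}"
    have "((\<lambda>t. Q 0 + ?M * integral {0..t} Q) has_real_derivative 0 + ?M * Q s) (at s within {0..T})"
      by (intro DERIV_add DERIV_const DERIV_cmult integral_has_real_derivative continuous_Q s)
    then show "((\<lambda>t. Q 0 + ?M * integral {0..t} Q) has_real_derivative ?M * Q s) (at s within {0..T})" by simp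
    show "?M * Q s \<le> ?M * ?C * ?S s"
      using mult_left_mono[OF QS[OF s] M0] by (simp only: mult.assoc)
  qed (intro continuous_intros)
  moreover have i0: "integral {0..0} Q = 0" by simp
  moreover have "integral {0..t} (\<lambda>_. c) = c * t" for c :: real using t by (simp add: mult.commute)
  ultimately have "?S t \<le> Q 0 * exp (?M * ?C * t)"
    by (simp only: i0 mult_zero_right add_0_right)
  then have "?C * ?S t \<le> ?C * (Q 0 * exp (?M * ?C * t))" by (intro mult_left_mono) auto
  then show ?thesis using QS[OF t] by linarith
qed

lemma norm_M_le:
  assumes t: "t \<in> {0..T}"
  shows "norm_M (b t, \<omega> t) \<le> (sqrt (card {(i, j). i + j \<le> (3::nat)}) * (2 * pi) ^ 3 + sqrt (card {(i, j). i + j \<le> (2::nat)}) * (2 * pi) ^ 2) * (1 + Q t)"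
proof -
  let ?c = "\<lambda>n::nat. sqrt (card {(i, j). i + j \<le> n}) * (2 * pi) ^ n"
  have le: "x \<le> 1 + x^2" if "0 \<le> x" for x :: real
    using sum_squares_bound[of 1 x] that by simp
  have "top_norm 3 (b t) \<le> 1 + Q t" "top_norm 2 (\<omega> t) \<le> 1 + Q t"
    using le[OF top_norm_nonneg, of 3 "b t"] le[OF top_norm_nonneg, of 2 "\<omega> t"]
      zero_le_power2[of "top_norm 3 (b t)"] zero_le_power2[of "top_norm 2 (\<omega> t)"]
    unfolding Q_def by (linarith, linarith)
  then have "?c 3 * top_norm 3 (b t) + ?c 2 * top_norm 2 (\<omega> t) \<le> ?c 3 * (1 + Q t) + ?c 2 * (1 + Q t)"
    by (intro add_mono mult_left_mono) auto
  moreover have "sob_norm 3 (b t) \<le> ?c 3 * top_norm 3 (b t)" "sob_norm 2 (\<omega> t) \<le> ?c 2 * top_norm 2 (\<omega> t)"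
    using sob_norm_le_top_norm[OF bW[OF t] zero_mode(1)[OF t]] sob_norm_le_top_norm[OF wW[OF t] zero_mode(2)[OF t]]
    by (simp_all only: mult.assoc)
  ultimately show ?thesis unfolding norm_M_def fst_conv snd_conv by (simp add: distrib_right)
qed

end

section \<open>The blow-up criterion\<close>

text \<open>\<open>\<eta>\<close> is half of \<open>h\<close>. Of the four powers of |k| one is
  supplied by passing to the velocity and three by its W^{3,2} regularity; at each frequency one
  velocity component suffices.\<close>

lemma stream_of_velocity:
  assumes h: "h \<in> W 1" and u: "(1/2) *\<^sub>R perp_grad h \<in> W_div 3"
  obtains \<eta> H where "\<eta> \<in> W 1" "stream (coef \<eta>) H" "perp_grad \<eta> = (1/2) *\<^sub>R perp_grad h"
proof -
  define \<eta> where "\<eta> = (1/2) *\<^sub>R h"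
  have d: "coef ((1/2) *\<^sub>R wderiv i j h) k = dmult i j k * coef \<eta> k" if "i + j \<le> 1" for i j k
    using coef_wderiv[OF h that, of k] by (simp add: coef_scaleR \<eta>_def)
  have w: "wderiv i j \<eta> = (1/2) *\<^sub>R wderiv i j h" if "i + j \<le> 1" for i j
    by (rule wderiv_eqI) (rule d[OF that])
  have W: "\<eta> \<in> W 1"
    unfolding W_def has_weak_deriv_iff using d by blast
  have e: "perp_grad \<eta> = (1/2) *\<^sub>R perp_grad h" by (simp add: perp_grad_def w)
  have u3: "wderiv 0 1 \<eta> \<in> W 3" "wderiv 1 0 \<eta> \<in> W 3"
  proof -
    have "- wderiv 0 1 \<eta> \<in> W 3" "wderiv 1 0 \<eta> \<in> W 3" using u unfolding e[symmetric] by (auto simp: W_div_def perp_grad_def)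
    \<comment> \<open>Used to remove the minus sign of the first velocity component by writing it as
      a difference from 0.\<close>
    moreover have "(0::L2T) \<in> W 3"
      unfolding W_def has_weak_deriv_iff by (auto intro!: exI[of _ 0])
    ultimately show "wderiv 0 1 \<eta> \<in> W 3" "wderiv 1 0 \<eta> \<in> W 3"
      using W_diff[of 0 3 "- wderiv 0 1 \<eta>"] by auto
  qed
  let ?x = "\<lambda>k. wnorm k ^ 3 * cmod (coef (wderiv 0 1 \<eta>) k)" and ?y = "\<lambda>k. wnorm k ^ 3 * cmod (coef (wderiv 1 0 \<eta>) k)"
  let ?X = "top_norm 3 (wderiv 0 1 \<eta>)" and ?Y = "top_norm 3 (wderiv 1 0 \<eta>)"
  have x: "ell2 ?x ?X" and y: "ell2 ?y ?Y" using ell2_top_norm u3 by auto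
  have le: "(wnorm k ^ 4 * cmod (coef \<eta> k))^2 \<le> (?x k)^2 + (?y k)^2" for k
  proof -
    have c: "cmod (coef (wderiv 0 1 \<eta>) k) = 2 * pi * \<bar>of_int (snd k)\<bar> * cmod (coef \<eta> k)"
      "cmod (coef (wderiv 1 0 \<eta>) k) = 2 * pi * \<bar>of_int (fst k)\<bar> * cmod (coef \<eta> k)"
      using coef_wderiv[OF W, of 0 1 k] coef_wderiv[OF W, of 1 0 k]
      by (simp_all add: dmult_simps norm_mult abs_mult)
    have g: "wnorm k ^ 4 * z \<le> wnorm k ^ 3 * (2 * pi * wnorm k * z)" if "0 \<le> z" for z
    proof -
      have "1 * (wnorm k ^ 4 * z) \<le> 2 * pi * (wnorm k ^ 4 * z)"
        using pi_ge_two that by (intro mult_right_mono) auto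
      then show ?thesis by (simp add: power_numeral_reduce mult_ac)
    qed
    have "wnorm k = \<bar>of_int (fst k)\<bar> \<or> wnorm k = \<bar>of_int (snd k)\<bar>" by (auto simp: wnorm_def max_def)
    then have "wnorm k ^ 4 * cmod (coef \<eta> k) \<le> ?x k \<or> wnorm k ^ 4 * cmod (coef \<eta> k) \<le> ?y k"
      unfolding c using g[of "cmod (coef \<eta> k)"] by auto
    then have "(wnorm k ^ 4 * cmod (coef \<eta> k))^2 \<le> (?x k)^2 \<or> (wnorm k ^ 4 * cmod (coef \<eta> k))^2 \<le> (?y k)^2"
      by (auto intro!: power_mono)
    then show ?thesis using zero_le_power2[of "?x k"] zero_le_power2[of "?y k"] by linarith
  qed
  have "ell2 (\<lambda>k. wnorm k ^ 4 * cmod (coef \<eta> k)) (sqrt (?X^2 + ?Y^2))"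
    unfolding ell2_def
  proof (intro conjI allI impI)
    fix F :: "freq set" assume F: "finite F"
    have "(\<Sum>k\<in>F. (wnorm k ^ 4 * cmod (coef \<eta> k))^2) \<le> (\<Sum>k\<in>F. (?x k)^2 + (?y k)^2)"
      by (intro sum_mono le)
    also have "\<dots> \<le> ?X^2 + ?Y^2"
      unfolding sum.distrib using x y F by (intro add_mono) (auto simp: ell2_def)
    finally show "(\<Sum>k\<in>F. (wnorm k ^ 4 * cmod (coef \<eta> k))^2) \<le> (sqrt (?X^2 + ?Y^2))^2" by simp
  qed simp
  then have "stream (coef \<eta>) (sqrt (?X^2 + ?Y^2))" by (simp add: stream_def hermitian_coef)
  then show ?thesis using that W e by blast
qed

text \<open>Compares the coefficient in the L2 estimate of \<open>\<omega>\<close> with the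
  integrand of the blow-up criterion.\<close>

lemma top_norm_1_le: "top_norm 1 v \<le> sob_norm_vec 1 (grad v)"
proof -
  have "norm w \<le> sob_norm 1 w" for w
    using norm_wderiv_le_sob_norm[of 0 0 1 w] by (simp add: wderiv_0_0)
  then show ?thesis unfolding top_norm_def sob_norm_vec_def grad_def fst_conv snd_conv
    by (intro real_sqrt_le_mono add_mono power_mono) auto
qed

lemma integral_top_norm_le:
  assumes c: "continuous_on {0..t} (\<lambda>s. top_norm 1 (b s))" and t: "ereal t \<le> Tmax"
    and K: "(\<integral>\<^sup>+s\<in>{s. 0 \<le> s \<and> ereal s < Tmax}. ennreal (sob_norm_vec 1 (grad (b s))) \<partial>lborel) = ennreal K" "0 \<le> K"
  shows "integral {0..t} (\<lambda>s. top_norm 1 (b s)) \<le> K"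
proof -
  have "((\<lambda>s. top_norm 1 (b s)) has_integral integral {0..t} (\<lambda>s. top_norm 1 (b s))) {0..t}"
    by (rule integrable_integral[OF integrable_continuous_real[OF c]])
  then have "ennreal (integral {0..t} (\<lambda>s. top_norm 1 (b s))) = (\<integral>\<^sup>+s\<in>{0..t}. ennreal (top_norm 1 (b s)) \<partial>lborel)"
    by (intro nn_integral_has_integral_lebesgue'[symmetric] top_norm_nonneg)
  also have "\<dots> \<le> (\<integral>\<^sup>+s\<in>{s. 0 \<le> s \<and> ereal s < Tmax}. ennreal (sob_norm_vec 1 (grad (b s))) \<partial>lborel)"
  proof (rule nn_integral_mono_AE)
    \<comment> \<open>If t equals the maximal time, the point t itself lies outside the larger
      domain of integration; as a null set it is discarded.\<close>
    show "AE s in lborel. ennreal (top_norm 1 (b s)) * indicator {0..t} s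
      \<le> ennreal (sob_norm_vec 1 (grad (b s))) * indicator {s. 0 \<le> s \<and> ereal s < Tmax} s"
      using AE_lborel_singleton[of t]
    proof eventually_elim
      case (elim s)
      show ?case
      proof (cases "0 \<le> s \<and> s \<le> t")
        case True
        then have "ereal s < ereal t" using elim by simp
        then have "ereal s < Tmax" using t by (rule less_le_trans)
        then show ?thesis using True ennreal_leI[OF top_norm_1_le[of "b s"]] by simp
      qed auto
    qed
  qed
  finally show ?thesis unfolding K(1) ennreal_le_iff[OF K(2)] .
qed

theorem theorem5p7:
  fixes \<alpha> :: real
    and h f b\<^sub>0 \<omega>\<^sub>0 :: L2T
    and u\<^sub>h :: "L2T \<times> L2T"
    and b \<omega> :: "real \<Rightarrow> L2T"
    and Tmax :: ereal
  assumes "\<alpha> > 0"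
    and "h \<in> W 1" and "zero_avg h"
    and "u\<^sub>h = (1/2) *\<^sub>R perp_grad h" and "u\<^sub>h \<in> W_div 3"
    and "f \<in> W 2" and "zero_avg f"
    and "b\<^sub>0 \<in> W 3" and "zero_avg b\<^sub>0"
    and "\<omega>\<^sub>0 \<in> W 2" and "zero_avg \<omega>\<^sub>0"
    and "maximal_solution \<alpha> u\<^sub>h f (b\<^sub>0, \<omega>\<^sub>0) b \<omega> Tmax"
    and "Tmax < \<infinity>"
  shows "(\<integral>\<^sup>+t\<in>{t. 0 \<le> t \<and> ereal t < Tmax}. ennreal (sob_norm_vec 1 (grad (b t))) \<partial>lborel) = \<infinity>"
proof (rule ccontr)
  let ?I = "\<integral>\<^sup>+t\<in>{t. 0 \<le> t \<and> ereal t < Tmax}. ennreal (sob_norm_vec 1 (grad (b t))) \<partial>lborel"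
  assume "?I \<noteq> \<infinity>"
  then obtain K where K: "?I = ennreal K" "0 \<le> K" by (cases ?I rule: ennreal_cases) auto
  obtain \<eta> H where \<eta>: "\<eta> \<in> W 1" "stream (coef \<eta>) H" "perp_grad \<eta> = u\<^sub>h"
    using stream_of_velocity[of h] assms(2,4,5) by metis
  obtain T where T: "incseq T" "(\<lambda>n. ereal (T n)) \<longlonglongrightarrow> Tmax"
    "\<And>n. local_strong_solution \<alpha> u\<^sub>h f (b\<^sub>0, \<omega>\<^sub>0) b \<omega> (T n)"
    "limsup (\<lambda>n. ereal ((norm_M (b (T n), \<omega> (T n)))^2)) = \<infinity>"
    using assms(12,13) unfolding maximal_solution_def by blast
  have T_le: "ereal (T n) \<le> Tmax" for n
    using incseq_le[OF _ T(2), of n] T(1) by (auto simp: incseq_def)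
  obtain S where S: "Tmax = ereal S"
    using T_le[of 0] assms(13) by (cases Tmax) auto
  have sol: "tqg_solution \<alpha> (T n) H f \<eta> b\<^sub>0 \<omega>\<^sub>0 b \<omega>" for n
    using assms(1) \<eta> T(3) by unfold_locales auto
  define Q\<^sub>0 where "Q\<^sub>0 = (top_norm 3 (b 0))^2 + (top_norm 2 (\<omega> 0))^2"
  \<comment> \<open>These repeat the constants of \<open>Q_bound\<close>, with the time replaced by
    the upper bound S in the exponent, so that B is independent of n.\<close>
  define R where "R = (1 + (norm (\<omega> 0))^2) * exp (128 * pi^2 * ((2 + norm f) / \<alpha> + H) * K) + norm f"
  define M where "M = 10^4 * pi^2 * (2 * R / \<alpha> + H) * (4 * (2 * pi) ^ 6)"
  define B where "B = (sqrt (card {(i, j). i + j \<le> (3::nat)}) * (2 * pi) ^ 3 + sqrt (card {(i, j). i + j \<le> (2::nat)}) * (2 * pi) ^ 2)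
    * (1 + 4 * (2 * pi) ^ 6 * (Q\<^sub>0 * exp (M * S)))"
  have "norm_M (b (T n), \<omega> (T n)) \<le> B" for n
  proof -
    interpret tqg_solution \<alpha> "T n" H f \<eta> b\<^sub>0 \<omega>\<^sub>0 b \<omega> by (rule sol)
    have Tn: "T n \<in> {0..T n}" using T by simp
    have K': "integral {0..s} (\<lambda>r. top_norm 1 (b r)) \<le> K" if "s \<in> {0..T n}" for s
    proof (rule integral_top_norm_le[OF _ _ K])
      show "continuous_on {0..s} (\<lambda>r. top_norm 1 (b r))"
        using that by (intro continuous_on_subset[OF continuous_top_norm(1)]) auto
      show "ereal s \<le> Tmax" using that by (intro order_trans[OF _ T_le[of n]]) auto
    qed
    have M0: "0 \<le> M"
      using H0 \<alpha> by (auto simp: M_def R_def intro!: mult_nonneg_nonneg add_nonneg_nonneg)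
    have Q0: "Q 0 = Q\<^sub>0" "0 \<le> Q\<^sub>0" by (simp_all add: Q_def Q\<^sub>0_def)
    have "T n \<le> S" using T_le[of n] S by simp
    then have "Q\<^sub>0 * exp (M * T n) \<le> Q\<^sub>0 * exp (M * S)"
      using M0 Q0 by (intro mult_left_mono) (auto intro: mult_left_mono)
    moreover have "Q (T n) \<le> 4 * (2 * pi) ^ 6 * (Q\<^sub>0 * exp (M * T n))"
      using Q_bound[OF Tn K'] by (simp add: M_def R_def growth_def Q0)
    ultimately have "1 + Q (T n) \<le> 1 + 4 * (2 * pi) ^ 6 * (Q\<^sub>0 * exp (M * S))"
      by (meson add_left_mono mult_left_mono order_trans zero_le_mult_iff zero_le_numeral zero_le_power pi_ge_zero)
    then show ?thesis
      unfolding B_def by (intro order_trans[OF norm_M_le[OF Tn]] mult_left_mono) auto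
  qed
  moreover have "0 \<le> norm_M z" for z
    by (auto simp: norm_M_def sob_norm_def intro!: add_nonneg_nonneg real_sqrt_ge_zero sum_nonneg)
  ultimately have "(norm_M (b (T n), \<omega> (T n)))^2 \<le> B^2" for n
    by (intro power_mono)
  then have "limsup (\<lambda>n. ereal ((norm_M (b (T n), \<omega> (T n)))^2)) \<le> ereal (B^2)"
    by (intro Limsup_bounded) auto
  then show False using T(4) by simp
qed

end
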